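(* The limit sketch of topological spaces $\mathcal{T}$ (built from the characterization of topological spaces in terms of net convergence, and defined in the context) is a large realized limit sketch with $$\mathsf{Top} \simeq \mathrm{Mod}(\mathcal{T}).$$ Moreover, every $\mathcal{T}$-model is small.
   Context: Conventions: categories are locally small unless otherwise stated; limits, colimits, cones and cocones are indexed by small categories. A limit sketch consists of a category and a class of ("distinguished") cones in it; it is small if the category is small and the class of cones is a set, and large otherwise. A model is a functor to $\mathsf{Set}$ mapping distinguished cones to limit cones; $\mathrm{Mod}$ denotes the category of models and natural transformations. The sketch is realized if all representable functors $\mathrm{Hom}(A,-)$ are models ("representable models"). A model of a realized limit sketch is small if it is a (small) colimit, taken in the category of models, of representable models. Colimit sketches are defined dually; if $(\mathcal{E},\mathcal{S})$ is a colimit sketch, $(\mathcal{E}^{\mathrm{op}},\mathcal{S}^{\mathrm{op}})$ is a limit sketch. Directed sets are non-empty preordered sets in which any two elements have an upper bound. $P_{\ge p}:=\{q\in P: q\ge p\}$. A map $h:Q\to P$ of directed sets (not necessarily monotonic) is cofinal if for every $p\in P$ there is $q\in Q$ with $h(Q_{\ge q})\subseteq P_{\ge p}$. A subset $Q\subseteq P$ is cofinal if every $p\in P$ has some $q\in Q$ with $q\ge p$. For a directed set $P$, the space $P\cup\{\infty\}$ (with $\infty\notin P$) has the topology in which every subset of $P$ is open and the sets $P_{\ge p}\cup\{\infty\}$, $p\in P$, form a local base at $\infty$. $P$, $P\sqcup 1$ carry the discrete topology, and $P\sqcup 1\to P\cup\{\infty\}$ is the canonical bijection. The epimorphism cocone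 of a morphism $f:A\to B$ is the cocone $(\mathrm{id}_B:B\to B,\ \mathrm{id}_B:B\to B)$ on the span $B\xleftarrow{f}A\xrightarrow{f}B$ (it is a colimit cocone iff $f$ is an epimorphism). Definition of $\mathcal{T}$: let $\mathcal{E}\subseteq\mathsf{Top}$ be the full subcategory and $\mathcal{S}$ the class of cocones in $\mathcal{E}$ consisting exactly of the following. (1) Every discrete space $I$ is in $\mathcal{E}$, and the coproduct cocone $(i:1\to I)_{i\in I}$ is in $\mathcal{S}$. (2) For every directed set $P$ the space $P\cup\{\infty\}$ is in $\mathcal{E}$, and the epimorphism cocone of $P\sqcup1\to P\cup\{\infty\}$ is in $\mathcal{S}$. (3) For every directed set $P$ and every family $h=(h_Q:R_Q\to Q)$ of cofinal maps from directed sets $R_Q$, indexed by the cofinal subsets $Q\subseteq P$, and every colimit cocone in $\mathsf{Top}$ with vertex $F(P,h)$ on the diagram consisting of the spans $R_Q\cup\{\infty\}\leftarrow R_Q\sqcup 1\to P\sqcup 1$ (right map induced by $h_Q$ and the inclusion $Q\subseteq P$; $Q$ varies over all cofinal subsets, $P\sqcup1$ is one common object), we have $F(P,h)\in\mathcal{E}$ and this cocone is in $\mathcal{S}$. (4) For every directed set $P$ and every family $Q=(Q_p)_{p\in P}$ of directed sets and every colimit cocone in $\mathsf{Top}$ with vertex $G(P,Q)$ on the diagram consisting of the spans $Q_p\cup\{\infty\}\xleftarrow{\infty}1\xrightarrow{p}P\cup\{\infty\}$ ($p$ varies over $P$, $P\cup\{\infty\}$ is one common object), we have $G(P,Q)\in\mathcal{E}$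 and this cocone is in $\mathcal{S}$. (So $G(P,Q)$ is the pushout of $\coprod_{p\in P}(Q_p\cup\{\infty\})\leftarrow P\to P\cup\{\infty\}$, where $p\mapsto\infty\in Q_p\cup\{\infty\}$.) Then $\mathcal{T}:=(\mathcal{E}^{\mathrm{op}},\mathcal{S}^{\mathrm{op}})$. *)

theory Defs
  imports "HOL-Analysis.Analysis"
begin

unbundle cardinal_syntax

section \<open>Smallness\<close>

text \<open>
  A type \<open>'u\<close> of inaccessible cardinality plays the role of the universe of sets: a collection
  (of elements of any type) is small, that is, a set as opposed to a proper class, if it has
  fewer elements than \<open>'u\<close>. Small sets and small spaces are represented on subsets of \<open>'u\<close>;
  every small collection is in bijection with such a subset.
\<close>

definition small :: "'u itself \<Rightarrow> 'a set \<Rightarrow> bool" where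
  "small _ A \<longleftrightarrow> |A| <o |UNIV :: 'u set|"

definition inaccessible :: "'u itself \<Rightarrow> bool" where
  "inaccessible U \<longleftrightarrow>
     uncountable (UNIV :: 'u set) \<and>
     (\<forall>A :: 'u set. small U A \<longrightarrow> small U (Pow A)) \<and>
     (\<forall>(A :: 'u set) (B :: 'u \<Rightarrow> 'u set).
        small U A \<longrightarrow> (\<forall>a\<in>A. small U (B a)) \<longrightarrow> small U (\<Union>a\<in>A. B a))"


section \<open>Categories, functors, natural transformations\<close>

record ('o, 'm) cat =
  Obj :: "'o set"
  Arr :: "'m set"
  Dom :: "'m \<Rightarrow> 'o"
  Cod :: "'m \<Rightarrow> 'o"
  Id :: "'o \<Rightarrow> 'm"
  Comp :: "'m \<Rightarrow> 'm \<Rightarrow> 'm"   \<comment> \<open>\<open>Comp C g f\<close> is g after f\<close>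

definition Hom :: "('o, 'm) cat \<Rightarrow> 'o \<Rightarrow> 'o \<Rightarrow> 'm set" where
  "Hom C a b = {f \<in> Arr C. Dom C f = a \<and> Cod C f = b}"

locale category =
  fixes C :: "('o, 'm) cat"
  assumes dom_cod: "f \<in> Arr C \<Longrightarrow> Dom C f \<in> Obj C \<and> Cod C f \<in> Obj C"
    and id_hom: "a \<in> Obj C \<Longrightarrow> Id C a \<in> Hom C a a"
    and comp_hom: "\<lbrakk>f \<in> Hom C a b; g \<in> Hom C b c\<rbrakk> \<Longrightarrow> Comp C g f \<in> Hom C a c"
    and id_left: "f \<in> Hom C a b \<Longrightarrow> Comp C (Id C b) f = f"
    and id_right: "f \<in> Hom C a b \<Longrightarrow> Comp C f (Id C a) = f"
    and assoc: "\<lbrakk>f \<in> Hom C a b; g \<in> Hom C b c; h \<in> Hom C c d\<rbrakk>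
      \<Longrightarrow> Comp C h (Comp C g f) = Comp C (Comp C h g) f"

definition small_category :: "'u itself \<Rightarrow> ('o, 'm) cat \<Rightarrow> bool" where
  "small_category U C \<longleftrightarrow> category C \<and> small U (Obj C) \<and> small U (Arr C)"

definition locally_small :: "'u itself \<Rightarrow> ('o, 'm) cat \<Rightarrow> bool" where
  "locally_small U C \<longleftrightarrow> (\<forall>a\<in>Obj C. \<forall>b\<in>Obj C. small U (Hom C a b))"

definition op_cat :: "('o, 'm) cat \<Rightarrow> ('o, 'm) cat" where
  "op_cat C = \<lparr>Obj = Obj C, Arr = Arr C, Dom = Cod C, Cod = Dom C, Id = Id C,
     Comp = (\<lambda>g f. Comp C f g)\<rparr>"

definition full_subcat :: "('o, 'm) cat \<Rightarrow> 'o set \<Rightarrow> ('o, 'm) cat" where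
  "full_subcat C A = C\<lparr>Obj := A, Arr := {f \<in> Arr C. Dom C f \<in> A \<and> Cod C f \<in> A}\<rparr>"

definition is_iso :: "('o, 'm) cat \<Rightarrow> 'm \<Rightarrow> bool" where
  "is_iso C f \<longleftrightarrow> f \<in> Arr C \<and>
     (\<exists>g \<in> Hom C (Cod C f) (Dom C f).
        Comp C g f = Id C (Dom C f) \<and> Comp C f g = Id C (Cod C f))"

text \<open>
  Functors, families of legs and natural transformations are extensional (\<open>undefined\<close>
  outside their domain), so that equality of functors is equality on objects and arrows.
\<close>

record ('o1, 'm1, 'o2, 'm2) fctr =
  ob_map :: "'o1 \<Rightarrow> 'o2"
  arr_map :: "'m1 \<Rightarrow> 'm2"

definition is_functor ::
  "('o1, 'm1) cat \<Rightarrow> ('o2, 'm2) cat \<Rightarrow> ('o1, 'm1, 'o2, 'm2) fctr \<Rightarrow> bool" where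
  "is_functor C D F \<longleftrightarrow>
     category C \<and> category D \<and>
     ob_map F \<in> Obj C \<rightarrow>\<^sub>E Obj D \<and> arr_map F \<in> Arr C \<rightarrow>\<^sub>E Arr D \<and>
     (\<forall>f\<in>Arr C. Dom D (arr_map F f) = ob_map F (Dom C f) \<and>
                Cod D (arr_map F f) = ob_map F (Cod C f)) \<and>
     (\<forall>a\<in>Obj C. arr_map F (Id C a) = Id D (ob_map F a)) \<and>
     (\<forall>f\<in>Arr C. \<forall>g\<in>Arr C. Dom C g = Cod C f \<longrightarrow>
        arr_map F (Comp C g f) = Comp D (arr_map F g) (arr_map F f))"

definition id_functor :: "('o, 'm) cat \<Rightarrow> ('o, 'm, 'o, 'm) fctr" where
  "id_functor C = \<lparr>ob_map = (\<lambda>a\<in>Obj C. a), arr_map = (\<lambda>f\<in>Arr C. f)\<rparr>"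

definition comp_functor ::
  "('o1, 'm1) cat \<Rightarrow> ('o2, 'm2, 'o3, 'm3) fctr \<Rightarrow> ('o1, 'm1, 'o2, 'm2) fctr
     \<Rightarrow> ('o1, 'm1, 'o3, 'm3) fctr" where
  "comp_functor C G F = \<lparr>ob_map = compose (Obj C) (ob_map G) (ob_map F),
     arr_map = compose (Arr C) (arr_map G) (arr_map F)\<rparr>"

definition nat_trans ::
  "('o1, 'm1) cat \<Rightarrow> ('o2, 'm2) cat \<Rightarrow> ('o1, 'm1, 'o2, 'm2) fctr \<Rightarrow> ('o1, 'm1, 'o2, 'm2) fctr
     \<Rightarrow> ('o1 \<Rightarrow> 'm2) \<Rightarrow> bool" where
  "nat_trans C D F G \<eta> \<longleftrightarrow>
     is_functor C D F \<and> is_functor C D G \<and> \<eta> \<in> extensional (Obj C) \<and>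
     (\<forall>a\<in>Obj C. \<eta> a \<in> Hom D (ob_map F a) (ob_map G a)) \<and>
     (\<forall>f\<in>Arr C. Comp D (arr_map G f) (\<eta> (Dom C f)) = Comp D (\<eta> (Cod C f)) (arr_map F f))"

definition naturally_isomorphic ::
  "('o1, 'm1) cat \<Rightarrow> ('o2, 'm2) cat \<Rightarrow> ('o1, 'm1, 'o2, 'm2) fctr \<Rightarrow> ('o1, 'm1, 'o2, 'm2) fctr
     \<Rightarrow> bool" where
  "naturally_isomorphic C D F G \<longleftrightarrow>
     (\<exists>\<eta>. nat_trans C D F G \<eta> \<and> (\<forall>a\<in>Obj C. is_iso D (\<eta> a)))"

definition equivalent_categories :: "('o1, 'm1) cat \<Rightarrow> ('o2, 'm2) cat \<Rightarrow> bool" where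
  "equivalent_categories C D \<longleftrightarrow>
     (\<exists>F G. is_functor C D F \<and> is_functor D C G \<and>
        naturally_isomorphic C C (id_functor C) (comp_functor C G F) \<and>
        naturally_isomorphic D D (comp_functor D F G) (id_functor D))"


section \<open>Cones and cocones\<close>

record ('i, 'j, 'o, 'm) cone =
  shape :: "('i, 'j) cat"
  diagram :: "('i, 'j, 'o, 'm) fctr"
  vertex :: 'o
  leg :: "'i \<Rightarrow> 'm"

definition is_cone :: "('o, 'm) cat \<Rightarrow> ('i, 'j, 'o, 'm) cone \<Rightarrow> bool" where
  "is_cone C K \<longleftrightarrow>
     is_functor (shape K) C (diagram K) \<and> vertex K \<in> Obj C \<and>
     leg K \<in> extensional (Obj (shape K)) \<and>
     (\<forall>i\<in>Obj (shape K). leg K i \<in> Hom C (vertex K) (ob_map (diagram K) i)) \<and>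
     (\<forall>u\<in>Arr (shape K).
        Comp C (arr_map (diagram K) u) (leg K (Dom (shape K) u)) = leg K (Cod (shape K) u))"

definition limit_cone :: "('o, 'm) cat \<Rightarrow> ('i, 'j, 'o, 'm) cone \<Rightarrow> bool" where
  "limit_cone C K \<longleftrightarrow> is_cone C K \<and>
     (\<forall>L. is_cone C L \<longrightarrow> shape L = shape K \<longrightarrow> diagram L = diagram K \<longrightarrow>
        (\<exists>!t. t \<in> Hom C (vertex L) (vertex K) \<and>
              (\<forall>i\<in>Obj (shape K). Comp C (leg K i) t = leg L i)))"

text \<open>
  A cocone is stored in the same record, its legs being read as arrows
  \<open>leg K i : ob_map (diagram K) i \<rightarrow> vertex K\<close>.
\<close>

definition op_cone :: "('i, 'j, 'o, 'm) cone \<Rightarrow> ('i, 'j, 'o, 'm) cone" where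
  "op_cone K = K\<lparr>shape := op_cat (shape K)\<rparr>"

definition is_cocone :: "('o, 'm) cat \<Rightarrow> ('i, 'j, 'o, 'm) cone \<Rightarrow> bool" where
  "is_cocone C K \<longleftrightarrow> is_cone (op_cat C) (op_cone K)"

definition colimit_cocone :: "('o, 'm) cat \<Rightarrow> ('i, 'j, 'o, 'm) cone \<Rightarrow> bool" where
  "colimit_cocone C K \<longleftrightarrow> limit_cone (op_cat C) (op_cone K)"

definition map_cone ::
  "('o1, 'm1, 'o2, 'm2) fctr \<Rightarrow> ('i, 'j, 'o1, 'm1) cone \<Rightarrow> ('i, 'j, 'o2, 'm2) cone" where
  "map_cone F K = \<lparr>shape = shape K, diagram = comp_functor (shape K) F (diagram K),
     vertex = ob_map F (vertex K), leg = compose (Obj (shape K)) (arr_map F) (leg K)\<rparr>"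


section \<open>The categories of sets and of topological spaces\<close>

datatype ('o, 'f) arrow = Arrow (src: 'o) (fn: 'f) (tgt: 'o)

definition Set :: "('u set, ('u set, 'u \<Rightarrow> 'u) arrow) cat" where
  "Set = \<lparr>
     Obj = {A. small TYPE('u) A},
     Arr = {Arrow A f B | A f B. small TYPE('u) A \<and> small TYPE('u) B \<and> f \<in> A \<rightarrow>\<^sub>E B},
     Dom = src, Cod = tgt,
     Id = (\<lambda>A. Arrow A (\<lambda>x\<in>A. x) A),
     Comp = (\<lambda>g f. Arrow (src f) (compose (src f) (fn g) (fn f)) (tgt g))\<rparr>"

definition Top :: "'u itself \<Rightarrow> ('u topology, ('u topology, 'u \<Rightarrow> 'u) arrow) cat" where
  "Top U = \<lparr>
     Obj = {X. small U (topspace X)},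
     Arr = {Arrow X f Y | X f Y. small U (topspace X) \<and> small U (topspace Y) \<and>
              continuous_map X Y f \<and> f \<in> extensional (topspace X)},
     Dom = src, Cod = tgt,
     Id = (\<lambda>X. Arrow X (\<lambda>x\<in>topspace X. x) X),
     Comp = (\<lambda>g f. Arrow (src f) (compose (topspace (src f)) (fn g) (fn f)) (tgt g))\<rparr>"


section \<open>Limit sketches\<close>

record ('i, 'j, 'o, 'm) sketch =
  under :: "('o, 'm) cat"
  cones :: "('i, 'j, 'o, 'm) cone set"

definition limit_sketch :: "'u itself \<Rightarrow> ('i, 'j, 'o, 'm) sketch \<Rightarrow> bool" where
  "limit_sketch U S \<longleftrightarrow>
     category (under S) \<and> locally_small U (under S) \<and>
     (\<forall>K\<in>cones S. is_cone (under S) K \<and> small_category U (shape K))"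

definition small_sketch :: "'u itself \<Rightarrow> ('i, 'j, 'o, 'm) sketch \<Rightarrow> bool" where
  "small_sketch U S \<longleftrightarrow> small_category U (under S) \<and> small U (cones S)"

abbreviation large_sketch :: "'u itself \<Rightarrow> ('i, 'j, 'o, 'm) sketch \<Rightarrow> bool" where
  "large_sketch U S \<equiv> \<not> small_sketch U S"

definition model ::
  "('i, 'j, 'o, 'm) sketch \<Rightarrow> ('o, 'm, 'u set, ('u set, 'u \<Rightarrow> 'u) arrow) fctr \<Rightarrow> bool" where
  "model S M \<longleftrightarrow> is_functor (under S) Set M \<and> (\<forall>K\<in>cones S. limit_cone Set (map_cone M K))"

definition Mod :: "'u itself \<Rightarrow> ('i, 'j, 'o, 'm) sketch \<Rightarrow>
  (('o, 'm, 'u set, ('u set, 'u \<Rightarrow> 'u) arrow) fctr,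
   (('o, 'm, 'u set, ('u set, 'u \<Rightarrow> 'u) arrow) fctr,
    'o \<Rightarrow> ('u set, 'u \<Rightarrow> 'u) arrow) arrow) cat" where
  "Mod _ S = \<lparr>
     Obj = {M. model S M},
     Arr = {Arrow M \<eta> N | M \<eta> N. model S M \<and> model S N \<and> nat_trans (under S) Set M N \<eta>},
     Dom = src, Cod = tgt,
     Id = (\<lambda>M. Arrow M (\<lambda>a\<in>Obj (under S). Id Set (ob_map M a)) M),
     Comp = (\<lambda>g f. Arrow (src f) (\<lambda>a\<in>Obj (under S). Comp Set (fn g a) (fn f a)) (tgt g))\<rparr>"

text \<open>
  The hom-sets of C consist of arrows and are not literally subsets of \<open>'u\<close>. So the functor
  \<open>Hom(A,-)\<close> is given by its copies: functors F into \<open>Set\<close> with bijections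
  \<open>Hom C A B \<rightarrow> F B\<close> natural in B. Such copies exist whenever C is locally small.
\<close>

definition represents ::
  "('o, 'm) cat \<Rightarrow> 'o \<Rightarrow> ('o, 'm, 'u set, ('u set, 'u \<Rightarrow> 'u) arrow) fctr \<Rightarrow> bool" where
  "represents C A F \<longleftrightarrow>
     A \<in> Obj C \<and> is_functor C Set F \<and>
     (\<exists>\<phi> :: 'o \<Rightarrow> 'm \<Rightarrow> 'u.
        (\<forall>B\<in>Obj C. bij_betw (\<phi> B) (Hom C A B) (ob_map F B)) \<and>
        (\<forall>f\<in>Arr C. \<forall>g\<in>Hom C A (Dom C f).
           \<phi> (Cod C f) (Comp C f g) = fn (arr_map F f) (\<phi> (Dom C f) g)))"

definition realized :: "'u itself \<Rightarrow> ('i, 'j, 'o, 'm) sketch \<Rightarrow> bool" where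
  "realized _ S \<longleftrightarrow>
     (\<forall>A\<in>Obj (under S). \<forall>F :: ('o, 'm, 'u set, ('u set, 'u \<Rightarrow> 'u) arrow) fctr.
        represents (under S) A F \<longrightarrow> model S F)"

definition small_model :: "'u itself \<Rightarrow> ('i, 'j, 'o, 'm) sketch \<Rightarrow>
  ('o, 'm, 'u set, ('u set, 'u \<Rightarrow> 'u) arrow) fctr \<Rightarrow> bool" where
  "small_model U S M \<longleftrightarrow>
     (\<exists>K :: ('u, 'u, ('o, 'm, 'u set, ('u set, 'u \<Rightarrow> 'u) arrow) fctr,
         (('o, 'm, 'u set, ('u set, 'u \<Rightarrow> 'u) arrow) fctr,
          'o \<Rightarrow> ('u set, 'u \<Rightarrow> 'u) arrow) arrow) cone.
        small_category U (shape K) \<and> colimit_cocone (Mod U S) K \<and> vertex K = M \<and>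
        (\<forall>i\<in>Obj (shape K). \<exists>A\<in>Obj (under S). represents (under S) A (ob_map (diagram K) i)))"


section \<open>Directed sets\<close>

text \<open>
  A directed set is given by its preorder r (with \<open>(x, y) \<in> r\<close> meaning \<open>x \<le> y\<close>); reflexivity
  makes its carrier \<open>Field r\<close>. Then \<open>above r p\<close> is the set of all \<open>q \<ge> p\<close>, and
  \<open>Restr r Q\<close> is the subset Q with the induced preorder.
\<close>

definition directed :: "'a rel \<Rightarrow> bool" where
  "directed r \<longleftrightarrow> Preorder r \<and> Field r \<noteq> {} \<and>
     (\<forall>x\<in>Field r. \<forall>y\<in>Field r. \<exists>z\<in>Field r. (x, z) \<in> r \<and> (y, z) \<in> r)"

definition small_directed :: "'u rel \<Rightarrow> bool" where
  "small_directed r \<longleftrightarrow> directed r \<and> small TYPE('u) (Field r)"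

definition cofinal_map :: "'a rel \<Rightarrow> 'b rel \<Rightarrow> ('a \<Rightarrow> 'b) \<Rightarrow> bool" where
  "cofinal_map r s h \<longleftrightarrow> h \<in> Field r \<rightarrow> Field s \<and>
     (\<forall>p\<in>Field s. \<exists>q\<in>Field r. h ` above r q \<subseteq> above s p)"

definition cofinal_subset :: "'a rel \<Rightarrow> 'a set \<Rightarrow> bool" where
  "cofinal_subset r Q \<longleftrightarrow> Q \<subseteq> Field r \<and> (\<forall>p\<in>Field r. \<exists>q\<in>Q. (p, q) \<in> r)"

definition infpt :: "'u rel \<Rightarrow> 'u" where
  "infpt r = (SOME x. x \<notin> Field r)"

definition net_space :: "'u rel \<Rightarrow> 'u topology" where
  "net_space r = topology (\<lambda>V. V \<subseteq> insert (infpt r) (Field r) \<and>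
     (infpt r \<in> V \<longrightarrow> (\<exists>p\<in>Field r. above r p \<subseteq> V)))"

lemma openin_net_space:
  assumes "directed r"
  shows "openin (net_space r) V \<longleftrightarrow> V \<subseteq> insert (infpt r) (Field r) \<and>
     (infpt r \<in> V \<longrightarrow> (\<exists>p\<in>Field r. above r p \<subseteq> V))"
proof -
  have up: "\<exists>z\<in>Field r. above r z \<subseteq> above r x \<inter> above r y"
    if xy: "x \<in> Field r" "y \<in> Field r" for x y
  proof -
    obtain z where z: "z \<in> Field r" "(x, z) \<in> r" "(y, z) \<in> r"
      using assms xy unfolding directed_def by meson
    have "trans r"
      using assms unfolding directed_def preorder_on_def by meson
    then have "above r z \<subseteq> above r x \<inter> above r y"
      using z(2,3) unfolding above_def by (auto elim: transE)
    with z(1) show ?thesis ..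
  qed
  have "istopology (\<lambda>V. V \<subseteq> insert (infpt r) (Field r) \<and>
     (infpt r \<in> V \<longrightarrow> (\<exists>p\<in>Field r. above r p \<subseteq> V)))" (is "istopology ?L")
    unfolding istopology_def
  proof (rule conjI; intro allI impI)
    fix V W
    assume V: "?L V" and W: "?L W"
    show "?L (V \<inter> W)"
    proof (intro conjI impI)
      show "V \<inter> W \<subseteq> insert (infpt r) (Field r)" using V by blast
      assume "infpt r \<in> V \<inter> W"
      then obtain x y where xy: "x \<in> Field r" "above r x \<subseteq> V" "y \<in> Field r" "above r y \<subseteq> W"
        using V W by blast
      then obtain z where "z \<in> Field r" "above r z \<subseteq> above r x \<inter> above r y"
        using up[OF xy(1,3)] by (elim bexE)
      with xy show "\<exists>p\<in>Field r. above r p \<subseteq> V \<inter> W" by (meson Int_mono order_trans)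
    qed
  next
    fix \<K>
    assume K: "\<forall>V\<in>\<K>. ?L V"
    show "?L (\<Union>\<K>)"
    proof (intro conjI impI)
      show "\<Union>\<K> \<subseteq> insert (infpt r) (Field r)" using K by (simp add: Sup_le_iff)
      assume "infpt r \<in> \<Union>\<K>"
      then obtain V where V: "V \<in> \<K>" "infpt r \<in> V" by blast
      then obtain p where "p \<in> Field r" "above r p \<subseteq> V" using K by metis
      with V show "\<exists>p\<in>Field r. above r p \<subseteq> \<Union>\<K>" by (meson Union_upper order_trans)
    qed
  qed
  then show ?thesis
    by (simp add: net_space_def topology_inverse')
qed

text \<open>
  The space \<open>P \<squnion> 1\<close> has the same points as \<open>P \<union> {\<infinity>}\<close>, so the canonical bijection between
  the two is the identity on points.
\<close>

definition sum_space :: "'u rel \<Rightarrow> 'u topology" where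
  "sum_space r = discrete_topology (insert (infpt r) (Field r))"

definition one_space :: "'u topology" where
  "one_space = discrete_topology {undefined}"

definition top_map :: "'u topology \<Rightarrow> ('u \<Rightarrow> 'u) \<Rightarrow> 'u topology \<Rightarrow> ('u topology, 'u \<Rightarrow> 'u) arrow" where
  "top_map X f Y = Arrow X (\<lambda>x\<in>topspace X. f x) Y"

definition sum_to_net :: "'u rel \<Rightarrow> ('u topology, 'u \<Rightarrow> 'u) arrow" where
  "sum_to_net r = top_map (sum_space r) (\<lambda>x. x) (net_space r)"

definition sum_to_sum :: "'u rel \<Rightarrow> ('u \<Rightarrow> 'u) \<Rightarrow> 'u rel \<Rightarrow> ('u topology, 'u \<Rightarrow> 'u) arrow" where
  "sum_to_sum r h s =
     top_map (sum_space r) (\<lambda>x. if x = infpt r then infpt s else h x) (sum_space s)"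

definition point :: "'u \<Rightarrow> 'u topology \<Rightarrow> ('u topology, 'u \<Rightarrow> 'u) arrow" where
  "point x X = top_map one_space (\<lambda>_. x) X"


section \<open>Families of spans as diagrams\<close>

text \<open>
  The category \<open>spans\<close> is freely generated by arrows \<open>Leg i \<leftarrow> Apex i \<rightarrow> Base\<close>, with one common
  object \<open>Base\<close>. All index categories needed below are full subcategories of it; in
  particular the one on objects \<open>Leg i\<close> is discrete.
\<close>

datatype 'i span_ob = Base | Apex 'i | Leg 'i

datatype 'i span_arr = Ident "'i span_ob" | To_Leg 'i | To_Base 'i

definition spans :: "('i span_ob, 'i span_arr) cat" where
  "spans = \<lparr>
     Obj = UNIV,
     Arr = UNIV,
     Dom = (\<lambda>u. case u of Ident x \<Rightarrow> x | To_Leg i \<Rightarrow> Apex i | To_Base i \<Rightarrow> Apex i),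
     Cod = (\<lambda>u. case u of Ident x \<Rightarrow> x | To_Leg i \<Rightarrow> Leg i | To_Base i \<Rightarrow> Base),
     Id = Ident,
     Comp = (\<lambda>v u. case u of Ident _ \<Rightarrow> v | _ \<Rightarrow> u)\<rparr>"

definition spans_on :: "'i set \<Rightarrow> ('i span_ob, 'i span_arr) cat" where
  "spans_on I = full_subcat spans (insert Base (Apex ` I \<union> Leg ` I))"

definition discrete_on :: "'i set \<Rightarrow> ('i span_ob, 'i span_arr) cat" where
  "discrete_on I = full_subcat spans (Leg ` I)"

fun span_ob_map :: "('o, 'm) cat \<Rightarrow> 'o \<Rightarrow> ('i \<Rightarrow> 'm) \<Rightarrow> 'i span_ob \<Rightarrow> 'o" where
  "span_ob_map C X l Base = X"
| "span_ob_map C X l (Apex i) = Dom C (l i)"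
| "span_ob_map C X l (Leg i) = Cod C (l i)"

fun span_arr_map ::
  "('o, 'm) cat \<Rightarrow> 'o \<Rightarrow> ('i \<Rightarrow> 'm) \<Rightarrow> ('i \<Rightarrow> 'm) \<Rightarrow> 'i span_arr \<Rightarrow> 'm" where
  "span_arr_map C X l b (Ident x) = Id C (span_ob_map C X l x)"
| "span_arr_map C X l b (To_Leg i) = l i"
| "span_arr_map C X l b (To_Base i) = b i"

text \<open>The diagram consisting of the spans formed by \<open>l i\<close> and \<open>b i\<close>, where \<open>b i\<close> has codomain X.\<close>

definition span_diagram ::
  "('o, 'm) cat \<Rightarrow> 'i set \<Rightarrow> 'o \<Rightarrow> ('i \<Rightarrow> 'm) \<Rightarrow> ('i \<Rightarrow> 'm)
     \<Rightarrow> ('i span_ob, 'i span_arr, 'o, 'm) fctr" where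
  "span_diagram C I X l b = \<lparr>
     ob_map = restrict (span_ob_map C X l) (Obj (spans_on I)),
     arr_map = restrict (span_arr_map C X l b) (Arr (spans_on I))\<rparr>"


section \<open>The limit sketch of topological spaces\<close>

datatype 'u key = Single | Point 'u | Subset "'u set"

type_synonym 'u top_cocone =
  "('u key span_ob, 'u key span_arr, 'u topology, ('u topology, 'u \<Rightarrow> 'u) arrow) cone"

definition coproduct_cocone :: "'u set \<Rightarrow> 'u top_cocone" where
  "coproduct_cocone I = \<lparr>
     shape = discrete_on (Point ` I),
     diagram = \<lparr>ob_map = (\<lambda>x\<in>Obj (discrete_on (Point ` I)). one_space),
                arr_map = (\<lambda>u\<in>Arr (discrete_on (Point ` I)). Id (Top TYPE('u)) one_space)\<rparr>,
     vertex = discrete_topology I,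
     leg = (\<lambda>x\<in>Obj (discrete_on (Point ` I)).
              case x of Leg (Point i) \<Rightarrow> point i (discrete_topology I))\<rparr>"

definition epi_cocone :: "('u topology, 'u \<Rightarrow> 'u) arrow \<Rightarrow> 'u top_cocone" where
  "epi_cocone f = \<lparr>
     shape = spans_on {Single},
     diagram = span_diagram (Top TYPE('u)) {Single} (tgt f) (\<lambda>_. f) (\<lambda>_. f),
     vertex = tgt f,
     leg = (\<lambda>x\<in>Obj (spans_on {Single}).
              case x of Apex _ \<Rightarrow> f | _ \<Rightarrow> Id (Top TYPE('u)) (tgt f))\<rparr>"

definition discrete_cocones :: "'u top_cocone set" where
  "discrete_cocones = {coproduct_cocone I | I. small TYPE('u) I}"

definition net_cocones :: "'u top_cocone set" where
  "net_cocones = {epi_cocone (sum_to_net P) | P. small_directed P}"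

definition subnet_cocones :: "'u top_cocone set" where
  "subnet_cocones = {K. \<exists>P R h.
     small_directed P \<and>
     (\<forall>Q. cofinal_subset P Q \<longrightarrow>
        small_directed (R Q) \<and> cofinal_map (R Q) (Restr P Q) (h Q)) \<and>
     shape K = spans_on (Subset ` {Q. cofinal_subset P Q}) \<and>
     diagram K = span_diagram (Top TYPE('u)) (Subset ` {Q. cofinal_subset P Q}) (sum_space P)
       (\<lambda>k. case k of Subset Q \<Rightarrow> sum_to_net (R Q))
       (\<lambda>k. case k of Subset Q \<Rightarrow> sum_to_sum (R Q) (h Q) P) \<and>
     colimit_cocone (Top TYPE('u)) K}"

definition iterated_cocones :: "'u top_cocone set" where
  "iterated_cocones = {K. \<exists>P Q.
     small_directed P \<and> (\<forall>p\<in>Field P. small_directed (Q p)) \<and>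
     shape K = spans_on (Point ` Field P) \<and>
     diagram K = span_diagram (Top TYPE('u)) (Point ` Field P) (net_space P)
       (\<lambda>k. case k of Point p \<Rightarrow> point (infpt (Q p)) (net_space (Q p)))
       (\<lambda>k. case k of Point p \<Rightarrow> point p (net_space P)) \<and>
     colimit_cocone (Top TYPE('u)) K}"

definition sketch_spaces :: "'u topology set" where
  "sketch_spaces =
     {discrete_topology I | I. small TYPE('u) I} \<union>
     {net_space P | P. small_directed P} \<union>
     vertex ` subnet_cocones \<union>
     vertex ` iterated_cocones"

definition top_sketch :: "'u itself \<Rightarrow> ('u key span_ob, 'u key span_arr,
    'u topology, ('u topology, 'u \<Rightarrow> 'u) arrow) sketch" where
  "top_sketch U = \<lparr>
     under = op_cat (full_subcat (Top U) sketch_spaces),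
     cones = op_cone `
       (discrete_cocones \<union> net_cocones \<union> subnet_cocones \<union> iterated_cocones)\<rparr>"

end

theory Submission
  imports Defs
begin

text \<open>
  For every space \<open>X\<close> the functor \<open>Hom(-,X)\<close> takes colimits in Top to limits of sets. All
  distinguished cocones are colimits in Top, so the restriction of \<open>Hom(-,X)\<close> to the spaces of the
  sketch is a model (\<open>presents_model\<close>); for \<open>X\<close> in the sketch this says that the sketch is
  realized. Sending \<open>X\<close> to this model is a functor from Top to models, and the theorem holds because
  this functor is fully faithful and essentially surjective.

  It is fully faithful because the sketch contains the one-point space, which sees the points of a
  space, and the spaces \<open>P \<union> {\<infinity>}\<close>, which see its convergent nets. More precisely, \<open>X\<close> is the
  colimit of a diagram formed by the discrete space on its points and one space \<open>P \<union> {\<infinity>}\<close> for each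
  point, with \<open>P\<close> indexing the neighbourhoods of the point (\<open>space_colimit_of_nets\<close>).
  Therefore a natural transformation between two such models is composition with a function on
  points that preserves convergence of nets, and thus with a continuous map
  (\<open>tracked_arrow_exists\<close>).

  For essential surjectivity let \<open>M\<close> be a model. Restriction to points turns an element of \<open>M B\<close>
  into a function from the points of \<open>B\<close> to the set \<open>M 1\<close>. The coproduct and epimorphism cocones
  make this injective and produce all functions if \<open>B\<close> is discrete. Call a net in \<open>M 1\<close> convergent
  to \<open>a\<close> if the net extended by \<open>a\<close> at \<open>\<infinity>\<close> comes from an element of \<open>M (P \<union> {\<infinity>})\<close>. Constant nets
  converge and subnets of convergent nets converge, by functoriality. The cocones with vertex
  \<open>F(P,h)\<close> and \<open>G(P,Q)\<close> give Kelley's two other axioms, on nets all of whose cofinal restrictions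
  have convergent subnets and on iterated limits (\<open>model_conv_local\<close>, \<open>model_conv_iterated\<close>).
  By Kelley's theorem (\<open>conv_iff_topological\<close>) this convergence belongs to a topology \<open>X\<close> on
  \<open>M 1\<close>. So the elements of \<open>M B\<close> are the continuous maps \<open>B \<rightarrow> X\<close> for \<open>B = P \<union> {\<infinity>}\<close>, and by
  passage to limits for all \<open>B\<close> in the sketch (\<open>traces_sketch\<close>, \<open>model_presented\<close>).

  Every model is small because equivalences preserve colimits, and the diagram with colimit \<open>X\<close>
  described above consists of spaces of the sketch (\<open>models_small\<close>).
\<close>

section \<open>Categories, functors and cocones\<close>

lemma op_cat_sel [simp]:
  "Obj (op_cat C) = Obj C" "Arr (op_cat C) = Arr C" "Dom (op_cat C) = Cod C"
  "Cod (op_cat C) = Dom C" "Id (op_cat C) = Id C" "Comp (op_cat C) g f = Comp C f g"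
  by (simp_all add: op_cat_def)

lemma op_cat_op_cat [simp]: "op_cat (op_cat C) = C"
  by (simp add: op_cat_def)

lemma Hom_op_cat [simp]: "Hom (op_cat C) a b = Hom C b a"
  by (auto simp: Hom_def)

lemma full_subcat_sel [simp]:
  "Obj (full_subcat C A) = A" "Dom (full_subcat C A) = Dom C" "Cod (full_subcat C A) = Cod C"
  "Id (full_subcat C A) = Id C" "Comp (full_subcat C A) = Comp C"
  "Arr (full_subcat C A) = {f \<in> Arr C. Dom C f \<in> A \<and> Cod C f \<in> A}"
  by (simp_all add: full_subcat_def)

lemma Hom_full_subcat: "a \<in> A \<Longrightarrow> b \<in> A \<Longrightarrow> Hom (full_subcat C A) a b = Hom C a b"
  by (auto simp: Hom_def)

lemma category_op_cat:
  assumes "category C"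
  shows "category (op_cat C)"
proof -
  interpret category C by fact
  show ?thesis
    by unfold_locales (auto simp: dom_cod id_hom comp_hom id_left id_right intro: assoc[symmetric])
qed

lemma category_full_subcat:
  assumes "category C" "A \<subseteq> Obj C"
  shows "category (full_subcat C A)"
proof -
  interpret category C by fact
  have H: "f \<in> Hom C a b \<and> a \<in> A \<and> b \<in> A" if "f \<in> Hom (full_subcat C A) a b" for f a b
    using that by (auto simp: Hom_def)
  show ?thesis
  proof
    show "\<And>a. a \<in> Obj (full_subcat C A) \<Longrightarrow> Id (full_subcat C A) a \<in> Hom (full_subcat C A) a a"
      using assms(2) by (auto simp: Hom_full_subcat intro: id_hom)
    show "\<And>f a b g c. \<lbrakk>f \<in> Hom (full_subcat C A) a b; g \<in> Hom (full_subcat C A) b c\<rbrakk>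
        \<Longrightarrow> Comp (full_subcat C A) g f \<in> Hom (full_subcat C A) a c"
      by (metis H Hom_full_subcat comp_hom full_subcat_sel(5))
  qed (auto dest!: H simp: id_left id_right intro: assoc)
qed

lemma functor_cat: "is_functor C D F \<Longrightarrow> category C" "is_functor C D F \<Longrightarrow> category D"
  by (simp_all add: is_functor_def)

lemma functor_ob: "is_functor C D F \<Longrightarrow> a \<in> Obj C \<Longrightarrow> ob_map F a \<in> Obj D"
  by (auto simp: is_functor_def)

lemma functor_hom:
  "is_functor C D F \<Longrightarrow> f \<in> Hom C a b \<Longrightarrow> arr_map F f \<in> Hom D (ob_map F a) (ob_map F b)"
  by (auto simp: is_functor_def Hom_def)

lemma functor_id: "is_functor C D F \<Longrightarrow> a \<in> Obj C \<Longrightarrow> arr_map F (Id C a) = Id D (ob_map F a)"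
  by (auto simp: is_functor_def)

lemma functor_comp:
  "is_functor C D F \<Longrightarrow> f \<in> Hom C a b \<Longrightarrow> g \<in> Hom C b c \<Longrightarrow>
     arr_map F (Comp C g f) = Comp D (arr_map F g) (arr_map F f)"
  by (auto simp: is_functor_def Hom_def)

lemma Hom_Obj:
  assumes "category C" "f \<in> Hom C a b"
  shows "a \<in> Obj C" "b \<in> Obj C"
  using category.dom_cod[OF assms(1), of f] assms(2) by (auto simp: Hom_def)

lemma Arr_Hom: "f \<in> Arr C \<Longrightarrow> f \<in> Hom C (Dom C f) (Cod C f)"
  by (simp add: Hom_def)

lemma is_functorI:
  assumes "category C" "category D"
    and "ob_map F \<in> extensional (Obj C)" "arr_map F \<in> extensional (Arr C)"
    and ob: "\<And>a. a \<in> Obj C \<Longrightarrow> ob_map F a \<in> Obj D"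
    and hom: "\<And>f a b. f \<in> Hom C a b \<Longrightarrow> arr_map F f \<in> Hom D (ob_map F a) (ob_map F b)"
    and "\<And>a. a \<in> Obj C \<Longrightarrow> arr_map F (Id C a) = Id D (ob_map F a)"
    and comp: "\<And>f g a b c. f \<in> Hom C a b \<Longrightarrow> g \<in> Hom C b c \<Longrightarrow>
      arr_map F (Comp C g f) = Comp D (arr_map F g) (arr_map F f)"
  shows "is_functor C D F"
  unfolding is_functor_def
proof (intro conjI ballI impI)
  show "ob_map F \<in> Obj C \<rightarrow>\<^sub>E Obj D" using assms(3) ob by (auto simp: PiE_def)
  have "arr_map F f \<in> Arr D" if "f \<in> Arr C" for f
    using hom[OF Arr_Hom[OF that]] by (simp add: Hom_def)
  then show "arr_map F \<in> Arr C \<rightarrow>\<^sub>E Arr D" using assms(4) by (auto simp: PiE_def)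
  fix f assume f: "f \<in> Arr C"
  from hom[OF Arr_Hom[OF f]]
  show "Dom D (arr_map F f) = ob_map F (Dom C f)" "Cod D (arr_map F f) = ob_map F (Cod C f)"
    by (auto simp: Hom_def)
  fix g assume g: "g \<in> Arr C" "Dom C g = Cod C f"
  show "arr_map F (Comp C g f) = Comp D (arr_map F g) (arr_map F f)"
    using comp[OF Arr_Hom[OF f], of g] g by (simp add: Hom_def)
qed (use assms in auto)

lemma is_functor_op:
  assumes "is_functor C D F"
  shows "is_functor (op_cat C) (op_cat D) F"
proof (rule is_functorI)
  show "ob_map F \<in> extensional (Obj (op_cat C))" "arr_map F \<in> extensional (Arr (op_cat C))"
    using assms by (auto simp: is_functor_def PiE_def)
qed (use assms in \<open>auto simp: functor_ob functor_hom functor_id functor_comp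
      intro: category_op_cat functor_cat\<close>)

lemma is_functor_op_iff: "is_functor (op_cat C) (op_cat D) F \<longleftrightarrow> is_functor C D F"
  using is_functor_op[of C D F] is_functor_op[of "op_cat C" "op_cat D" F] by auto

lemma comp_functor_sel [simp]:
  "a \<in> Obj C \<Longrightarrow> ob_map (comp_functor C G F) a = ob_map G (ob_map F a)"
  "f \<in> Arr C \<Longrightarrow> arr_map (comp_functor C G F) f = arr_map G (arr_map F f)"
  by (simp_all add: comp_functor_def compose_def)

lemma Hom_Arr: "f \<in> Hom C a b \<Longrightarrow> f \<in> Arr C"
  by (simp add: Hom_def)

lemma is_functor_comp:
  assumes F: "is_functor C D F" and G: "is_functor D E G"
  shows "is_functor C E (comp_functor C G F)"
proof -
  interpret C: category C using functor_cat[OF F] by simp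
  show ?thesis
  proof (rule is_functorI)
    show "ob_map (comp_functor C G F) \<in> extensional (Obj C)"
      "arr_map (comp_functor C G F) \<in> extensional (Arr C)"
      by (simp_all add: comp_functor_def)
    fix f a b assume f: "f \<in> Hom C a b"
    note ab = Hom_Obj[OF C.category_axioms f]
    show "arr_map (comp_functor C G F) f
      \<in> Hom E (ob_map (comp_functor C G F) a) (ob_map (comp_functor C G F) b)"
      using functor_hom[OF G functor_hom[OF F f]] ab Hom_Arr[OF f] by simp
    fix g c assume g: "g \<in> Hom C b c"
    show "arr_map (comp_functor C G F) (Comp C g f)
      = Comp E (arr_map (comp_functor C G F) g) (arr_map (comp_functor C G F) f)"
      using functor_comp[OF F f g] functor_comp[OF G functor_hom[OF F f] functor_hom[OF F g]]
        Hom_Arr[OF f] Hom_Arr[OF g] Hom_Arr[OF C.comp_hom[OF f g]] by simp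
  next
    fix a assume a: "a \<in> Obj C"
    show "arr_map (comp_functor C G F) (Id C a) = Id E (ob_map (comp_functor C G F) a)"
      using a functor_id[OF F a] functor_id[OF G functor_ob[OF F a]] Hom_Arr[OF C.id_hom[OF a]]
      by simp
  qed (use assms in \<open>auto simp: functor_ob intro: functor_cat\<close>)
qed

lemma is_functor_id:
  assumes "category C"
  shows "is_functor C C (id_functor C)"
proof -
  interpret category C by fact
  show ?thesis
    by (rule is_functorI)
      (auto simp: id_functor_def Hom_Arr id_hom Hom_Obj[OF assms] comp_hom[THEN Hom_Arr] assms
        id_hom[THEN Hom_Arr])
qed

lemma op_cone_sel [simp]:
  "shape (op_cone K) = op_cat (shape K)" "diagram (op_cone K) = diagram K"
  "vertex (op_cone K) = vertex K" "leg (op_cone K) = leg K" "op_cone (op_cone K) = K"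
  by (simp_all add: op_cone_def)

lemma map_cone_sel [simp]:
  "shape (map_cone F K) = shape K" "vertex (map_cone F K) = ob_map F (vertex K)"
  "diagram (map_cone F K) = comp_functor (shape K) F (diagram K)"
  "i \<in> Obj (shape K) \<Longrightarrow> leg (map_cone F K) i = arr_map F (leg K i)"
  by (simp_all add: map_cone_def compose_def)

lemma is_cocone_iff:
  "is_cocone C K \<longleftrightarrow>
     is_functor (shape K) C (diagram K) \<and> vertex K \<in> Obj C \<and>
     leg K \<in> extensional (Obj (shape K)) \<and>
     (\<forall>i\<in>Obj (shape K). leg K i \<in> Hom C (ob_map (diagram K) i) (vertex K)) \<and>
     (\<forall>u\<in>Arr (shape K).
        Comp C (leg K (Cod (shape K) u)) (arr_map (diagram K) u) = leg K (Dom (shape K) u))"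
  by (simp add: is_cocone_def is_cone_def is_functor_op_iff)

lemma colimit_cocone_iff:
  "colimit_cocone C K \<longleftrightarrow> is_cocone C K \<and>
     (\<forall>L. is_cocone C L \<longrightarrow> shape L = shape K \<longrightarrow> diagram L = diagram K \<longrightarrow>
        (\<exists>!t. t \<in> Hom C (vertex K) (vertex L) \<and>
              (\<forall>i\<in>Obj (shape K). Comp C t (leg K i) = leg L i)))"
  (is "_ \<longleftrightarrow> _ \<and> ?R")
proof -
  have "(\<forall>L. is_cone (op_cat C) L \<longrightarrow> shape L = shape (op_cone K) \<longrightarrow>
      diagram L = diagram (op_cone K) \<longrightarrow>
        (\<exists>!t. t \<in> Hom (op_cat C) (vertex L) (vertex (op_cone K)) \<and>
              (\<forall>i\<in>Obj (shape (op_cone K)). Comp (op_cat C) (leg (op_cone K) i) t = leg L i)))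
     \<longleftrightarrow> ?R" (is "?L \<longleftrightarrow> _")
  proof
    assume l: ?L
    show ?R
    proof (intro allI impI)
      fix L assume "is_cocone C L" "shape L = shape K" "diagram L = diagram K"
      then show "\<exists>!t. t \<in> Hom C (vertex K) (vertex L) \<and>
              (\<forall>i\<in>Obj (shape K). Comp C t (leg K i) = leg L i)"
        using l[rule_format, of "op_cone L"] by (simp add: is_cocone_def)
    qed
  next
    assume r: ?R
    show ?L
    proof (intro allI impI)
      fix L assume "is_cone (op_cat C) L" "shape L = shape (op_cone K)"
        "diagram L = diagram (op_cone K)"
      then show "\<exists>!t. t \<in> Hom (op_cat C) (vertex L) (vertex (op_cone K)) \<and>
          (\<forall>i\<in>Obj (shape (op_cone K)). Comp (op_cat C) (leg (op_cone K) i) t = leg L i)"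
        using r[rule_format, of "op_cone L"] by (simp add: is_cocone_def)
    qed
  qed
  then show ?thesis
    unfolding colimit_cocone_def limit_cone_def is_cocone_def by simp
qed

lemma is_cone_map:
  assumes F: "is_functor C D F" and K: "is_cone C K"
  shows "is_cone D (map_cone F K)"
proof -
  have dia: "is_functor (shape K) C (diagram K)"
    and v: "vertex K \<in> Obj C"
    and leg: "\<And>i. i \<in> Obj (shape K) \<Longrightarrow> leg K i \<in> Hom C (vertex K) (ob_map (diagram K) i)"
    and com: "\<And>u. u \<in> Arr (shape K) \<Longrightarrow>
        Comp C (arr_map (diagram K) u) (leg K (Dom (shape K) u)) = leg K (Cod (shape K) u)"
    using K by (auto simp: is_cone_def)
  interpret J: category "shape K" using functor_cat[OF dia] by simp
  have "leg (map_cone F K) \<in> extensional (Obj (shape K))" by (simp add: map_cone_def)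
  moreover have "Comp D (arr_map F (arr_map (diagram K) u)) (arr_map F (leg K (Dom (shape K) u)))
     = arr_map F (leg K (Cod (shape K) u))" if u: "u \<in> Arr (shape K)" for u
    using functor_comp[OF F leg functor_hom[OF dia Arr_Hom[OF u]]] J.dom_cod[OF u] com[OF u] by simp
  ultimately show ?thesis
    using is_functor_comp[OF dia F] functor_ob[OF F v] functor_hom[OF F leg] J.dom_cod
    unfolding is_cone_def by simp
qed

section \<open>Equivalences of categories and colimits\<close>

definition fully_faithful ::
  "('o1, 'm1) cat \<Rightarrow> ('o2, 'm2) cat \<Rightarrow> ('o1, 'm1, 'o2, 'm2) fctr \<Rightarrow> bool" where
  "fully_faithful C D F \<longleftrightarrow> (\<forall>a\<in>Obj C. \<forall>b\<in>Obj C.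
     bij_betw (arr_map F) (Hom C a b) (Hom D (ob_map F a) (ob_map F b)))"

definition inverse_arrows :: "('o, 'm) cat \<Rightarrow> 'o \<Rightarrow> 'o \<Rightarrow> 'm \<Rightarrow> 'm \<Rightarrow> bool" where
  "inverse_arrows C a b f g \<longleftrightarrow>
     f \<in> Hom C a b \<and> g \<in> Hom C b a \<and> Comp C g f = Id C a \<and> Comp C f g = Id C b"

definition essentially_surjective ::
  "('o1, 'm1) cat \<Rightarrow> ('o2, 'm2) cat \<Rightarrow> ('o1, 'm1, 'o2, 'm2) fctr \<Rightarrow> bool" where
  "essentially_surjective C D F \<longleftrightarrow>
     (\<forall>d\<in>Obj D. \<exists>c\<in>Obj C. \<exists>m n. inverse_arrows D (ob_map F c) d m n)"

lemma is_iso_inverse: "inverse_arrows C a b f g \<Longrightarrow> is_iso C f"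
  by (auto simp: inverse_arrows_def is_iso_def Hom_def)

lemma fully_faithfulD:
  assumes "fully_faithful C D F" "is_functor C D F"
  shows "\<And>f g a b. f \<in> Hom C a b \<Longrightarrow> g \<in> Hom C a b \<Longrightarrow> arr_map F f = arr_map F g \<Longrightarrow> f = g"
    and "\<And>a b k. a \<in> Obj C \<Longrightarrow> b \<in> Obj C \<Longrightarrow> k \<in> Hom D (ob_map F a) (ob_map F b) \<Longrightarrow>
      \<exists>f\<in>Hom C a b. arr_map F f = k"
proof -
  show "f = g" if "f \<in> Hom C a b" "g \<in> Hom C a b" "arr_map F f = arr_map F g" for f g a b
    using that assms(1) Hom_Obj[OF functor_cat(1)[OF assms(2)] that(1)]
    unfolding fully_faithful_def bij_betw_def inj_on_def by blast
  show "\<exists>f\<in>Hom C a b. arr_map F f = k"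
    if "a \<in> Obj C" "b \<in> Obj C" "k \<in> Hom D (ob_map F a) (ob_map F b)" for a b k
    using that assms(1) unfolding fully_faithful_def bij_betw_def by (metis imageE)
qed

lemma fully_faithful_reflects_inverse:
  assumes F: "is_functor C D F" and ff: "fully_faithful C D F"
    and fg: "f \<in> Hom C a b" "g \<in> Hom C b a"
    and inv: "inverse_arrows D (ob_map F a) (ob_map F b) (arr_map F f) (arr_map F g)"
  shows "inverse_arrows C a b f g"
proof -
  interpret C: category C using functor_cat[OF F] by simp
  note ab = Hom_Obj[OF C.category_axioms fg(1)]
  have "Comp C g f = Id C a" "Comp C f g = Id C b"
    using inv fg ab C.comp_hom C.id_hom functor_comp[OF F] functor_id[OF F]
    by (auto intro!: fully_faithfulD(1)[OF ff F] simp: inverse_arrows_def)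
  with fg show ?thesis by (simp add: inverse_arrows_def)
qed

text \<open>
  The inverse functor sends \<open>d\<close> to a chosen object \<open>gob d\<close> with an isomorphism
  \<open>m d : F (gob d) \<rightarrow> d\<close> and an arrow to the unique arrow over its conjugate by these
  isomorphisms. The family \<open>m\<close> is then natural by construction, and the other natural isomorphism
  is the preimage under \<open>F\<close> of the inverses of \<open>m\<close>.
\<close>

lemma equivalence_of_fully_faithful:
  assumes F: "is_functor C D F" and ff: "fully_faithful C D F"
    and es: "essentially_surjective C D F"
  shows "equivalent_categories C D"
proof -
  interpret C: category C using functor_cat[OF F] by simp
  interpret D: category D using functor_cat[OF F] by simp
  note faithful = fully_faithfulD(1)[OF ff F] and full = fully_faithfulD(2)[OF ff F]
  obtain gob m n where gob: "\<And>d. d \<in> Obj D \<Longrightarrow> gob d \<in> Obj C"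
    and mn: "\<And>d. d \<in> Obj D \<Longrightarrow> inverse_arrows D (ob_map F (gob d)) d (m d) (n d)"
    using es unfolding essentially_surjective_def by metis
  have m: "m d \<in> Hom D (ob_map F (gob d)) d" and n: "n d \<in> Hom D d (ob_map F (gob d))"
    and nm: "Comp D (n d) (m d) = Id D (ob_map F (gob d))" and mn1: "Comp D (m d) (n d) = Id D d"
    if "d \<in> Obj D" for d
    using mn[OF that] by (auto simp: inverse_arrows_def)
  define conj where "conj k = Comp D (n (Cod D k)) (Comp D k (m (Dom D k)))" for k
  have conj: "conj k \<in> Hom D (ob_map F (gob d)) (ob_map F (gob e))"
    and conj_m: "Comp D (m e) (conj k) = Comp D k (m d)"
    if k: "k \<in> Hom D d e" for k d e
  proof -
    note de = Hom_Obj[OF D.category_axioms k]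
    have eq: "conj k = Comp D (n e) (Comp D k (m d))" using k by (simp add: conj_def Hom_def)
    have km: "Comp D k (m d) \<in> Hom D (ob_map F (gob d)) e"
      by (rule D.comp_hom[OF m[OF de(1)] k])
    show "conj k \<in> Hom D (ob_map F (gob d)) (ob_map F (gob e))"
      unfolding eq by (rule D.comp_hom[OF km n[OF de(2)]])
    show "Comp D (m e) (conj k) = Comp D k (m d)"
      unfolding eq D.assoc[OF km n[OF de(2)] m[OF de(2)]] mn1[OF de(2)] by (rule D.id_left[OF km])
  qed
  define garr where
    "garr k = (SOME f. f \<in> Hom C (gob (Dom D k)) (gob (Cod D k)) \<and> arr_map F f = conj k)" for k
  have garr: "garr k \<in> Hom C (gob d) (gob e)" "arr_map F (garr k) = conj k"
    if k: "k \<in> Hom D d e" for k d e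
  proof -
    note de = Hom_Obj[OF D.category_axioms k]
    have "\<exists>f. f \<in> Hom C (gob (Dom D k)) (gob (Cod D k)) \<and> arr_map F f = conj k"
      using full[OF gob gob conj, OF de k] k by (auto simp: Hom_def)
    from someI_ex[OF this] show "garr k \<in> Hom C (gob d) (gob e)" "arr_map F (garr k) = conj k"
      using k unfolding garr_def by (auto simp: Hom_def)
  qed
  define G where "G = \<lparr>ob_map = (\<lambda>d\<in>Obj D. gob d), arr_map = (\<lambda>k\<in>Arr D. garr k)\<rparr>"
  have Gob [simp]: "ob_map G d = gob d" if "d \<in> Obj D" for d using that by (simp add: G_def)
  have Garr [simp]: "arr_map G k = garr k" if "k \<in> Hom D d e" for k d e
    using that by (simp add: G_def Hom_def)
  \<comment> \<open>an arrow into \<open>F (gob e)\<close> is determined by its composite with the invertible arrow \<open>m e\<close>\<close>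
  have cancel: "x = y" if "x \<in> Hom D d (ob_map F (gob e))" "y \<in> Hom D d (ob_map F (gob e))"
    "Comp D (m e) x = Comp D (m e) y" "e \<in> Obj D" for x y d e
  proof -
    have "x = Comp D (n e) (Comp D (m e) x)" if "x \<in> Hom D d (ob_map F (gob e))" for x
      using D.assoc[OF that m n] D.id_left[OF that] nm \<open>e \<in> Obj D\<close> by simp
    with that show ?thesis by metis
  qed
  have G: "is_functor D C G"
  proof (rule is_functorI)
    show "ob_map G \<in> extensional (Obj D)" "arr_map G \<in> extensional (Arr D)"
      by (simp_all add: G_def)
    fix f a b assume f: "f \<in> Hom D a b"
    note ab = Hom_Obj[OF D.category_axioms f]
    show "arr_map G f \<in> Hom C (ob_map G a) (ob_map G b)"
      using garr(1)[OF f] ab Garr[OF f] by simp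
    fix g c assume g: "g \<in> Hom D b c"
    note c = Hom_Obj[OF D.category_axioms g]
    note gf = D.comp_hom[OF f g] and ggf = C.comp_hom[OF garr(1)[OF f] garr(1)[OF g]]
    have "conj (Comp D g f) = Comp D (conj g) (conj f)"
    proof (rule cancel[OF conj[OF gf] D.comp_hom[OF conj[OF f] conj[OF g]] _ c(2)])
      have "Comp D (m c) (Comp D (conj g) (conj f)) = Comp D (Comp D g (m b)) (conj f)"
        using D.assoc[OF conj[OF f] conj[OF g] m[OF c(2)]] conj_m[OF g] by simp
      also have "\<dots> = Comp D g (Comp D f (m a))"
        using D.assoc[OF conj[OF f] m[OF ab(2)] g] conj_m[OF f] by simp
      also have "\<dots> = Comp D (m c) (conj (Comp D g f))"
        using D.assoc[OF m[OF ab(1)] f g] conj_m[OF gf] by simp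
      finally show "Comp D (m c) (conj (Comp D g f)) = Comp D (m c) (Comp D (conj g) (conj f))"
        by simp
    qed
    then have "garr (Comp D g f) = Comp C (garr g) (garr f)"
      using faithful[OF garr(1)[OF gf] ggf] garr(2)[OF gf] garr(2)[OF f] garr(2)[OF g]
        functor_comp[OF F garr(1)[OF f] garr(1)[OF g]] by simp
    then show "arr_map G (Comp D g f) = Comp C (arr_map G g) (arr_map G f)"
      using f g gf Garr by metis
  next
    fix a assume a: "a \<in> Obj D"
    note ida = D.id_hom[OF a]
    have "conj (Id D a) = Id D (ob_map F (gob a))"
      using cancel[OF conj[OF ida] D.id_hom[OF functor_ob[OF F gob[OF a]]] _ a]
        conj_m[OF ida] D.id_left[OF m[OF a]] D.id_right[OF m[OF a]] by simp
    then have "garr (Id D a) = Id C (gob a)"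
      using faithful[OF garr(1)[OF ida] C.id_hom[OF gob[OF a]]] garr(2)[OF ida]
        functor_id[OF F gob[OF a]] by simp
    then show "arr_map G (Id D a) = Id C (ob_map G a)" using a Garr[OF ida] by simp
  qed (use gob in \<open>simp_all add: C.category_axioms D.category_axioms\<close>)
  have FG: "is_functor D D (comp_functor D F G)" and GF: "is_functor C C (comp_functor C G F)"
    by (rule is_functor_comp[OF G F], rule is_functor_comp[OF F G])
  have "nat_trans D D (comp_functor D F G) (id_functor D) (\<lambda>d\<in>Obj D. m d)"
    unfolding nat_trans_def
  proof (intro conjI ballI)
    fix f assume f: "f \<in> Arr D"
    note fh = Arr_Hom[OF f]
    show "Comp D (arr_map (id_functor D) f) ((\<lambda>d\<in>Obj D. m d) (Dom D f)) =
         Comp D ((\<lambda>d\<in>Obj D. m d) (Cod D f)) (arr_map (comp_functor D F G) f)"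
      using D.dom_cod[OF f] f conj_m[OF fh] garr[OF fh] Garr[OF fh] by (simp add: id_functor_def)
  qed (use m FG is_functor_id[OF D.category_axioms] in \<open>simp_all add: id_functor_def\<close>)
  then have 1: "naturally_isomorphic D D (comp_functor D F G) (id_functor D)"
    unfolding naturally_isomorphic_def using is_iso_inverse[OF mn]
    by (intro exI[of _ "\<lambda>d\<in>Obj D. m d"]) simp
  have "\<exists>h. inverse_arrows C c (gob (ob_map F c)) (fst h) (snd h) \<and>
      arr_map F (fst h) = n (ob_map F c)" if c: "c \<in> Obj C" for c
  proof -
    note Fc = functor_ob[OF F c]
    obtain f g where "f \<in> Hom C c (gob (ob_map F c))" "arr_map F f = n (ob_map F c)"
      "g \<in> Hom C (gob (ob_map F c)) c" "arr_map F g = m (ob_map F c)"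
      using full[OF c gob n] full[OF gob c m] Fc by metis
    then show ?thesis
      using fully_faithful_reflects_inverse[OF F ff, of f c _ g] mn[OF Fc]
      by (intro exI[of _ "(f, g)"]) (auto simp: inverse_arrows_def)
  qed
  then obtain h where h: "\<And>c. c \<in> Obj C \<Longrightarrow>
      inverse_arrows C c (gob (ob_map F c)) (fst (h c)) (snd (h c)) \<and>
      arr_map F (fst (h c)) = n (ob_map F c)" by metis
  have hh: "fst (h c) \<in> Hom C c (gob (ob_map F c))" if "c \<in> Obj C" for c
    using h[OF that] by (simp add: inverse_arrows_def)
  have "nat_trans C C (id_functor C) (comp_functor C G F) (\<lambda>c\<in>Obj C. fst (h c))"
    unfolding nat_trans_def
  proof (intro conjI ballI)
    fix f assume f: "f \<in> Arr C"
    note fh = Arr_Hom[OF f] and ab = C.dom_cod[OF f]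
    let ?a = "Dom C f" and ?b = "Cod C f"
    note Ff = functor_hom[OF F fh]
    note ha = hh[OF conjunct1[OF ab]] and hb = hh[OF conjunct2[OF ab]]
    note Fab = functor_ob[OF F conjunct1[OF ab]] functor_ob[OF F conjunct2[OF ab]]
    note gFf = garr[OF Ff]
    have "Comp C (garr (arr_map F f)) (fst (h ?a)) = Comp C (fst (h ?b)) f"
    proof (rule faithful[OF C.comp_hom[OF ha gFf(1)] C.comp_hom[OF fh hb]])
      have "Comp D (conj (arr_map F f)) (n (ob_map F ?a)) = Comp D (n (ob_map F ?b)) (arr_map F f)"
      proof (rule cancel[OF D.comp_hom[OF n conj[OF Ff]] D.comp_hom[OF Ff n]])
        show "Comp D (m (ob_map F ?b)) (Comp D (conj (arr_map F f)) (n (ob_map F ?a))) =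
          Comp D (m (ob_map F ?b)) (Comp D (n (ob_map F ?b)) (arr_map F f))"
          using D.assoc[OF n conj[OF Ff] m] conj_m[OF Ff] D.assoc[OF n m Ff] mn1 Fab
            D.assoc[OF Ff n m] D.id_left[OF Ff] D.id_right[OF Ff] by simp
      qed (rule Fab)+
      then show "arr_map F (Comp C (garr (arr_map F f)) (fst (h ?a))) =
          arr_map F (Comp C (fst (h ?b)) f)"
        using functor_comp[OF F ha gFf(1)] functor_comp[OF F fh hb] gFf(2) h ab by simp
    qed
    then show "Comp C (arr_map (comp_functor C G F) f) ((\<lambda>c\<in>Obj C. fst (h c)) ?a) =
         Comp C ((\<lambda>c\<in>Obj C. fst (h c)) ?b) (arr_map (id_functor C) f)"
      using f ab Garr[OF Ff] by (simp add: id_functor_def)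
  qed (use hh GF is_functor_id[OF C.category_axioms] functor_ob[OF F] in \<open>simp_all add: id_functor_def\<close>)
  then have 2: "naturally_isomorphic C C (id_functor C) (comp_functor C G F)"
    unfolding naturally_isomorphic_def using is_iso_inverse[OF conjunct1[OF h]]
    by (intro exI[of _ "\<lambda>c\<in>Obj C. fst (h c)"]) simp
  show ?thesis
    unfolding equivalent_categories_def using F G 1 2 by blast
qed

text \<open>
  Equivalences preserve colimits: a cocone under the image of the diagram has, up to isomorphism,
  a vertex \<open>F Y\<close>, so that it comes from a cocone under the diagram itself. The vertex is allowed
  to be any object isomorphic to the image of the given one, since a model is only isomorphic to,
  and not literally equal to, a presheaf of the form \<open>Hom(-,X)\<close>.
\<close>

lemma colimit_under_equivalence:
  assumes F: "is_functor C D F" and ff: "fully_faithful C D F"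
    and es: "essentially_surjective C D F"
    and K: "colimit_cocone C K" and mn: "inverse_arrows D (ob_map F (vertex K)) M m n"
  shows "colimit_cocone D \<lparr>shape = shape K, diagram = comp_functor (shape K) F (diagram K),
     vertex = M, leg = (\<lambda>i\<in>Obj (shape K). Comp D m (arr_map F (leg K i)))\<rparr>"
    (is "colimit_cocone D ?K")
proof -
  interpret C: category C using functor_cat[OF F] by simp
  interpret D: category D using functor_cat[OF F] by simp
  note faithful = fully_faithfulD(1)[OF ff F] and full = fully_faithfulD(2)[OF ff F]
  let ?J = "shape K" and ?V = "vertex K"
  define d where "d i = ob_map (diagram K) i" for i
  define F' where "F' f = arr_map F f" for f
  have dia: "is_functor ?J C (diagram K)" and V: "?V \<in> Obj C"
    and leg: "\<And>i. i \<in> Obj ?J \<Longrightarrow> leg K i \<in> Hom C (d i) ?V"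
    and com: "\<And>u. u \<in> Arr ?J \<Longrightarrow>
        Comp C (leg K (Cod ?J u)) (arr_map (diagram K) u) = leg K (Dom ?J u)"
    and univ: "\<And>L. \<lbrakk>is_cocone C L; shape L = ?J; diagram L = diagram K\<rbrakk> \<Longrightarrow>
        \<exists>!t. t \<in> Hom C ?V (vertex L) \<and> (\<forall>i\<in>Obj ?J. Comp C t (leg K i) = leg L i)"
    using K by (auto simp: colimit_cocone_iff is_cocone_iff d_def)
  interpret J: category ?J using functor_cat[OF dia] by simp
  have m: "m \<in> Hom D (ob_map F ?V) M" and n: "n \<in> Hom D M (ob_map F ?V)"
    and nm: "Comp D n m = Id D (ob_map F ?V)" and mn': "Comp D m n = Id D M"
    using mn by (auto simp: inverse_arrows_def)
  have dOb: "d i \<in> Obj C" if "i \<in> Obj ?J" for i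
    using functor_ob[OF dia that] by (simp add: d_def)
  have Du: "arr_map (diagram K) u \<in> Hom C (d (Dom ?J u)) (d (Cod ?J u))" if "u \<in> Arr ?J" for u
    using functor_hom[OF dia Arr_Hom[OF that]] by (simp add: d_def)
  have Fleg: "F' (leg K i) \<in> Hom D (ob_map F (d i)) (ob_map F ?V)" if "i \<in> Obj ?J" for i
    unfolding F'_def by (rule functor_hom[OF F leg[OF that]])
  have cK: "is_cocone D ?K"
    unfolding is_cocone_iff
  proof (intro conjI ballI)
    fix u assume "u \<in> Arr (shape ?K)"
    then have u: "u \<in> Arr ?J" by simp
    note ab = J.dom_cod[OF u]
    have "Comp D (Comp D m (F' (leg K (Cod ?J u)))) (F' (arr_map (diagram K) u))
      = Comp D m (Comp D (F' (leg K (Cod ?J u))) (F' (arr_map (diagram K) u)))"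
      using D.assoc[OF functor_hom[OF F Du[OF u]] Fleg m] ab by (simp add: F'_def)
    also have "Comp D (F' (leg K (Cod ?J u))) (F' (arr_map (diagram K) u)) = F' (leg K (Dom ?J u))"
      using functor_comp[OF F Du[OF u] leg] ab com[OF u] by (simp add: F'_def)
    finally show "Comp D (leg ?K (Cod (shape ?K) u)) (arr_map (diagram ?K) u)
      = leg ?K (Dom (shape ?K) u)" using u ab by (simp add: F'_def)
  qed (use is_functor_comp[OF dia F] D.comp_hom[OF Fleg m] Hom_Obj[OF D.category_axioms m]
      in \<open>simp_all add: F'_def d_def\<close>)
  show ?thesis
    unfolding colimit_cocone_iff
  proof (intro conjI allI impI cK)
    fix L assume L: "is_cocone D L" "shape L = shape ?K" "diagram L = diagram ?K"
    then have sL: "shape L = ?J" and dL: "diagram L = comp_functor ?J F (diagram K)" by simp_all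
    have N: "vertex L \<in> Obj D"
      and legL: "\<And>i. i \<in> Obj ?J \<Longrightarrow> leg L i \<in> Hom D (ob_map F (d i)) (vertex L)"
      and comL: "\<And>u. u \<in> Arr ?J \<Longrightarrow>
          Comp D (leg L (Cod ?J u)) (F' (arr_map (diagram K) u)) = leg L (Dom ?J u)"
      using L(1) by (auto simp: is_cocone_iff sL dL d_def F'_def)
    obtain Y p q where Y: "Y \<in> Obj C" and pq: "inverse_arrows D (ob_map F Y) (vertex L) p q"
      using es N unfolding essentially_surjective_def by blast
    have p: "p \<in> Hom D (ob_map F Y) (vertex L)" and q: "q \<in> Hom D (vertex L) (ob_map F Y)"
      and qp: "Comp D q p = Id D (ob_map F Y)" and pq': "Comp D p q = Id D (vertex L)"
      using pq by (auto simp: inverse_arrows_def)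
    have "\<exists>s. s \<in> Hom C (d i) Y \<and> F' s = Comp D q (leg L i)" if "i \<in> Obj ?J" for i
      using full[OF dOb[OF that] Y D.comp_hom[OF legL[OF that] q]] by (auto simp: F'_def)
    then obtain s where s: "\<And>i. i \<in> Obj ?J \<Longrightarrow> s i \<in> Hom C (d i) Y"
      and Fs: "\<And>i. i \<in> Obj ?J \<Longrightarrow> F' (s i) = Comp D q (leg L i)" by metis
    let ?S = "\<lparr>shape = ?J, diagram = diagram K, vertex = Y, leg = (\<lambda>i\<in>Obj ?J. s i)\<rparr>"
    have "is_cocone C ?S"
      unfolding is_cocone_iff
    proof (intro conjI ballI)
      fix u assume "u \<in> Arr (shape ?S)"
      then have u: "u \<in> Arr ?J" by simp
      note ab = J.dom_cod[OF u]
      have "Comp C (s (Cod ?J u)) (arr_map (diagram K) u) = s (Dom ?J u)"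
      proof (rule faithful[OF C.comp_hom[OF Du[OF u]]])
        have "F' (Comp C (s (Cod ?J u)) (arr_map (diagram K) u))
          = Comp D (Comp D q (leg L (Cod ?J u))) (F' (arr_map (diagram K) u))"
          using functor_comp[OF F Du[OF u] s] ab Fs by (simp add: F'_def)
        also have "\<dots> = F' (s (Dom ?J u))"
          using D.assoc[OF functor_hom[OF F Du[OF u]] legL q] ab comL[OF u] Fs by (simp add: F'_def)
        finally show "arr_map F (Comp C (s (Cod ?J u)) (arr_map (diagram K) u))
          = arr_map F (s (Dom ?J u))" by (simp add: F'_def)
      qed (use s ab in auto)
      then show "Comp C (leg ?S (Cod (shape ?S) u)) (arr_map (diagram ?S) u)
        = leg ?S (Dom (shape ?S) u)" using ab by simp
    qed (use dia Y s in \<open>simp_all add: d_def\<close>)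
    then have "\<exists>!t. t \<in> Hom C ?V Y \<and> (\<forall>i\<in>Obj ?J. Comp C t (leg K i) = s i)"
      using univ[of ?S] by simp
    then obtain t where t: "t \<in> Hom C ?V Y"
      and ts: "\<And>i. i \<in> Obj ?J \<Longrightarrow> Comp C t (leg K i) = s i"
      and tuniq: "\<And>t'. t' \<in> Hom C ?V Y \<Longrightarrow> (\<And>i. i \<in> Obj ?J \<Longrightarrow> Comp C t' (leg K i) = s i) \<Longrightarrow> t' = t"
      by blast
    note Ft = functor_hom[OF F t, folded F'_def]
    define r where "r = Comp D p (Comp D (F' t) n)"
    have Ftn: "Comp D (F' t) n \<in> Hom D M (ob_map F Y)" by (rule D.comp_hom[OF n Ft])
    have r: "r \<in> Hom D M (vertex L)" unfolding r_def by (rule D.comp_hom[OF Ftn p])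
    have rm: "Comp D r m = Comp D p (F' t)"
      unfolding r_def using D.assoc[OF m Ftn p] D.assoc[OF m n Ft] nm D.id_right[OF Ft] by simp
    have rleg: "Comp D r (Comp D m (F' (leg K i))) = leg L i" if i: "i \<in> Obj ?J" for i
    proof -
      have "Comp D r (Comp D m (F' (leg K i))) = Comp D p (Comp D (F' t) (F' (leg K i)))"
        using D.assoc[OF Fleg[OF i] m r] rm D.assoc[OF Fleg[OF i] Ft p] by simp
      also have "Comp D (F' t) (F' (leg K i)) = Comp D q (leg L i)"
        using functor_comp[OF F leg[OF i] t] ts[OF i] Fs[OF i] by (simp add: F'_def)
      also have "Comp D p \<dots> = leg L i"
        using D.assoc[OF legL[OF i] q p] pq' D.id_left[OF legL[OF i]] by simp
      finally show ?thesis .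
    qed
    show "\<exists>!t. t \<in> Hom D (vertex ?K) (vertex L) \<and>
        (\<forall>i\<in>Obj (shape ?K). Comp D t (leg ?K i) = leg L i)"
    proof (rule ex1I[of _ r])
      show "r \<in> Hom D (vertex ?K) (vertex L) \<and> (\<forall>i\<in>Obj (shape ?K). Comp D r (leg ?K i) = leg L i)"
        using r rleg by (simp add: F'_def)
      fix r' assume "r' \<in> Hom D (vertex ?K) (vertex L) \<and>
        (\<forall>i\<in>Obj (shape ?K). Comp D r' (leg ?K i) = leg L i)"
      then have r': "r' \<in> Hom D M (vertex L)"
        and r'leg: "\<And>i. i \<in> Obj ?J \<Longrightarrow> Comp D r' (Comp D m (F' (leg K i))) = leg L i"
        by (auto simp: F'_def)
      have r'm: "Comp D r' m \<in> Hom D (ob_map F ?V) (vertex L)" by (rule D.comp_hom[OF m r'])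
      obtain t' where t': "t' \<in> Hom C ?V Y" and Ft': "F' t' = Comp D q (Comp D r' m)"
        using full[OF V Y D.comp_hom[OF r'm q]] by (auto simp: F'_def)
      have "t' = t"
      proof (rule tuniq[OF t'])
        fix i assume i: "i \<in> Obj ?J"
        have "F' (Comp C t' (leg K i)) = Comp D (Comp D q (Comp D r' m)) (F' (leg K i))"
          using functor_comp[OF F leg[OF i] t'] Ft' by (simp add: F'_def)
        also have "\<dots> = F' (s i)"
          using D.assoc[OF Fleg[OF i] r'm q] D.assoc[OF Fleg[OF i] m r'] r'leg[OF i] Fs[OF i] by simp
        finally show "Comp C t' (leg K i) = s i"
          using faithful[OF C.comp_hom[OF leg[OF i] t'] s[OF i]] by (simp add: F'_def)
      qed
      then have qr: "Comp D q (Comp D r' m) = F' t" using Ft' by simp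
      have "Comp D r' m = Comp D p (F' t)"
        using D.assoc[OF r'm q p] pq' D.id_left[OF r'm] qr by simp
      then have "Comp D (Comp D r' m) n = Comp D (Comp D r m) n" using rm by simp
      then show "r' = r"
        using D.assoc[OF n m r] D.assoc[OF n m r'] mn' D.id_right[OF r] D.id_right[OF r'] by simp
    qed
  qed
qed

definition transport_cat :: "('i \<Rightarrow> 'k) \<Rightarrow> ('j \<Rightarrow> 'l) \<Rightarrow> ('i, 'j) cat \<Rightarrow> ('k, 'l) cat" where
  "transport_cat a b J = \<lparr>Obj = a ` Obj J, Arr = b ` Arr J,
     Dom = (\<lambda>v. a (Dom J (inv_into (Arr J) b v))),
     Cod = (\<lambda>v. a (Cod J (inv_into (Arr J) b v))),
     Id = (\<lambda>x. b (Id J (inv_into (Obj J) a x))),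
     Comp = (\<lambda>v u. b (Comp J (inv_into (Arr J) b v) (inv_into (Arr J) b u)))\<rparr>"

text \<open>
  For a small model the index category must have its objects and arrows in \<open>'u\<close>, whereas colimits
  are more naturally indexed by other types. Renaming along injections changes nothing.
\<close>

lemma colimit_reindex:
  assumes K: "colimit_cocone C K"
    and a: "inj_on a (Obj (shape K))" and b: "inj_on b (Arr (shape K))"
  obtains K' where "shape K' = transport_cat a b (shape K)" "category (shape K')"
    "colimit_cocone C K'" "vertex K' = vertex K"
    "\<And>i. i \<in> Obj (shape K) \<Longrightarrow> ob_map (diagram K') (a i) = ob_map (diagram K) i"
proof -
  let ?J = "shape K" and ?J' = "transport_cat a b (shape K)"
  let ?a' = "inv_into (Obj ?J) a" and ?b' = "inv_into (Arr ?J) b"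
  have dia: "is_functor ?J C (diagram K)" and V: "vertex K \<in> Obj C"
    and leg: "\<And>i. i \<in> Obj ?J \<Longrightarrow> leg K i \<in> Hom C (ob_map (diagram K) i) (vertex K)"
    and com: "\<And>u. u \<in> Arr ?J \<Longrightarrow>
        Comp C (leg K (Cod ?J u)) (arr_map (diagram K) u) = leg K (Dom ?J u)"
    and univ: "\<And>L. \<lbrakk>is_cocone C L; shape L = ?J; diagram L = diagram K\<rbrakk> \<Longrightarrow>
        \<exists>!t. t \<in> Hom C (vertex K) (vertex L) \<and> (\<forall>i\<in>Obj ?J. Comp C t (leg K i) = leg L i)"
    using K by (auto simp: colimit_cocone_iff is_cocone_iff)
  interpret J: category ?J using functor_cat[OF dia] by simp
  have sel: "Obj ?J' = a ` Obj ?J" "Arr ?J' = b ` Arr ?J"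
    "\<And>u. u \<in> Arr ?J \<Longrightarrow> Dom ?J' (b u) = a (Dom ?J u)"
    "\<And>u. u \<in> Arr ?J \<Longrightarrow> Cod ?J' (b u) = a (Cod ?J u)"
    "\<And>i. i \<in> Obj ?J \<Longrightarrow> Id ?J' (a i) = b (Id ?J i)"
    "\<And>u v. u \<in> Arr ?J \<Longrightarrow> v \<in> Arr ?J \<Longrightarrow> Comp ?J' (b v) (b u) = b (Comp ?J v u)"
    using a b by (simp_all add: transport_cat_def)
  have aeq: "a i = a j \<longleftrightarrow> i = j" if "i \<in> Obj ?J" "j \<in> Obj ?J" for i j
    using a that by (auto dest: inj_onD)
  have HomJ': "u' \<in> Hom ?J' x' y' \<longleftrightarrow>
      (\<exists>u x y. u \<in> Hom ?J x y \<and> u' = b u \<and> x' = a x \<and> y' = a y)" for u' x' y'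
    unfolding Hom_def by (auto simp: sel image_iff)
  have HomJ: "b u \<in> Hom ?J' (a x) (a y)" if "u \<in> Hom ?J x y" for u x y
    using that HomJ' by blast
  have J': "category ?J'"
  proof
    fix f assume "f \<in> Arr ?J'"
    then show "Dom ?J' f \<in> Obj ?J' \<and> Cod ?J' f \<in> Obj ?J'" using J.dom_cod by (auto simp: sel)
  next
    fix x assume "x \<in> Obj ?J'"
    then show "Id ?J' x \<in> Hom ?J' x x" using J.id_hom HomJ by (auto simp: sel)
  next
    fix f x y g z assume f: "f \<in> Hom ?J' x y" and g: "g \<in> Hom ?J' y z"
    obtain f0 x0 y0 where f0: "f0 \<in> Hom ?J x0 y0" "f = b f0" "x = a x0" "y = a y0"
      using f HomJ' by auto
    note xy = Hom_Obj[OF J.category_axioms f0(1)]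
    obtain g0 z0 where g0: "g0 \<in> Hom ?J y0 z0" "g = b g0" "z = a z0"
      using g HomJ' aeq[OF _ xy(2)] f0(4) Hom_Obj[OF J.category_axioms] by metis
    show "Comp ?J' g f \<in> Hom ?J' x z"
      using HomJ[OF J.comp_hom[OF f0(1) g0(1)]] f0 g0 by (simp add: sel Hom_Arr)
    fix h w assume h: "h \<in> Hom ?J' z w"
    note yz = Hom_Obj[OF J.category_axioms g0(1)]
    obtain h0 w0 where h0: "h0 \<in> Hom ?J z0 w0" "h = b h0" "w = a w0"
      using h HomJ' aeq[OF _ yz(2)] g0(3) Hom_Obj[OF J.category_axioms] by metis
    show "Comp ?J' h (Comp ?J' g f) = Comp ?J' (Comp ?J' h g) f"
      using f0 g0 h0 J.assoc[OF f0(1) g0(1) h0(1)] J.comp_hom[OF f0(1) g0(1)]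
        J.comp_hom[OF g0(1) h0(1)] by (simp add: sel Hom_Arr)
  next
    fix f x y assume f: "f \<in> Hom ?J' x y"
    then obtain f0 x0 y0 where f0: "f0 \<in> Hom ?J x0 y0" "f = b f0" "x = a x0" "y = a y0"
      using HomJ' by auto
    note xy = Hom_Obj[OF J.category_axioms f0(1)]
    show "Comp ?J' (Id ?J' y) f = f" "Comp ?J' f (Id ?J' x) = f"
      using f0 xy J.id_left[OF f0(1)] J.id_right[OF f0(1)] J.id_hom[THEN Hom_Arr]
      by (simp_all add: sel Hom_Arr)
  qed
  let ?P = "\<lparr>ob_map = restrict ?a' (Obj ?J'), arr_map = restrict ?b' (Arr ?J')\<rparr>"
  have P: "is_functor ?J' ?J ?P"
  proof (rule is_functorI)
    fix f x y assume f: "f \<in> Hom ?J' x y"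
    then obtain f0 x0 y0 where f0: "f0 \<in> Hom ?J x0 y0" "f = b f0" "x = a x0" "y = a y0"
      using HomJ' by auto
    note xy = Hom_Obj[OF J.category_axioms f0(1)]
    show "arr_map ?P f \<in> Hom ?J (ob_map ?P x) (ob_map ?P y)"
      using f0 xy a b by (simp add: sel Hom_Arr)
    fix g z assume g: "g \<in> Hom ?J' y z"
    obtain g0 z0 where g0: "g0 \<in> Hom ?J y0 z0" "g = b g0" "z = a z0"
      using g HomJ' aeq[OF _ xy(2)] f0(4) Hom_Obj[OF J.category_axioms] by metis
    show "arr_map ?P (Comp ?J' g f) = Comp ?J (arr_map ?P g) (arr_map ?P f)"
      using f0 g0 a b J.comp_hom[OF f0(1) g0(1)] by (simp add: sel Hom_Arr)
  next
    fix x assume "x \<in> Obj ?J'"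
    then obtain i where "i \<in> Obj ?J" "x = a i" by (auto simp: sel)
    then show "arr_map ?P (Id ?J' x) = Id ?J (ob_map ?P x)" "ob_map ?P x \<in> Obj ?J"
      using a b J.id_hom[THEN Hom_Arr] by (simp_all add: sel)
  qed (simp_all add: J' J.category_axioms)
  let ?K' = "\<lparr>shape = ?J', diagram = comp_functor ?J' (diagram K) ?P, vertex = vertex K,
     leg = (\<lambda>i\<in>Obj ?J'. leg K (?a' i))\<rparr>"
  have ob': "ob_map (diagram ?K') (a i) = ob_map (diagram K) i" if "i \<in> Obj ?J" for i
    using that a by (simp add: sel)
  have arr': "arr_map (diagram ?K') (b u) = arr_map (diagram K) u" if "u \<in> Arr ?J" for u
    using that b by (simp add: sel)
  have leg': "leg ?K' (a i) = leg K i" if "i \<in> Obj ?J" for i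
    using that a by (simp add: sel)
  have c': "is_cocone C ?K'"
    unfolding is_cocone_iff
  proof (intro conjI ballI)
    fix u' assume "u' \<in> Arr (shape ?K')"
    then obtain u where u: "u \<in> Arr ?J" "u' = b u" by (auto simp: sel)
    then show "Comp C (leg ?K' (Cod (shape ?K') u')) (arr_map (diagram ?K') u')
      = leg ?K' (Dom (shape ?K') u')"
      using J.dom_cod[OF u(1)] com[OF u(1)] arr'[OF u(1)] leg' by (simp add: sel del: comp_functor_sel)
  next
    fix i' assume "i' \<in> Obj (shape ?K')"
    then obtain i where i: "i \<in> Obj ?J" "i' = a i" by (auto simp: sel)
    then show "leg ?K' i' \<in> Hom C (ob_map (diagram ?K') i') (vertex ?K')"
      using leg[OF i(1)] leg'[OF i(1)] ob'[OF i(1)] by simp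
  qed (use is_functor_comp[OF P dia] V in \<open>simp_all\<close>)
  have "colimit_cocone C ?K'"
    unfolding colimit_cocone_iff
  proof (intro conjI allI impI c')
    fix L assume L: "is_cocone C L" "shape L = shape ?K'" "diagram L = diagram ?K'"
    then have sL: "shape L = ?J'" by simp
    let ?L = "\<lparr>shape = ?J, diagram = diagram K, vertex = vertex L,
       leg = (\<lambda>i\<in>Obj ?J. leg L (a i))\<rparr>"
    have "is_cocone C ?L"
      unfolding is_cocone_iff
    proof (intro conjI ballI)
      fix u assume "u \<in> Arr (shape ?L)"
      then have u: "u \<in> Arr ?J" by simp
      have "Comp C (leg L (Cod ?J' (b u))) (arr_map (diagram ?K') (b u)) = leg L (Dom ?J' (b u))"
        using L u by (auto simp: is_cocone_iff sel)
      then show "Comp C (leg ?L (Cod (shape ?L) u)) (arr_map (diagram ?L) u)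
        = leg ?L (Dom (shape ?L) u)"
        using J.dom_cod[OF u] arr'[OF u] u by (simp add: sel del: comp_functor_sel)
    next
      fix i assume "i \<in> Obj (shape ?L)"
      then have i: "i \<in> Obj ?J" by simp
      then have "leg L (a i) \<in> Hom C (ob_map (diagram ?K') (a i)) (vertex L)"
        using L by (auto simp: is_cocone_iff sel)
      then show "leg ?L i \<in> Hom C (ob_map (diagram ?L) i) (vertex ?L)" using ob'[OF i] i by simp
    qed (use L(1) dia in \<open>simp_all add: is_cocone_iff\<close>)
    from univ[OF this]
    have "\<exists>!t. t \<in> Hom C (vertex K) (vertex L) \<and> (\<forall>i\<in>Obj ?J. Comp C t (leg K i) = leg L (a i))"
      by simp
    moreover have "(\<forall>i'\<in>Obj ?J'. Comp C t (leg ?K' i') = leg L i') \<longleftrightarrow>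
        (\<forall>i\<in>Obj ?J. Comp C t (leg K i) = leg L (a i))" for t
      using leg' by (simp add: sel)
    ultimately show "\<exists>!t. t \<in> Hom C (vertex ?K') (vertex L) \<and>
        (\<forall>i\<in>Obj (shape ?K'). Comp C t (leg ?K' i) = leg L i)" by simp
  qed
  with J' ob' show ?thesis by (intro that[of ?K']) (simp_all del: comp_functor_sel)
qed

section \<open>Smallness\<close>

lemma small_subset: "small U A \<Longrightarrow> B \<subseteq> A \<Longrightarrow> small U B"
  unfolding small_def by (rule ordLeq_ordLess_trans[OF card_of_mono1])

lemma small_image: "small U A \<Longrightarrow> small U (f ` A)"
  unfolding small_def by (rule ordLeq_ordLess_trans[OF card_of_image])

lemma small_inj: "inj_on f A \<Longrightarrow> small U (f ` A) \<Longrightarrow> small U A"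
  unfolding small_def using card_of_ordLeq[of A "f ` A"] ordLeq_ordLess_trans by blast

lemma small_embed:
  assumes "small TYPE('u) A"
  obtains f :: "'a \<Rightarrow> 'u" where "inj_on f A"
  using assms unfolding small_def by (meson card_of_ordLeq ordLess_imp_ordLeq)

lemma small_fresh: "small TYPE('u) (A :: 'u set) \<Longrightarrow> \<exists>x. x \<notin> A"
  unfolding small_def using ordLess_irreflexive by (metis UNIV_eq_I)

context
  assumes inacc: "inaccessible TYPE('u)"
begin

lemma infinite_universe: "infinite (UNIV :: 'u set)"
  using inacc unfolding inaccessible_def using countable_finite by blast

lemma small_finite: "finite A \<Longrightarrow> small TYPE('u) A"
  unfolding small_def using infinite_universe
  by (simp add: finite_ordLess_infinite[OF card_of_Well_order card_of_Well_order] Field_card_of)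

lemma small_Pow:
  assumes "small TYPE('u) A" shows "small TYPE('u) (Pow A)"
proof -
  obtain f :: "'a \<Rightarrow> 'u" where f: "inj_on f A" using small_embed[OF assms] .
  have "small TYPE('u) (Pow (f ` A))"
    using inacc small_image[OF assms, of f] unfolding inaccessible_def by blast
  moreover have "image f ` Pow A = Pow (f ` A)" by (rule image_Pow_surj) simp
  moreover have "inj_on (image f) (Pow A)" by (rule inj_on_image_Pow[OF f])
  ultimately show ?thesis using small_inj[of "image f" "Pow A"] by simp
qed

lemma universe_pairing: obtains p :: "'u \<times> 'u \<Rightarrow> 'u" where "inj p"
proof -
  have "|UNIV \<times> UNIV :: ('u \<times> 'u) set| \<le>o |UNIV :: 'u set|"
    using card_of_Times_same_infinite[OF infinite_universe] ordIso_iff_ordLeq by blast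
  then show ?thesis using that by (auto simp: card_of_ordLeq[symmetric])
qed

text \<open>
  The universe bounds unions of families of subsets of \<open>'u\<close> only. A family in another type
  need not embed into \<open>'u\<close> as a whole before its union is known to be small; its disjoint sum
  does, through codes of pairs.
\<close>

lemma small_Sigma:
  assumes A: "small TYPE('u) A" and B: "\<And>a. a \<in> A \<Longrightarrow> small TYPE('u) (B a)"
  shows "small TYPE('u) (Sigma A B)"
proof -
  obtain p :: "'u \<times> 'u \<Rightarrow> 'u" where p: "inj p" by (rule universe_pairing)
  obtain e :: "'a \<Rightarrow> 'u" where e: "inj_on e A" using small_embed[OF A] .
  have "\<exists>g :: 'b \<Rightarrow> 'u. inj_on g (B a)" if "a \<in> A" for a using small_embed[OF B[OF that]] by blast
  then obtain g :: "'a \<Rightarrow> 'b \<Rightarrow> 'u" where g: "\<And>a. a \<in> A \<Longrightarrow> inj_on (g a) (B a)" by metis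
  define S where "S u = (\<lambda>b. p (u, g (inv_into A e u) b)) ` B (inv_into A e u)" for u
  have "small TYPE('u) (\<Union>u\<in>e ` A. S u)"
    using inacc small_image[OF A, of e] small_image[OF B] inv_into_into[of _ e A]
    unfolding inaccessible_def S_def by (metis (no_types, lifting))
  moreover have "(\<lambda>(a, b). p (e a, g a b)) ` Sigma A B = (\<Union>u\<in>e ` A. S u)"
    using e by (auto simp: S_def image_iff)
  moreover have "inj_on (\<lambda>(a, b). p (e a, g a b)) (Sigma A B)"
  proof (rule inj_onI, clarify)
    fix a b a' b'
    assume ab: "a \<in> A" "b \<in> B a" "a' \<in> A" "b' \<in> B a'" "p (e a, g a b) = p (e a', g a' b')"
    then have eq: "e a = e a'" "g a b = g a' b'" using injD[OF p] by auto
    then have "a = a'" using inj_onD[OF e] ab by simp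
    then show "a = a' \<and> b = b'" using inj_onD[OF g] ab eq by simp
  qed
  ultimately show ?thesis using small_inj[of "\<lambda>(a, b). p (e a, g a b)" "Sigma A B"] by simp
qed

lemma small_UN:
  assumes "small TYPE('u) A" "\<And>a. a \<in> A \<Longrightarrow> small TYPE('u) (B a)"
  shows "small TYPE('u) (\<Union>a\<in>A. B a)"
proof -
  have "(\<Union>a\<in>A. B a) = snd ` Sigma A B" by force
  then show ?thesis using small_image[OF small_Sigma[of A B, OF assms], of snd] by simp
qed

lemma small_Un: "small TYPE('u) A \<Longrightarrow> small TYPE('u) B \<Longrightarrow> small TYPE('u) (A \<union> B)"
  using small_UN[of "{True, False}" "\<lambda>b. if b then A else B", OF small_finite]
  by (simp add: Un_commute)

lemma small_insert: "small TYPE('u) A \<Longrightarrow> small TYPE('u) (insert x A)"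
  using small_Un[of "{x}" A] small_finite[of "{x}"] by simp

text \<open>
  A dependent function is determined by its graph, a subset of the disjoint sum.
\<close>

lemma small_PiE:
  assumes A: "small TYPE('u) A" and B: "\<And>a. a \<in> A \<Longrightarrow> small TYPE('u) (B a)"
  shows "small TYPE('u) (Pi\<^sub>E A B)"
proof -
  let ?G = "\<lambda>f. (\<lambda>a. (a, f a)) ` A"
  have G: "?G ` Pi\<^sub>E A B \<subseteq> Pow (Sigma A B)" by fastforce
  have "small TYPE('u) (?G ` Pi\<^sub>E A B)"
    by (rule small_subset[OF small_Pow[OF small_Sigma[OF A B]] G])
  moreover have "inj_on ?G (Pi\<^sub>E A B)"
  proof (rule inj_onI)
    fix f g assume f: "f \<in> Pi\<^sub>E A B" "g \<in> Pi\<^sub>E A B" and eq: "?G f = ?G g"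
    have "f a = g a" if "a \<in> A" for a
    proof -
      have "(a, f a) \<in> ?G g" using that eq by blast
      then show ?thesis by auto
    qed
    with f show "f = g" by (intro PiE_ext)
  qed
  ultimately show ?thesis by (intro small_inj[of ?G])
qed

end

section \<open>Limits of sets\<close>

lemma Set_sel [simp]:
  "Obj (Set :: ('u set, _) cat) = {A. small TYPE('u) A}"
  "Dom Set = src" "Cod Set = tgt" "Id Set A = Arrow A (\<lambda>x\<in>A. x) A"
  "Comp Set g f = Arrow (src f) (compose (src f) (fn g) (fn f)) (tgt g)"
  by (simp_all add: Set_def)

lemma Hom_Set: "f \<in> Hom Set (A :: 'u set) B \<longleftrightarrow>
    small TYPE('u) A \<and> small TYPE('u) B \<and> src f = A \<and> tgt f = B \<and> fn f \<in> A \<rightarrow>\<^sub>E B"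
  by (cases f) (auto simp: Hom_def Set_def)

lemma category_Set: "category (Set :: ('u set, _) cat)"
proof
  fix f :: "('u set, 'u \<Rightarrow> 'u) arrow" assume "f \<in> Arr Set"
  then show "Dom Set f \<in> Obj Set \<and> Cod Set f \<in> Obj Set" by (auto simp: Set_def)
next
  fix f g h :: "('u set, 'u \<Rightarrow> 'u) arrow" and A B C D
  assume f: "f \<in> Hom Set A B"
  show "Comp Set (Id Set B) f = f" "Comp Set f (Id Set A) = f"
    using f unfolding Hom_Set
    by (auto intro!: arrow.expand ext simp: compose_def PiE_def extensional_def Pi_def)
  assume g: "g \<in> Hom Set B C"
  show "Comp Set g f \<in> Hom Set A C" using f g unfolding Hom_Set
    by (auto simp: compose_def)
  assume h: "h \<in> Hom Set C D"
  show "Comp Set h (Comp Set g f) = Comp Set (Comp Set h g) f"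
    using f g h unfolding Hom_Set by (auto simp: compose_def fun_eq_iff)
qed (auto simp: Hom_Set)

lemma fn_eqI: "f \<in> Hom Set A B \<Longrightarrow> g \<in> Hom Set A B \<Longrightarrow> (\<And>x. x \<in> A \<Longrightarrow> fn f x = fn g x) \<Longrightarrow> f = g"
  unfolding Hom_Set by (intro arrow.expand) (auto intro: PiE_ext)

text \<open>
  Cones with a one-point vertex are compatible families of elements, and a cone with vertex
  \<open>A\<close> is a family of these indexed by \<open>A\<close>.
\<close>

lemma limit_cone_Set_iff:
  fixes K :: "('i, 'j, 'u set, ('u set, 'u \<Rightarrow> 'u) arrow) cone"
  assumes inacc: "inaccessible TYPE('u)" and K: "is_cone Set K"
  shows "limit_cone Set K \<longleftrightarrow>
     (\<forall>x. (\<forall>i\<in>Obj (shape K). x i \<in> ob_map (diagram K) i) \<longrightarrow>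
        (\<forall>u\<in>Arr (shape K). fn (arr_map (diagram K) u) (x (Dom (shape K) u)) = x (Cod (shape K) u)) \<longrightarrow>
        (\<exists>!v. v \<in> vertex K \<and> (\<forall>i\<in>Obj (shape K). fn (leg K i) v = x i)))" (is "_ \<longleftrightarrow> ?R")
proof -
  let ?J = "shape K" and ?D = "ob_map (diagram K)" and ?A = "arr_map (diagram K)"
  have dia: "is_functor ?J Set (diagram K)" and V: "small TYPE('u) (vertex K)"
    and leg: "\<And>i. i \<in> Obj ?J \<Longrightarrow> leg K i \<in> Hom Set (vertex K) (?D i)"
    using K by (auto simp: is_cone_def)
  interpret J: category ?J using functor_cat[OF dia] by simp
  have Du: "?A u \<in> Hom Set (?D (Dom ?J u)) (?D (Cod ?J u))" if "u \<in> Arr ?J" for u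
    by (rule functor_hom[OF dia Arr_Hom[OF that]])
  show ?thesis
  proof
    assume lim: "limit_cone Set K"
    have limD: "\<exists>!t. t \<in> Hom Set (vertex L) (vertex K) \<and> (\<forall>i\<in>Obj ?J. Comp Set (leg K i) t = leg L i)"
      if "is_cone Set L" "shape L = ?J" "diagram L = diagram K" for L
      using lim that unfolding limit_cone_def by blast
    show ?R
    proof (intro allI impI)
      fix x assume x: "\<forall>i\<in>Obj ?J. x i \<in> ?D i"
        and compat: "\<forall>u\<in>Arr ?J. fn (?A u) (x (Dom ?J u)) = x (Cod ?J u)"
      let ?one = "{undefined} :: 'u set"
      define L where "L = \<lparr>shape = ?J, diagram = diagram K, vertex = ?one,
        leg = (\<lambda>i\<in>Obj ?J. Arrow ?one (\<lambda>_\<in>?one. x i) (?D i))\<rparr>"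
      have one: "small TYPE('u) ?one" by (rule small_finite[OF inacc]) simp
      have Dsm: "small TYPE('u) (?D i)" if "i \<in> Obj ?J" for i
        using functor_ob[OF dia that] by simp
      have "is_cone Set L"
        unfolding is_cone_def
      proof (intro conjI ballI)
        fix u assume "u \<in> Arr (shape L)"
        then have u: "u \<in> Arr ?J" by (simp add: L_def)
        then show "Comp Set (arr_map (diagram L) u) (leg L (Dom (shape L) u))
          = leg L (Cod (shape L) u)"
          using compat J.dom_cod[OF u] Du[OF u] by (auto simp: L_def Hom_Set compose_def)
      qed (use dia one Dsm x in \<open>auto simp: L_def Hom_Set\<close>)
      then have "\<exists>!t. t \<in> Hom Set ?one (vertex K) \<and> (\<forall>i\<in>Obj ?J. Comp Set (leg K i) t = leg L i)"
        using limD[of L] by (simp add: L_def)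
      then obtain t where t: "t \<in> Hom Set ?one (vertex K)"
        and legt: "\<And>i. i \<in> Obj ?J \<Longrightarrow> Comp Set (leg K i) t = leg L i"
        and uniq: "\<And>t'. t' \<in> Hom Set ?one (vertex K) \<Longrightarrow>
           (\<And>i. i \<in> Obj ?J \<Longrightarrow> Comp Set (leg K i) t' = leg L i) \<Longrightarrow> t' = t" by blast
      show "\<exists>!v. v \<in> vertex K \<and> (\<forall>i\<in>Obj ?J. fn (leg K i) v = x i)"
      proof (rule ex1I[of _ "fn t undefined"])
        have "fn (leg K i) (fn t undefined) = x i" if "i \<in> Obj ?J" for i
        proof -
          have "fn (Comp Set (leg K i) t) undefined = fn (leg L i) undefined" using legt[OF that] by simp
          then show ?thesis using that t by (simp add: L_def Hom_Set compose_def)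
        qed
        then show "fn t undefined \<in> vertex K \<and> (\<forall>i\<in>Obj ?J. fn (leg K i) (fn t undefined) = x i)"
          using t by (auto simp: Hom_Set)
        fix v assume v: "v \<in> vertex K \<and> (\<forall>i\<in>Obj ?J. fn (leg K i) v = x i)"
        have "Arrow ?one (\<lambda>_\<in>?one. v) (vertex K) = t"
        proof (rule uniq)
          show "Arrow ?one (\<lambda>_\<in>?one. v) (vertex K) \<in> Hom Set ?one (vertex K)"
            using v V one by (simp add: Hom_Set)
          fix i assume i: "i \<in> Obj ?J"
          show "Comp Set (leg K i) (Arrow ?one (\<lambda>_\<in>?one. v) (vertex K)) = leg L i"
            using i v leg[OF i] by (auto simp: L_def Hom_Set compose_def)
        qed
        then show "v = fn t undefined" by auto
      qed
    qed
  next
    assume r: ?R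
    show "limit_cone Set K"
      unfolding limit_cone_def
    proof (intro conjI allI impI K)
      fix L assume L: "is_cone Set L" and sL: "shape L = ?J" and dL: "diagram L = diagram K"
      have legL: "\<And>i. i \<in> Obj ?J \<Longrightarrow> leg L i \<in> Hom Set (vertex L) (?D i)"
        and comL: "\<And>u. u \<in> Arr ?J \<Longrightarrow> Comp Set (?A u) (leg L (Dom ?J u)) = leg L (Cod ?J u)"
        and vL: "small TYPE('u) (vertex L)"
        using L by (auto simp: is_cone_def sL dL simp del: Set_sel(5))
      have "\<exists>!v. v \<in> vertex K \<and> (\<forall>i\<in>Obj ?J. fn (leg K i) v = fn (leg L i) a)"
        if a: "a \<in> vertex L" for a
      proof (rule r[rule_format])
        show "\<And>i. i \<in> Obj ?J \<Longrightarrow> fn (leg L i) a \<in> ?D i" using legL a by (auto simp: Hom_Set)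
        fix u assume u: "u \<in> Arr ?J"
        show "fn (?A u) (fn (leg L (Dom ?J u)) a) = fn (leg L (Cod ?J u)) a"
          using arg_cong[OF comL[OF u], of "\<lambda>f. fn f a"] legL[of "Dom ?J u"] J.dom_cod[OF u] a
          by (simp add: Hom_Set compose_def)
      qed
      then have "\<forall>a\<in>vertex L. \<exists>!v. v \<in> vertex K \<and> (\<forall>i\<in>Obj ?J. fn (leg K i) v = fn (leg L i) a)" ..
      then obtain t where t: "\<And>a. a \<in> vertex L \<Longrightarrow> t a \<in> vertex K"
        and legt: "\<And>a i. a \<in> vertex L \<Longrightarrow> i \<in> Obj ?J \<Longrightarrow> fn (leg K i) (t a) = fn (leg L i) a"
        and uniq: "\<And>a v. a \<in> vertex L \<Longrightarrow> v \<in> vertex K \<Longrightarrow>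
          (\<And>i. i \<in> Obj ?J \<Longrightarrow> fn (leg K i) v = fn (leg L i) a) \<Longrightarrow> v = t a"
        by metis
      let ?t = "Arrow (vertex L) (\<lambda>a\<in>vertex L. t a) (vertex K)"
      show "\<exists>!t. t \<in> Hom Set (vertex L) (vertex K) \<and> (\<forall>i\<in>Obj ?J. Comp Set (leg K i) t = leg L i)"
      proof (rule ex1I[of _ ?t])
        have T: "?t \<in> Hom Set (vertex L) (vertex K)" using t V vL by (simp add: Hom_Set)
        show "?t \<in> Hom Set (vertex L) (vertex K) \<and> (\<forall>i\<in>Obj ?J. Comp Set (leg K i) ?t = leg L i)"
        proof (intro conjI ballI T)
          fix i assume i: "i \<in> Obj ?J"
          show "Comp Set (leg K i) ?t = leg L i"
            by (rule fn_eqI[OF category.comp_hom[OF category_Set T leg[OF i]] legL[OF i]])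
              (simp add: legt i compose_def)
        qed
        fix t' assume "t' \<in> Hom Set (vertex L) (vertex K) \<and>
          (\<forall>i\<in>Obj ?J. Comp Set (leg K i) t' = leg L i)"
        then have t': "t' \<in> Hom Set (vertex L) (vertex K)"
          and com': "\<And>i. i \<in> Obj ?J \<Longrightarrow> Comp Set (leg K i) t' = leg L i" by auto
        show "t' = ?t"
        proof (rule fn_eqI[OF t' T])
          fix a assume a: "a \<in> vertex L"
          have "fn t' a = t a"
          proof (rule uniq[OF a])
            show "fn t' a \<in> vertex K" using t' a by (auto simp: Hom_Set)
            show "fn (leg K i) (fn t' a) = fn (leg L i) a" if "i \<in> Obj ?J" for i
              using arg_cong[OF com'[OF that], of "\<lambda>f. fn f a"] t' a by (simp add: Hom_Set compose_def)
          qed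
          then show "fn t' a = fn ?t a" using a by simp
        qed
      qed
    qed
  qed
qed

section \<open>Colimits of spaces\<close>

lemma Top_sel [simp]:
  "Obj (Top U) = {X. small U (topspace X)}"
  "Dom (Top U) = src" "Cod (Top U) = tgt" "Id (Top U) X = Arrow X (\<lambda>x\<in>topspace X. x) X"
  by (simp_all add: Top_def)

lemma Comp_Top:
  "Comp (Top U) g f = Arrow (src f) (compose (topspace (src f)) (fn g) (fn f)) (tgt g)"
  by (simp add: Top_def)

lemma Hom_Top: "f \<in> Hom (Top U) X Y \<longleftrightarrow> small U (topspace X) \<and> small U (topspace Y) \<and>
    src f = X \<and> tgt f = Y \<and> continuous_map X Y (fn f) \<and> fn f \<in> extensional (topspace X)"
  by (cases f) (auto simp: Hom_def Top_def)

lemma Hom_Top_PiE: "f \<in> Hom (Top U) X Y \<Longrightarrow> fn f \<in> topspace X \<rightarrow>\<^sub>E topspace Y"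
  by (auto simp: Hom_Top continuous_map_def PiE_def)

lemma Hom_Top_mem: "f \<in> Hom (Top U) X Y \<Longrightarrow> x \<in> topspace X \<Longrightarrow> fn f x \<in> topspace Y"
  using Hom_Top_PiE by fast

lemma Hom_Top_eqI:
  "f \<in> Hom (Top U) X Y \<Longrightarrow> g \<in> Hom (Top U) X Y \<Longrightarrow> (\<And>x. x \<in> topspace X \<Longrightarrow> fn f x = fn g x) \<Longrightarrow> f = g"
  using Hom_Top_PiE[of f U X Y] Hom_Top_PiE[of g U X Y]
  by (intro arrow.expand) (auto intro: PiE_ext simp: Hom_Top)

lemma category_Top: "category (Top U)"
proof
  fix f assume "f \<in> Arr (Top U)"
  then show "Dom (Top U) f \<in> Obj (Top U) \<and> Cod (Top U) f \<in> Obj (Top U)" by (auto simp: Top_def)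
next
  fix X assume "X \<in> Obj (Top U)"
  then show "Id (Top U) X \<in> Hom (Top U) X X"
    by (auto simp: Hom_Top intro: continuous_map_eq[of _ _ id])
next
  fix f g h X Y Z W
  assume f: "f \<in> Hom (Top U) X Y"
  show "Comp (Top U) (Id (Top U) Y) f = f" "Comp (Top U) f (Id (Top U) X) = f"
    using f Hom_Top_mem[OF f] unfolding Hom_Top
    by (auto intro!: arrow.expand ext simp: Comp_Top compose_def extensional_def)
  assume g: "g \<in> Hom (Top U) Y Z"
  have "continuous_map X Z (fn g \<circ> fn f)"
    using f g by (auto simp: Hom_Top intro: continuous_map_compose)
  then have "continuous_map X Z (compose (topspace X) (fn g) (fn f))"
    by (rule continuous_map_eq) (simp add: compose_def)
  then show "Comp (Top U) g f \<in> Hom (Top U) X Z" using f g by (auto simp: Hom_Top Comp_Top)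
  assume h: "h \<in> Hom (Top U) Z W"
  show "Comp (Top U) h (Comp (Top U) g f) = Comp (Top U) (Comp (Top U) h g) f"
    using f g h Hom_Top_mem[OF f] by (auto simp: Hom_Top Comp_Top compose_def fun_eq_iff)
qed

lemma fn_Comp_Top [simp]:
  "f \<in> Hom (Top U) X Y \<Longrightarrow> x \<in> topspace X \<Longrightarrow> fn (Comp (Top U) g f) x = fn g (fn f x)"
  by (simp add: Hom_Top Comp_Top compose_def)

lemma top_map_hom:
  "small U (topspace X) \<Longrightarrow> small U (topspace Y) \<Longrightarrow> continuous_map X Y f \<Longrightarrow>
     top_map X f Y \<in> Hom (Top U) X Y"
  by (auto simp: top_map_def Hom_Top intro: continuous_map_eq)

lemma top_map_sel [simp]: "src (top_map X f Y) = X" "tgt (top_map X f Y) = Y"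
  "x \<in> topspace X \<Longrightarrow> fn (top_map X f Y) x = f x"
  by (simp_all add: top_map_def)

lemma cocone_TopD:
  assumes "is_cocone (Top U) K"
  shows "is_functor (shape K) (Top U) (diagram K)"
    and "\<And>i. i \<in> Obj (shape K) \<Longrightarrow> leg K i \<in> Hom (Top U) (ob_map (diagram K) i) (vertex K)"
    and "\<And>u x. u \<in> Arr (shape K) \<Longrightarrow> x \<in> topspace (ob_map (diagram K) (Dom (shape K) u)) \<Longrightarrow>
      fn (leg K (Cod (shape K) u)) (fn (arr_map (diagram K) u) x) = fn (leg K (Dom (shape K) u)) x"
    and "category (shape K)"
    and "\<And>u. u \<in> Arr (shape K) \<Longrightarrow> arr_map (diagram K) u
      \<in> Hom (Top U) (ob_map (diagram K) (Dom (shape K) u)) (ob_map (diagram K) (Cod (shape K) u))"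
proof -
  show dia: "is_functor (shape K) (Top U) (diagram K)" using assms by (simp add: is_cocone_iff)
  show "leg K i \<in> Hom (Top U) (ob_map (diagram K) i) (vertex K)" if "i \<in> Obj (shape K)" for i
    using assms that by (simp add: is_cocone_iff)
  show u: "arr_map (diagram K) u
      \<in> Hom (Top U) (ob_map (diagram K) (Dom (shape K) u)) (ob_map (diagram K) (Cod (shape K) u))"
    if "u \<in> Arr (shape K)" for u by (rule functor_hom[OF dia Arr_Hom[OF that]])
  show "fn (leg K (Cod (shape K) u)) (fn (arr_map (diagram K) u) x) = fn (leg K (Dom (shape K) u)) x"
    if "u \<in> Arr (shape K)" "x \<in> topspace (ob_map (diagram K) (Dom (shape K) u))" for u x
    using assms that fn_Comp_Top[OF u, of u x] unfolding is_cocone_iff by metis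
  show "category (shape K)" using functor_cat[OF dia] by simp
qed

lemma cocone_TopI:
  assumes dia: "is_functor (shape K) (Top U) (diagram K)"
    and leg: "\<And>i. i \<in> Obj (shape K) \<Longrightarrow> leg K i \<in> Hom (Top U) (ob_map (diagram K) i) (vertex K)"
    and "leg K \<in> extensional (Obj (shape K))" "small U (topspace (vertex K))"
    and com: "\<And>u x. u \<in> Arr (shape K) \<Longrightarrow> x \<in> topspace (ob_map (diagram K) (Dom (shape K) u)) \<Longrightarrow>
      fn (leg K (Cod (shape K) u)) (fn (arr_map (diagram K) u) x) = fn (leg K (Dom (shape K) u)) x"
  shows "is_cocone (Top U) K"
proof -
  interpret J: category "shape K" using functor_cat[OF dia] by simp
  have "Comp (Top U) (leg K (Cod (shape K) u)) (arr_map (diagram K) u) = leg K (Dom (shape K) u)"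
    if u: "u \<in> Arr (shape K)" for u
  proof -
    note d = J.dom_cod[OF u] and Du = functor_hom[OF dia Arr_Hom[OF u]]
    show ?thesis
      using category.comp_hom[OF category_Top Du leg] leg d fn_Comp_Top[OF Du] com[OF u]
      by (intro Hom_Top_eqI[of _ U "ob_map (diagram K) (Dom (shape K) u)" "vertex K"]) auto
  qed
  with assms show ?thesis unfolding is_cocone_iff by simp
qed

text \<open>
  The criterion that the underlying cocone of sets is a colimit and the vertex carries the final
  topology. That distinct points of the vertex are not identified too much is expressed by
  \<open>glue\<close>: compatible families of functions factor over the vertex. It suffices to have this
  for functions with values in \<open>'u\<close>, because all points of spaces lie there.
\<close>

lemma colimit_cocone_TopI:
  fixes K :: "('i, 'j, 'u topology, ('u topology, 'u \<Rightarrow> 'u) arrow) cone"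
  assumes K: "is_cocone (Top U) K"
    and surj: "\<And>y. y \<in> topspace (vertex K) \<Longrightarrow>
      \<exists>i\<in>Obj (shape K). \<exists>x\<in>topspace (ob_map (diagram K) i). y = fn (leg K i) x"
    and final: "\<And>W. W \<subseteq> topspace (vertex K) \<Longrightarrow>
      (\<And>i. i \<in> Obj (shape K) \<Longrightarrow>
        openin (ob_map (diagram K) i) {x \<in> topspace (ob_map (diagram K) i). fn (leg K i) x \<in> W}) \<Longrightarrow>
      openin (vertex K) W"
    and glue: "\<And>g :: 'i \<Rightarrow> 'u \<Rightarrow> 'u. (\<And>u x. u \<in> Arr (shape K) \<Longrightarrow> x \<in> topspace (ob_map (diagram K) (Dom (shape K) u)) \<Longrightarrow>
        g (Cod (shape K) u) (fn (arr_map (diagram K) u) x) = g (Dom (shape K) u) x) \<Longrightarrow>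
      \<exists>t. \<forall>i\<in>Obj (shape K). \<forall>x\<in>topspace (ob_map (diagram K) i). t (fn (leg K i) x) = g i x"
  shows "colimit_cocone (Top U) K"
  unfolding colimit_cocone_iff
proof (intro conjI allI impI K)
  let ?J = "shape K" and ?D = "ob_map (diagram K)" and ?V = "vertex K"
  note leg = cocone_TopD(2)[OF K] and J = cocone_TopD(4)[OF K]
  have V: "small U (topspace ?V)" using K by (auto simp: is_cocone_iff)
  fix L assume L: "is_cocone (Top U) L" and sL: "shape L = ?J" and dL: "diagram L = diagram K"
  note legL = cocone_TopD(2)[OF L, unfolded sL dL]
  have vL: "small U (topspace (vertex L))" using L by (auto simp: is_cocone_iff)
  obtain t where t: "\<And>i x. i \<in> Obj ?J \<Longrightarrow> x \<in> topspace (?D i) \<Longrightarrow> t (fn (leg K i) x) = fn (leg L i) x"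
    using glue[of "\<lambda>i. fn (leg L i)"] cocone_TopD(3)[OF L] unfolding sL dL by metis
  have tV: "t y \<in> topspace (vertex L)" if "y \<in> topspace ?V" for y
    using surj[OF that] t Hom_Top_mem[OF legL] by metis
  have cont: "continuous_map ?V (vertex L) t"
    unfolding continuous_map_def
  proof (intro conjI allI impI)
    show "t \<in> topspace ?V \<rightarrow> topspace (vertex L)" using tV by blast
    fix W assume W: "openin (vertex L) W"
    show "openin ?V {x \<in> topspace ?V. t x \<in> W}"
    proof (rule final)
      fix i assume i: "i \<in> Obj ?J"
      have "{x \<in> topspace (?D i). fn (leg K i) x \<in> {x \<in> topspace ?V. t x \<in> W}} =
        {x \<in> topspace (?D i). fn (leg L i) x \<in> W}"
        using t[OF i] Hom_Top_mem[OF leg[OF i]] by auto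
      then show "openin (?D i) {x \<in> topspace (?D i). fn (leg K i) x \<in> {x \<in> topspace ?V. t x \<in> W}}"
        using legL[OF i] W by (simp add: Hom_Top continuous_map_def)
    qed auto
  qed
  let ?t = "top_map ?V t (vertex L)"
  have T: "?t \<in> Hom (Top U) ?V (vertex L)" by (rule top_map_hom[OF V vL cont])
  show "\<exists>!t. t \<in> Hom (Top U) ?V (vertex L) \<and> (\<forall>i\<in>Obj ?J. Comp (Top U) t (leg K i) = leg L i)"
  proof (rule ex1I[of _ ?t])
    show "?t \<in> Hom (Top U) ?V (vertex L) \<and> (\<forall>i\<in>Obj ?J. Comp (Top U) ?t (leg K i) = leg L i)"
    proof (intro conjI ballI T)
      fix i assume i: "i \<in> Obj ?J"
      show "Comp (Top U) ?t (leg K i) = leg L i"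
        by (rule Hom_Top_eqI[OF category.comp_hom[OF category_Top leg[OF i] T] legL[OF i]])
          (use t[OF i] Hom_Top_mem[OF leg[OF i]] fn_Comp_Top[OF leg[OF i]] in \<open>simp del: Top_sel\<close>)
    qed
    fix t' assume t': "t' \<in> Hom (Top U) ?V (vertex L) \<and> (\<forall>i\<in>Obj ?J. Comp (Top U) t' (leg K i) = leg L i)"
    show "t' = ?t"
    proof (rule Hom_Top_eqI[OF conjunct1[OF t'] T])
      fix y assume y: "y \<in> topspace ?V"
      obtain i x where ix: "i \<in> Obj ?J" "x \<in> topspace (?D i)" "y = fn (leg K i) x"
        using surj[OF y] by blast
      have "fn t' y = fn (Comp (Top U) t' (leg K i)) x"
        using fn_Comp_Top[OF leg[OF ix(1)] ix(2)] ix(3) by simp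
      also have "\<dots> = t y" using t' ix t by simp
      finally show "fn t' y = fn ?t y" using y by simp
    qed
  qed
qed

text \<open>
  The images of the legs form a subspace over which the cocone factors; composing the induced map
  with the inclusion gives the identity by uniqueness, so the subspace is everything.
\<close>

lemma colimit_Top_surj:
  assumes K: "colimit_cocone (Top U) K" and y: "y \<in> topspace (vertex K)"
  shows "\<exists>i\<in>Obj (shape K). \<exists>x\<in>topspace (ob_map (diagram K) i). y = fn (leg K i) x"
proof -
  let ?J = "shape K" and ?D = "ob_map (diagram K)" and ?V = "vertex K"
  have cK: "is_cocone (Top U) K"
    and univ: "\<And>L. \<lbrakk>is_cocone (Top U) L; shape L = ?J; diagram L = diagram K\<rbrakk> \<Longrightarrow>
        \<exists>!t. t \<in> Hom (Top U) ?V (vertex L) \<and> (\<forall>i\<in>Obj ?J. Comp (Top U) t (leg K i) = leg L i)"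
    using K unfolding colimit_cocone_iff by auto
  note leg = cocone_TopD(2)[OF cK] and J = cocone_TopD(4)[OF cK] and Du = cocone_TopD(5)[OF cK]
  interpret J: category ?J by (rule J)
  have V: "small U (topspace ?V)" using cK by (auto simp: is_cocone_iff)
  let ?S = "\<Union>i\<in>Obj ?J. fn (leg K i) ` topspace (?D i)"
  have S: "?S \<subseteq> topspace ?V" using Hom_Top_mem[OF leg] by blast
  let ?W = "subtopology ?V ?S"
  have tW: "topspace ?W = ?S" using S by (simp only: topspace_subtopology Int_absorb1)
  have W: "small U (topspace ?W)" using small_subset[OF V S] tW by simp
  \<comment> \<open>the union of the images is a subspace through which all legs factor\<close>
  define L where "L = \<lparr>shape = ?J, diagram = diagram K, vertex = ?W,
    leg = (\<lambda>i\<in>Obj ?J. top_map (?D i) (fn (leg K i)) ?W)\<rparr>"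
  have legL: "top_map (?D i) (fn (leg K i)) ?W \<in> Hom (Top U) (?D i) ?W" if i: "i \<in> Obj ?J" for i
  proof (rule top_map_hom[OF _ W])
    show "small U (topspace (?D i))" "continuous_map (?D i) ?W (fn (leg K i))"
      using leg[OF i] i by (auto simp: Hom_Top continuous_map_in_subtopology)
  qed
  have "is_cocone (Top U) L"
  proof (rule cocone_TopI)
    fix u x assume "u \<in> Arr (shape L)" "x \<in> topspace (ob_map (diagram L) (Dom (shape L) u))"
    then have u: "u \<in> Arr ?J" and x: "x \<in> topspace (?D (Dom ?J u))" by (simp_all add: L_def)
    show "fn (leg L (Cod (shape L) u)) (fn (arr_map (diagram L) u) x) = fn (leg L (Dom (shape L) u)) x"
      using J.dom_cod[OF u] x Hom_Top_mem[OF Du[OF u] x] cocone_TopD(3)[OF cK u x] by (simp add: L_def)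
  qed (use cocone_TopD(1)[OF cK] legL W in \<open>simp_all add: L_def\<close>)
  then have "\<exists>t. t \<in> Hom (Top U) ?V ?W \<and> (\<forall>i\<in>Obj ?J. Comp (Top U) t (leg K i) = leg L i)"
    using univ[of L] by (simp add: L_def) blast
  then obtain t where t: "t \<in> Hom (Top U) ?V ?W"
    and tl: "\<And>i. i \<in> Obj ?J \<Longrightarrow> Comp (Top U) t (leg K i) = leg L i" by blast
  have tl': "fn t (fn (leg K i) x) = fn (leg K i) x" if "i \<in> Obj ?J" "x \<in> topspace (?D i)" for i x
    using fn_Comp_Top[OF leg[OF that(1)] that(2), of t] tl[OF that(1)] that by (simp add: L_def)
  let ?t = "top_map ?V (fn t) ?V"
  have T: "?t \<in> Hom (Top U) ?V ?V"
    using t V by (intro top_map_hom) (auto simp: Hom_Top continuous_map_in_subtopology)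
  have Tl: "Comp (Top U) ?t (leg K i) = leg K i" if i: "i \<in> Obj ?J" for i
    by (rule Hom_Top_eqI[OF category.comp_hom[OF category_Top leg[OF i] T] leg[OF i]])
      (use tl'[OF i] Hom_Top_mem[OF leg[OF i]] fn_Comp_Top[OF leg[OF i]] in \<open>simp del: Top_sel\<close>)
  have idV: "Id (Top U) ?V \<in> Hom (Top U) ?V ?V"
    using category.id_hom[OF category_Top] V by simp
  have "?t = Id (Top U) ?V"
    using univ[OF cK refl refl] T Tl idV category.id_left[OF category_Top leg] by blast
  then have "fn ?t y = fn (Id (Top U) ?V) y" by (rule arg_cong)
  then have "fn t y = y" using y by simp
  then have "y \<in> ?S" using Hom_Top_mem[OF t y] tW by simp
  then show ?thesis by blast
qed

text \<open>
  The universal property provides a continuous map with the same composites with the legs as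
  \<open>f\<close>, and it equals \<open>f\<close> because the legs are jointly surjective.
\<close>

lemma colimit_Top_final:
  fixes K :: "('i, 'j, 'u topology, ('u topology, 'u \<Rightarrow> 'u) arrow) cone" and X :: "'u topology"
  assumes K: "colimit_cocone (Top U) K" and X: "small U (topspace X)"
    and f: "f \<in> topspace (vertex K) \<rightarrow> topspace X"
    and cont: "\<And>i. i \<in> Obj (shape K) \<Longrightarrow>
       continuous_map (ob_map (diagram K) i) X (\<lambda>x. f (fn (leg K i) x))"
  shows "continuous_map (vertex K) X f"
proof -
  let ?J = "shape K" and ?D = "ob_map (diagram K)" and ?V = "vertex K"
  have cK: "is_cocone (Top U) K"
    and univ: "\<And>L. \<lbrakk>is_cocone (Top U) L; shape L = ?J; diagram L = diagram K\<rbrakk> \<Longrightarrow>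
        \<exists>!t. t \<in> Hom (Top U) ?V (vertex L) \<and> (\<forall>i\<in>Obj ?J. Comp (Top U) t (leg K i) = leg L i)"
    using K unfolding colimit_cocone_iff by auto
  note leg = cocone_TopD(2)[OF cK] and J = cocone_TopD(4)[OF cK] and Du = cocone_TopD(5)[OF cK]
  interpret J: category ?J by (rule J)
  define L where "L = \<lparr>shape = ?J, diagram = diagram K, vertex = X,
    leg = (\<lambda>i\<in>Obj ?J. top_map (?D i) (\<lambda>x. f (fn (leg K i) x)) X)\<rparr>"
  have legL: "top_map (?D i) (\<lambda>x. f (fn (leg K i) x)) X \<in> Hom (Top U) (?D i) X" if i: "i \<in> Obj ?J" for i
    using leg[OF i] X cont[OF i] by (intro top_map_hom) (auto simp: Hom_Top)
  have "is_cocone (Top U) L"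
  proof (rule cocone_TopI)
    fix u x assume "u \<in> Arr (shape L)" "x \<in> topspace (ob_map (diagram L) (Dom (shape L) u))"
    then have u: "u \<in> Arr ?J" and x: "x \<in> topspace (?D (Dom ?J u))" by (simp_all add: L_def)
    show "fn (leg L (Cod (shape L) u)) (fn (arr_map (diagram L) u) x) = fn (leg L (Dom (shape L) u)) x"
      using J.dom_cod[OF u] x Hom_Top_mem[OF Du[OF u] x] cocone_TopD(3)[OF cK u x] by (simp add: L_def)
  qed (use cocone_TopD(1)[OF cK] legL X in \<open>simp_all add: L_def\<close>)
  then have "\<exists>t. t \<in> Hom (Top U) ?V X \<and> (\<forall>i\<in>Obj ?J. Comp (Top U) t (leg K i) = leg L i)"
    using univ[of L] by (simp add: L_def) blast
  then obtain t where t: "t \<in> Hom (Top U) ?V X"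
    and tl: "\<And>i. i \<in> Obj ?J \<Longrightarrow> Comp (Top U) t (leg K i) = leg L i" by blast
  have tl': "fn t (fn (leg K i) x) = f (fn (leg K i) x)" if "i \<in> Obj ?J" "x \<in> topspace (?D i)" for i x
    using fn_Comp_Top[OF leg[OF that(1)] that(2), of t] tl[OF that(1)] that by (simp add: L_def)
  have "fn t y = f y" if "y \<in> topspace ?V" for y
    using colimit_Top_surj[OF K that] tl' by auto
  then show ?thesis using t unfolding Hom_Top by (auto intro: continuous_map_eq)
qed

section \<open>Colimits of families of spans of spaces\<close>

lemma spans_sel [simp]:
  "Obj spans = UNIV" "Arr spans = UNIV"
  "Dom spans (Ident x) = x" "Dom spans (To_Leg i) = Apex i" "Dom spans (To_Base i) = Apex i"
  "Cod spans (Ident x) = x" "Cod spans (To_Leg i) = Leg i" "Cod spans (To_Base i) = Base"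
  "Id spans = Ident"
  "Comp spans v (Ident x) = v" "Comp spans v (To_Leg i) = To_Leg i" "Comp spans v (To_Base i) = To_Base i"
  by (simp_all add: spans_def)

lemma Hom_spans: "u \<in> Hom spans x y \<longleftrightarrow> (u = Ident x \<and> x = y) \<or>
    (\<exists>i. u = To_Leg i \<and> x = Apex i \<and> y = Leg i) \<or> (\<exists>i. u = To_Base i \<and> x = Apex i \<and> y = Base)"
  by (cases u) (auto simp: Hom_def)

lemma category_spans: "category spans"
  by unfold_locales (auto simp: Hom_spans)

lemma category_spans_on: "category (spans_on I)"
  unfolding spans_on_def by (rule category_full_subcat[OF category_spans]) simp

lemma category_discrete_on: "category (discrete_on I)"
  unfolding discrete_on_def by (rule category_full_subcat[OF category_spans]) simp

lemma spans_on_sel [simp]: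
  "Obj (spans_on I) = insert Base (Apex ` I \<union> Leg ` I)"
  "Dom (spans_on I) = Dom spans" "Cod (spans_on I) = Cod spans" "Id (spans_on I) = Ident"
  "Comp (spans_on I) = Comp spans"
  by (simp_all add: spans_on_def)

lemma Arr_spans_on: "Arr (spans_on I) = Ident ` Obj (spans_on I) \<union> To_Leg ` I \<union> To_Base ` I"
proof (rule set_eqI)
  fix u show "u \<in> Arr (spans_on I) \<longleftrightarrow> u \<in> Ident ` Obj (spans_on I) \<union> To_Leg ` I \<union> To_Base ` I"
    by (cases u) (auto simp: spans_on_def)
qed

lemma discrete_on_sel [simp]:
  "Obj (discrete_on I) = Leg ` I"
  "Dom (discrete_on I) = Dom spans" "Cod (discrete_on I) = Cod spans" "Id (discrete_on I) = Ident"
  "Comp (discrete_on I) = Comp spans"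
  by (simp_all add: discrete_on_def)

lemma Arr_discrete_on: "Arr (discrete_on I) = Ident ` Leg ` I"
proof (rule set_eqI)
  fix u show "u \<in> Arr (discrete_on I) \<longleftrightarrow> u \<in> Ident ` Leg ` I"
    by (cases u) (auto simp: discrete_on_def)
qed

lemma small_category_spans_on:
  assumes "inaccessible TYPE('u)" "small TYPE('u) I"
  shows "small_category TYPE('u) (spans_on I)"
  unfolding small_category_def Arr_spans_on spans_on_sel
  using assms by (simp add: category_spans_on small_Un small_insert small_image)

lemma small_category_discrete_on:
  assumes "small TYPE('u) I"
  shows "small_category TYPE('u) (discrete_on I)"
  unfolding small_category_def Arr_discrete_on discrete_on_sel
  using assms by (simp add: category_discrete_on small_image)

lemma Hom_spans_on: "u \<in> Hom (spans_on I) x y \<longleftrightarrow> (u = Ident x \<and> x = y \<and> x \<in> Obj (spans_on I)) \<or>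
    (\<exists>i\<in>I. u = To_Leg i \<and> x = Apex i \<and> y = Leg i) \<or> (\<exists>i\<in>I. u = To_Base i \<and> x = Apex i \<and> y = Base)"
  by (cases u) (auto simp: Hom_def Arr_spans_on)

lemma span_diagram_sel [simp]:
  "ob_map (span_diagram C I X l b) Base = X"
  "i \<in> I \<Longrightarrow> ob_map (span_diagram C I X l b) (Apex i) = Dom C (l i)"
  "i \<in> I \<Longrightarrow> ob_map (span_diagram C I X l b) (Leg i) = Cod C (l i)"
  "i \<in> I \<Longrightarrow> arr_map (span_diagram C I X l b) (To_Leg i) = l i"
  "i \<in> I \<Longrightarrow> arr_map (span_diagram C I X l b) (To_Base i) = b i"
  "x \<in> Obj (spans_on I) \<Longrightarrow> arr_map (span_diagram C I X l b) (Ident x)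
     = Id C (ob_map (span_diagram C I X l b) x)"
  by (auto simp: span_diagram_def Arr_spans_on)

lemma is_functor_span_diagram:
  assumes C: "category C" and X: "X \<in> Obj C"
    and l: "\<And>i. i \<in> I \<Longrightarrow> l i \<in> Arr C"
    and b: "\<And>i. i \<in> I \<Longrightarrow> b i \<in> Hom C (Dom C (l i)) X"
  shows "is_functor (spans_on I) C (span_diagram C I X l b)" (is "is_functor _ _ ?D")
proof (rule is_functorI)
  interpret C: category C by (rule C)
  show ob: "ob_map ?D x \<in> Obj C" if "x \<in> Obj (spans_on I)" for x
    using that X C.dom_cod[OF l] by auto
  note ids = C.id_hom[OF ob] C.id_left C.id_right
  show hom: "arr_map ?D f \<in> Hom C (ob_map ?D x) (ob_map ?D y)" if "f \<in> Hom (spans_on I) x y" for f x y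
  proof (cases "f = Ident x")
    case True
    with that have "x = y" "x \<in> Obj (spans_on I)" unfolding Hom_spans_on by auto
    with True show ?thesis using ids(1)[of x] by (simp del: spans_on_sel(1))
  next
    case False
    with that show ?thesis unfolding Hom_spans_on using b Arr_Hom[OF l] by auto
  qed
  fix f x y g z assume f: "f \<in> Hom (spans_on I) x y" and g: "g \<in> Hom (spans_on I) y z"
  show "arr_map ?D (Comp (spans_on I) g f) = Comp C (arr_map ?D g) (arr_map ?D f)"
  proof (cases "f = Ident x")
    case True
    with f have "x = y" "x \<in> Obj (spans_on I)" unfolding Hom_spans_on by auto
    with True show ?thesis using C.id_right[OF hom[OF g]] by (simp del: spans_on_sel(1))
  next
    case False
    with f g have g': "g = Ident y" "z = y" "y \<in> Obj (spans_on I)" "Comp spans g f = f"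
      unfolding Hom_spans_on by auto
    then show ?thesis using C.id_left[OF hom[OF f]] by (simp del: spans_on_sel(1))
  qed
next
  show "ob_map ?D \<in> extensional (Obj (spans_on I))" "arr_map ?D \<in> extensional (Arr (spans_on I))"
    by (simp_all add: span_diagram_def)
  show "arr_map ?D (Id (spans_on I) x) = Id C (ob_map ?D x)" if "x \<in> Obj (spans_on I)" for x
    using that by (simp del: spans_on_sel(1))
qed (use C category_spans_on in auto)

text \<open>
  The legs at the apexes are forced by the leg \<open>e\<close> at the common object.
\<close>

definition span_cocone ::
  "('o, 'm) cat \<Rightarrow> 'i set \<Rightarrow> 'o \<Rightarrow> ('i \<Rightarrow> 'm) \<Rightarrow> ('i \<Rightarrow> 'm) \<Rightarrow> 'o \<Rightarrow> 'm \<Rightarrow> ('i \<Rightarrow> 'm)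
     \<Rightarrow> ('i span_ob, 'i span_arr, 'o, 'm) cone" where
  "span_cocone C I X l b V e c = \<lparr>shape = spans_on I, diagram = span_diagram C I X l b, vertex = V,
     leg = (\<lambda>x\<in>Obj (spans_on I). case x of Base \<Rightarrow> e | Leg i \<Rightarrow> c i | Apex i \<Rightarrow> Comp C e (b i))\<rparr>"

lemma span_cocone_sel [simp]:
  "shape (span_cocone C I X l b V e c) = spans_on I"
  "diagram (span_cocone C I X l b V e c) = span_diagram C I X l b"
  "vertex (span_cocone C I X l b V e c) = V"
  "leg (span_cocone C I X l b V e c) Base = e"
  "i \<in> I \<Longrightarrow> leg (span_cocone C I X l b V e c) (Leg i) = c i"
  "i \<in> I \<Longrightarrow> leg (span_cocone C I X l b V e c) (Apex i) = Comp C e (b i)"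
  by (auto simp: span_cocone_def)

lemma is_cocone_span_cocone:
  assumes C: "category C"
    and l: "\<And>i. i \<in> I \<Longrightarrow> l i \<in> Arr C"
    and b: "\<And>i. i \<in> I \<Longrightarrow> b i \<in> Hom C (Dom C (l i)) X"
    and e: "e \<in> Hom C X V" and c: "\<And>i. i \<in> I \<Longrightarrow> c i \<in> Hom C (Cod C (l i)) V"
    and com: "\<And>i. i \<in> I \<Longrightarrow> Comp C (c i) (l i) = Comp C e (b i)"
  shows "is_cocone C (span_cocone C I X l b V e c)"
proof -
  interpret C: category C by (rule C)
  let ?K = "span_cocone C I X l b V e c" and ?D = "span_diagram C I X l b"
  have leg: "leg ?K x \<in> Hom C (ob_map ?D x) V" if "x \<in> Obj (spans_on I)" for x
    using that e c C.comp_hom[OF b e] by auto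
  have "Comp C (leg ?K (Cod spans u)) (arr_map ?D u) = leg ?K (Dom spans u)"
    if u: "u \<in> Arr (spans_on I)" for u
  proof (cases u)
    case (Ident x)
    then have x: "x \<in> Obj (spans_on I)" using u by (auto simp: Arr_spans_on)
    show ?thesis using C.id_right[OF leg[OF x]] Ident x by (simp del: spans_on_sel(1))
  qed (use u com in \<open>auto simp: Arr_spans_on\<close>)
  moreover have "is_functor (spans_on I) C ?D"
    by (rule is_functor_span_diagram[OF C _ l b]) (use Hom_Obj[OF C e] in auto)
  moreover have "leg ?K \<in> extensional (Obj (spans_on I))" by (simp add: span_cocone_def)
  ultimately show ?thesis
    unfolding is_cocone_iff using leg Hom_Obj[OF C e] by (simp del: spans_on_sel(1))
qed

lemma colimit_span_cocone_TopI:
  fixes X V :: "'u topology" and U :: "'u itself"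
  assumes l: "\<And>i. i \<in> I \<Longrightarrow> l i \<in> Hom (Top U) (A i) (B i)"
    and b: "\<And>i. i \<in> I \<Longrightarrow> b i \<in> Hom (Top U) (A i) X"
    and e: "e \<in> Hom (Top U) X V" and c: "\<And>i. i \<in> I \<Longrightarrow> c i \<in> Hom (Top U) (B i) V"
    and com: "\<And>i x. i \<in> I \<Longrightarrow> x \<in> topspace (A i) \<Longrightarrow> fn (c i) (fn (l i) x) = fn e (fn (b i) x)"
    and surj: "topspace V \<subseteq> fn e ` topspace X \<union> (\<Union>i\<in>I. fn (c i) ` topspace (B i))"
    and final: "\<And>W. W \<subseteq> topspace V \<Longrightarrow> openin X {x \<in> topspace X. fn e x \<in> W} \<Longrightarrow>
      (\<And>i. i \<in> I \<Longrightarrow> openin (B i) {x \<in> topspace (B i). fn (c i) x \<in> W}) \<Longrightarrow> openin V W"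
    and glue: "\<And>g0 (g :: 'i \<Rightarrow> 'u \<Rightarrow> 'u). (\<And>i x. i \<in> I \<Longrightarrow> x \<in> topspace (A i) \<Longrightarrow>
          g i (fn (l i) x) = g0 (fn (b i) x)) \<Longrightarrow>
      \<exists>t. (\<forall>x\<in>topspace X. t (fn e x) = g0 x) \<and> (\<forall>i\<in>I. \<forall>x\<in>topspace (B i). t (fn (c i) x) = g i x)"
  shows "colimit_cocone (Top U) (span_cocone (Top U) I X l b V e c)"
proof (rule colimit_cocone_TopI)
  let ?K = "span_cocone (Top U) I X l b V e c" and ?D = "span_diagram (Top U) I X l b"
  have lsel [simp]: "src (l i) = A i" "tgt (l i) = B i" if "i \<in> I" for i
    using l[OF that] by (simp_all add: Hom_Top)
  show "is_cocone (Top U) ?K"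
  proof (rule is_cocone_span_cocone[OF category_Top])
    fix i assume i: "i \<in> I"
    show "Comp (Top U) (c i) (l i) = Comp (Top U) e (b i)"
      by (rule Hom_Top_eqI[OF category.comp_hom[OF category_Top l c]
            category.comp_hom[OF category_Top b e]]) (use i com in \<open>auto simp: fn_Comp_Top[OF l] fn_Comp_Top[OF b]\<close>)
  qed (use b e c Hom_Arr[OF l] in auto)
  show "\<exists>i\<in>Obj (shape ?K). \<exists>x\<in>topspace (ob_map (diagram ?K) i). y = fn (leg ?K i) x"
    if y: "y \<in> topspace (vertex ?K)" for y
  proof -
    from surj y consider x where "x \<in> topspace X" "y = fn e x"
      | i x where "i \<in> I" "x \<in> topspace (B i)" "y = fn (c i) x" by auto
    then show ?thesis
    proof cases
      case 1 then show ?thesis by (intro bexI[of _ Base]) auto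
    next
      case 2 then show ?thesis by (intro bexI[of _ "Leg i"]) auto
    qed
  qed
  show "openin (vertex ?K) W" if W: "W \<subseteq> topspace (vertex ?K)"
    and op: "\<And>i. i \<in> Obj (shape ?K) \<Longrightarrow> openin (ob_map (diagram ?K) i)
       {x \<in> topspace (ob_map (diagram ?K) i). fn (leg ?K i) x \<in> W}" for W
    unfolding span_cocone_sel
  proof (rule final)
    show "openin (B i) {x \<in> topspace (B i). fn (c i) x \<in> W}" if "i \<in> I" for i
      using op[of "Leg i"] that by simp
  qed (use W op[of Base] in simp_all)
  fix g :: "'i span_ob \<Rightarrow> 'u \<Rightarrow> 'u"
  assume "\<And>u x. u \<in> Arr (shape ?K) \<Longrightarrow> x \<in> topspace (ob_map (diagram ?K) (Dom (shape ?K) u)) \<Longrightarrow>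
    g (Cod (shape ?K) u) (fn (arr_map (diagram ?K) u) x) = g (Dom (shape ?K) u) x"
  then have g: "\<And>u x. u \<in> Arr (spans_on I) \<Longrightarrow> x \<in> topspace (ob_map ?D (Dom spans u)) \<Longrightarrow>
    g (Cod spans u) (fn (arr_map ?D u) x) = g (Dom spans u) x" by simp
  have gl: "g (Leg i) (fn (l i) x) = g (Apex i) x" and gb: "g Base (fn (b i) x) = g (Apex i) x"
    if "i \<in> I" "x \<in> topspace (A i)" for i x
    using g[of "To_Leg i" x] g[of "To_Base i" x] that by (simp_all add: Arr_spans_on)
  obtain t where t: "\<And>x. x \<in> topspace X \<Longrightarrow> t (fn e x) = g Base x"
    "\<And>i x. i \<in> I \<Longrightarrow> x \<in> topspace (B i) \<Longrightarrow> t (fn (c i) x) = g (Leg i) x"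
    using glue[of "\<lambda>i. g (Leg i)" "g Base"] gl gb by metis
  have tA: "t (fn (Comp (Top U) e (b i)) x) = g (Apex i) x" if "i \<in> I" "x \<in> topspace (A i)" for i x
    using that fn_Comp_Top[OF b] t(1)[OF Hom_Top_mem[OF b]] gb by simp
  show "\<exists>t. \<forall>i\<in>Obj (shape ?K). \<forall>x\<in>topspace (ob_map (diagram ?K) i). t (fn (leg ?K i) x) = g i x"
    using t tA by (intro exI[of _ t]) auto
qed

text \<open>
  If the arms \<open>l i\<close> are onto, gluing \<open>B i\<close> along \<open>A i\<close> adds no points to \<open>X\<close> and
  only takes away open sets. Three kinds of colimits have this form: the epimorphism cocones, the
  cocones that express subnets, and the presentation of a space by its convergent nets.
\<close>

lemma colimit_coarsening:
  fixes X V :: "'u topology" and U :: "'u itself"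
  assumes X: "small U (topspace X)" and V: "topspace V = topspace X"
    and coarser: "\<And>W. openin V W \<Longrightarrow> openin X W"
    and l: "\<And>i. i \<in> I \<Longrightarrow> l i \<in> Hom (Top U) (A i) (B i)"
    and l_surj: "\<And>i. i \<in> I \<Longrightarrow> topspace (B i) \<subseteq> fn (l i) ` topspace (A i)"
    and b: "\<And>i. i \<in> I \<Longrightarrow> b i \<in> Hom (Top U) (A i) X"
    and c: "\<And>i. i \<in> I \<Longrightarrow> c i \<in> Hom (Top U) (B i) V"
    and com: "\<And>i x. i \<in> I \<Longrightarrow> x \<in> topspace (A i) \<Longrightarrow> fn (c i) (fn (l i) x) = fn (b i) x"
    and final: "\<And>W. openin X W \<Longrightarrow>
      (\<And>i. i \<in> I \<Longrightarrow> openin (B i) {x \<in> topspace (B i). fn (c i) x \<in> W}) \<Longrightarrow> openin V W"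
  shows "colimit_cocone (Top U) (span_cocone (Top U) I X l b V (top_map X (\<lambda>x. x) V) c)"
proof (rule colimit_span_cocone_TopI[OF l b _ c])
  have "continuous_map X V (\<lambda>x. x)"
    using coarser V unfolding continuous_map_def by (simp add: openin_subset Collect_conj_eq)
      (metis Int_absorb1 openin_subset inf_commute)
  then show "top_map X (\<lambda>x. x) V \<in> Hom (Top U) X V"
    using X V by (intro top_map_hom) auto
  show "fn (c i) (fn (l i) x) = fn (top_map X (\<lambda>x. x) V) (fn (b i) x)"
    if "i \<in> I" "x \<in> topspace (A i)" for i x
    using com that Hom_Top_mem[OF b] by simp
  show "topspace V \<subseteq> fn (top_map X (\<lambda>x. x) V) ` topspace X \<union> (\<Union>i\<in>I. fn (c i) ` topspace (B i))"
    using V by (auto simp: image_iff)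
  show "openin V W" if W: "W \<subseteq> topspace V" "openin X {x \<in> topspace X. fn (top_map X (\<lambda>x. x) V) x \<in> W}"
    "\<And>i. i \<in> I \<Longrightarrow> openin (B i) {x \<in> topspace (B i). fn (c i) x \<in> W}" for W
  proof (rule final)
    have "{x \<in> topspace X. fn (top_map X (\<lambda>x. x) V) x \<in> W} = W" using W V by auto
    then show "openin X W" using W by simp
  qed (rule W)
  fix g0 and g :: "'a \<Rightarrow> 'u \<Rightarrow> 'u"
  assume g: "\<And>i x. i \<in> I \<Longrightarrow> x \<in> topspace (A i) \<Longrightarrow> g i (fn (l i) x) = g0 (fn (b i) x)"
  have "g0 (fn (c i) x) = g i x" if i: "i \<in> I" and x: "x \<in> topspace (B i)" for i x
  proof -
    obtain a where "a \<in> topspace (A i)" "x = fn (l i) a" using l_surj[OF i] x by blast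
    then show ?thesis using g[OF i] com[OF i] by simp
  qed
  then show "\<exists>t. (\<forall>x\<in>topspace X. t (fn (top_map X (\<lambda>x. x) V) x) = g0 x) \<and>
      (\<forall>i\<in>I. \<forall>x\<in>topspace (B i). t (fn (c i) x) = g i x)"
    by (intro exI[of _ g0]) simp
qed

lemma colimit_epi_cocone:
  assumes f: "f \<in> Hom (Top TYPE('u)) X Y" and surj: "topspace Y \<subseteq> fn f ` topspace X"
  shows "colimit_cocone (Top TYPE('u)) (epi_cocone (f :: ('u topology, 'u \<Rightarrow> 'u) arrow))"
proof -
  let ?T = "Top TYPE('u)"
  have Y: "small TYPE('u) (topspace Y)" and tf: "tgt f = Y" using f by (auto simp: Hom_Top)
  have idY: "Id ?T Y \<in> Hom ?T Y Y" using category.id_hom[OF category_Top] Y by simp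
  have "epi_cocone f = span_cocone ?T {Single} Y (\<lambda>_. f) (\<lambda>_. f) Y (top_map Y (\<lambda>x. x) Y) (\<lambda>_. Id ?T Y)"
    using category.id_left[OF category_Top f] tf
    by (auto simp: epi_cocone_def span_cocone_def top_map_def fun_eq_iff split: span_ob.splits)
  also have "colimit_cocone ?T \<dots>"
    by (rule colimit_coarsening[where A = "\<lambda>_. X" and B = "\<lambda>_. Y"])
      (use Y f idY surj Hom_Top_mem[OF f] in auto)
  finally show ?thesis .
qed

section \<open>Nets as continuous maps\<close>

lemma directedD:
  assumes "directed r"
  shows "Preorder r" "Field r \<noteq> {}" "trans r" "\<And>x. x \<in> Field r \<Longrightarrow> (x, x) \<in> r"
    "\<And>x y. x \<in> Field r \<Longrightarrow> y \<in> Field r \<Longrightarrow> \<exists>z\<in>Field r. (x, z) \<in> r \<and> (y, z) \<in> r"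
  using assms unfolding directed_def preorder_on_def refl_on_def by blast+

lemma above_Field: "above r p \<subseteq> Field r"
  by (auto simp: above_def Field_def)

lemma infpt_notin: "small_directed r \<Longrightarrow> infpt r \<notin> Field r"
  unfolding infpt_def small_directed_def by (rule someI_ex) (use small_fresh in blast)

lemma topspace_net_space [simp]:
  assumes "small_directed r"
  shows "topspace (net_space r) = insert (infpt r) (Field r)"
proof -
  have r: "directed r" using assms by (simp add: small_directed_def)
  obtain p where "p \<in> Field r" using directedD(2)[OF r] by blast
  then have "openin (net_space r) (insert (infpt r) (Field r))"
    using above_Field[of r] by (auto simp: openin_net_space[OF r])
  moreover have "openin (net_space r) V \<Longrightarrow> V \<subseteq> insert (infpt r) (Field r)" for V
    by (simp add: openin_net_space[OF r])
  ultimately show ?thesis by (metis openin_subset openin_topspace subset_antisym)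
qed

lemma continuous_map_net_space:
  assumes r: "small_directed r"
  shows "continuous_map (net_space r) X f \<longleftrightarrow> f ` insert (infpt r) (Field r) \<subseteq> topspace X \<and>
    (\<forall>W. openin X W \<longrightarrow> f (infpt r) \<in> W \<longrightarrow> (\<exists>p\<in>Field r. f ` above r p \<subseteq> W))"
proof -
  have dr: "directed r" using r by (simp add: small_directed_def)
  have "openin (net_space r) {x \<in> insert (infpt r) (Field r). f x \<in> W} \<longleftrightarrow>
      (f (infpt r) \<in> W \<longrightarrow> (\<exists>p\<in>Field r. f ` above r p \<subseteq> W))" for W
    using above_Field[of r] unfolding openin_net_space[OF dr] by fastforce
  then show ?thesis
    by (simp only: continuous_map_def topspace_net_space[OF r] image_subset_iff_funcset)
qed

lemma topspace_sum_space [simp]: "topspace (sum_space r) = insert (infpt r) (Field r)"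
  by (simp add: sum_space_def)

lemma topspace_one_space [simp]: "topspace one_space = {undefined}"
  by (simp add: one_space_def)

lemma continuous_map_sum_space [simp]:
  "continuous_map (sum_space r) X f \<longleftrightarrow> f ` insert (infpt r) (Field r) \<subseteq> topspace X"
  unfolding sum_space_def by (auto simp: continuous_map_def)

lemma continuous_map_one_space [simp]: "continuous_map one_space X f \<longleftrightarrow> f undefined \<in> topspace X"
  unfolding one_space_def by (auto simp: continuous_map_def)

lemma sum_to_net_hom:
  assumes "inaccessible TYPE('u)" "small_directed (r :: 'u rel)"
  shows "sum_to_net r \<in> Hom (Top TYPE('u)) (sum_space r) (net_space r)"
  unfolding sum_to_net_def using assms
  by (intro top_map_hom) (auto simp: small_insert small_directed_def)

lemma sum_to_net_fn [simp]:
  "x \<in> insert (infpt r) (Field r) \<Longrightarrow> fn (sum_to_net r) x = x"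
  "src (sum_to_net r) = sum_space r" "tgt (sum_to_net r) = net_space r"
  by (simp_all add: sum_to_net_def)

lemma small_net_space:
  assumes "inaccessible TYPE('u)" "small_directed (r :: 'u rel)"
  shows "small TYPE('u) (topspace (net_space r))" "small TYPE('u) (topspace (sum_space r))"
  using assms by (auto simp: small_insert small_directed_def)

text \<open>
  Directed sets of neighbourhoods or of choice functions live in other types than \<open>'u\<close>; their
  smallness makes copies in \<open>'u\<close> available.
\<close>

lemma small_directed_copy:
  fixes r :: "'a rel"
  assumes r: "directed r" and sm: "small TYPE('u) (Field r)"
  obtains s :: "'u rel" and d :: "'u \<Rightarrow> 'a" where "small_directed s" "bij_betw d (Field s) (Field r)"
    "\<forall>x y. (x, y) \<in> s \<longleftrightarrow> x \<in> Field s \<and> y \<in> Field s \<and> (d x, d y) \<in> r"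
proof -
  obtain e :: "'a \<Rightarrow> 'u" where e: "inj_on e (Field r)" using small_embed[OF sm] .
  note dr = directedD[OF r]
  let ?s = "map_prod e e ` r" and ?d = "inv_into (Field r) e"
  have Fs: "Field ?s = e ` Field r" by (force simp: Field_def)
  have de: "?d (e x) = x" if "x \<in> Field r" for x using e that by simp
  have s: "(x, y) \<in> ?s \<longleftrightarrow> x \<in> Field ?s \<and> y \<in> Field ?s \<and> (?d x, ?d y) \<in> r" for x y
  proof
    assume "(x, y) \<in> ?s"
    then obtain a b where ab: "(a, b) \<in> r" "x = e a" "y = e b" by auto
    then have "a \<in> Field r" "b \<in> Field r" by (auto simp: Field_def)
    with ab show "x \<in> Field ?s \<and> y \<in> Field ?s \<and> (?d x, ?d y) \<in> r" unfolding Fs using de by simp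
  next
    assume "x \<in> Field ?s \<and> y \<in> Field ?s \<and> (?d x, ?d y) \<in> r"
    then obtain a b where "a \<in> Field r" "b \<in> Field r" "x = e a" "y = e b" "(?d x, ?d y) \<in> r"
      unfolding Fs by blast
    then show "(x, y) \<in> ?s" using de by (force simp: image_iff)
  qed
  have bij: "bij_betw ?d (Field ?s) (Field r)" unfolding Fs by (rule bij_betw_inv_into) (simp add: bij_betw_imageI e)
  have "directed ?s"
    unfolding directed_def preorder_on_def
  proof (intro conjI ballI)
    show "refl_on (Field ?s) ?s"
      using dr(4) de unfolding refl_on_def by (auto simp: s Fs)
    show "trans ?s" using dr(3) unfolding trans_def s by blast
    show "?s \<subseteq> Field ?s \<times> Field ?s" by (auto simp: Field_def)
    show "Field ?s \<noteq> {}" using dr(2) Fs by simp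
    fix x y assume "x \<in> Field ?s" "y \<in> Field ?s"
    then obtain a b where ab: "a \<in> Field r" "b \<in> Field r" "x = e a" "y = e b" unfolding Fs by blast
    then obtain c where "c \<in> Field r" "(a, c) \<in> r" "(b, c) \<in> r" using dr(5) by blast
    then show "\<exists>z\<in>Field ?s. (x, z) \<in> ?s \<and> (y, z) \<in> ?s"
      using ab de by (intro bexI[of _ "e c"]) (auto simp: s Fs)
  qed
  moreover have "small TYPE('u) (Field ?s)" unfolding Fs by (rule small_image[OF sm])
  ultimately show ?thesis using bij s by (intro that[of ?s ?d] allI) (auto simp: small_directed_def)
qed

lemma directed_Collect:
  assumes "N \<noteq> {}" "\<And>v. v \<in> N \<Longrightarrow> le v v" "\<And>u v w. le u v \<Longrightarrow> le v w \<Longrightarrow> le u w"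
    "\<And>v w. v \<in> N \<Longrightarrow> w \<in> N \<Longrightarrow> \<exists>z\<in>N. le v z \<and> le w z"
  shows "directed {(v, w). v \<in> N \<and> w \<in> N \<and> le v w} \<and> Field {(v, w). v \<in> N \<and> w \<in> N \<and> le v w} = N"
    (is "directed ?r \<and> _")
proof -
  have F: "Field ?r = N" using assms(2) by (auto simp: Field_def)
  have "trans ?r" unfolding trans_def using assms(3) by blast
  moreover have "refl_on N ?r" unfolding refl_on_def using assms(2) by blast
  ultimately have "directed ?r"
    unfolding directed_def preorder_on_def F using assms(1,4) by auto
  with F show ?thesis by blast
qed

text \<open>
  A net in \<open>X\<close> together with a limit is the same as a continuous map \<open>P \<union> {\<infinity>} \<rightarrow> X\<close>; this is
  the function that encodes the net \<open>x\<close> and the candidate limit \<open>a\<close>.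
\<close>

definition limit_extend :: "'u rel \<Rightarrow> ('u \<Rightarrow> 'u) \<Rightarrow> 'u \<Rightarrow> 'u \<Rightarrow> 'u" where
  "limit_extend P x a = (\<lambda>p. if p = infpt P then a else x p)"

lemma limit_extend_simps [simp]:
  "limit_extend P x a (infpt P) = a"
  "small_directed P \<Longrightarrow> p \<in> Field P \<Longrightarrow> limit_extend P x a p = x p"
  using infpt_notin by (auto simp: limit_extend_def)

lemma limit_extend_image:
  "small_directed P \<Longrightarrow> A \<subseteq> Field P \<Longrightarrow> limit_extend P x a ` A = x ` A"
  by (rule image_cong) auto

lemma continuous_limit_extend:
  assumes P: "small_directed P"
  shows "continuous_map (net_space P) X (limit_extend P x a) \<longleftrightarrow>
    x ` Field P \<subseteq> topspace X \<and> a \<in> topspace X \<and>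
    (\<forall>W. openin X W \<longrightarrow> a \<in> W \<longrightarrow> (\<exists>p\<in>Field P. x ` above P p \<subseteq> W))"
  unfolding continuous_map_net_space[OF P]
  using limit_extend_image[OF P] above_Field[of P] by auto

text \<open>
  The pairs \<open>(V, y)\<close> of an open neighbourhood \<open>V\<close> of \<open>x\<close> and a point \<open>y \<in> V\<close>, ordered by
  reverse inclusion of the \<open>V\<close>, form a directed set on which \<open>(V, y) \<mapsto> y\<close> converges to \<open>x\<close>.
  Its tails are the neighbourhoods: the image of the tail at \<open>(V, y)\<close> is all of \<open>V\<close>.
\<close>

lemma neighbourhood_net:
  fixes X :: "'u topology"
  assumes inacc: "inaccessible TYPE('u)" and X: "small TYPE('u) (topspace X)" and x: "x \<in> topspace X"
  obtains P :: "'u rel" and n where "small_directed P"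
    "continuous_map (net_space P) X (limit_extend P n x)"
    "\<And>W p. p \<in> Field P \<Longrightarrow> n ` above P p \<subseteq> W \<Longrightarrow> \<exists>V. openin X V \<and> x \<in> V \<and> V \<subseteq> W"
proof -
  define N where "N = {(V, y). openin X V \<and> x \<in> V \<and> y \<in> V}"
  have N: "v \<in> N \<longleftrightarrow> openin X (fst v) \<and> x \<in> fst v \<and> snd v \<in> fst v" for v
    by (auto simp: N_def)
  let ?r = "{(v, w). v \<in> N \<and> w \<in> N \<and> fst w \<subseteq> fst v}"
  have r: "directed ?r \<and> Field ?r = N"
  proof (rule directed_Collect)
    have "(topspace X, x) \<in> N" using x by (simp add: N)
    then show "N \<noteq> {}" by blast
    fix v w assume v: "v \<in> N" and w: "w \<in> N"
    then show "\<exists>z\<in>N. fst z \<subseteq> fst v \<and> fst z \<subseteq> fst w"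
      by (intro bexI[of _ "(fst v \<inter> fst w, x)"]) (auto simp: N)
  qed auto
  then have F: "Field ?r = N" ..
  have "small TYPE('u) (Field ?r)"
  proof (rule small_subset)
    show "small TYPE('u) (Pow (topspace X) \<times> topspace X)"
      by (rule small_Sigma[OF inacc small_Pow[OF inacc X] X])
    show "Field ?r \<subseteq> Pow (topspace X) \<times> topspace X"
      unfolding F by (auto simp: N dest: openin_subset[THEN subsetD])
  qed
  then obtain P :: "'u rel" and d where P: "small_directed P"
    and "bij_betw d (Field P) (Field ?r)"
    and Pd: "\<forall>u v. (u, v) \<in> P \<longleftrightarrow> u \<in> Field P \<and> v \<in> Field P \<and> (d u, d v) \<in> ?r"
    by (rule small_directed_copy[OF conjunct1[OF r]]) (rule that; assumption)
  then have bij: "bij_betw d (Field P) N" using F by simp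
  have dN: "d p \<in> N" if "p \<in> Field P" for p by (rule bij_betw_apply[OF bij that])
  have dex: "\<exists>p\<in>Field P. d p = v" if "v \<in> N" for v
    using that bij_betw_imp_surj_on[OF bij] by blast
  show ?thesis
  proof (rule that[OF P, of "snd \<circ> d"])
    show "continuous_map (net_space P) X (limit_extend P (snd \<circ> d) x)"
      unfolding continuous_limit_extend[OF P]
    proof (intro conjI allI impI x)
      show "(snd \<circ> d) ` Field P \<subseteq> topspace X" using dN by (auto simp: N dest: openin_subset[THEN subsetD])
      fix W assume W: "openin X W" "x \<in> W"
      then obtain p where p: "p \<in> Field P" "d p = (W, x)" using dex[of "(W, x)"] by (auto simp: N)
      then have "(snd \<circ> d) ` above P p \<subseteq> W" by (auto simp: above_def Pd N)
      with p show "\<exists>p\<in>Field P. (snd \<circ> d) ` above P p \<subseteq> W" by blast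
    qed
    fix W p assume p: "p \<in> Field P" and sub: "(snd \<circ> d) ` above P p \<subseteq> W"
    have "y \<in> W" if y: "y \<in> fst (d p)" for y
    proof -
      have "(fst (d p), y) \<in> N" using dN[OF p] y by (simp add: N)
      then obtain q where q: "q \<in> Field P" "d q = (fst (d p), y)" using dex by blast
      then have "q \<in> above P p" using p dN[OF p] dN[OF q(1)] by (simp add: above_def Pd)
      then have "snd (d q) \<in> W" using sub by auto
      then show ?thesis using q by simp
    qed
    then show "\<exists>V. openin X V \<and> x \<in> V \<and> V \<subseteq> W"
      using dN[OF p] by (intro exI[of _ "fst (d p)"]) (auto simp: N)
  qed
qed

text \<open>
  The points of \<open>X\<close> with one convergent net \<open>n x\<close> on \<open>P x\<close> for each \<open>x \<in> X\<close>, glued to the discrete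
  space of points along the values of the net.
\<close>

abbreviation nets_cocone where
  "nets_cocone X P n \<equiv> span_cocone (Top TYPE('u)) (topspace X) (discrete_topology (topspace X))
     (\<lambda>x. sum_to_net (P x))
     (\<lambda>x. top_map (sum_space (P x)) (n x) (discrete_topology (topspace X)))
     (X :: 'u topology) (top_map (discrete_topology (topspace X)) (\<lambda>x. x) X)
     (\<lambda>x. top_map (net_space (P x)) (n x) X)"

text \<open>
  One neighbourhood net at every point suffices to generate the topology, so that \<open>X\<close> arises
  from the discrete space on its points by coarsening along these nets. Hence every space is a
  colimit of a small diagram of discrete spaces and spaces \<open>P \<union> {\<infinity>}\<close>.
\<close>

lemma space_colimit_of_nets:
  fixes X :: "'u topology"
  assumes inacc: "inaccessible TYPE('u)" and X: "small TYPE('u) (topspace X)"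
  obtains P :: "'u \<Rightarrow> 'u rel" and n :: "'u \<Rightarrow> 'u \<Rightarrow> 'u" where
    "\<And>x. x \<in> topspace X \<Longrightarrow> small_directed (P x)"
    "\<And>x. x \<in> topspace X \<Longrightarrow> continuous_map (net_space (P x)) X (n x)"
    "colimit_cocone (Top TYPE('u)) (nets_cocone X P n)"
proof -
  let ?T = "Top TYPE('u)" and ?S = "topspace X"
  have "\<exists>P m. small_directed (P :: 'u rel) \<and> continuous_map (net_space P) X (limit_extend P m x) \<and>
     (\<forall>W. \<forall>p\<in>Field P. m ` above P p \<subseteq> W \<longrightarrow> (\<exists>V. openin X V \<and> x \<in> V \<and> V \<subseteq> W))"
    if x: "x \<in> ?S" for x
    using neighbourhood_net[OF inacc X x] by metis
  then obtain P :: "'u \<Rightarrow> 'u rel" and m where P: "\<And>x. x \<in> ?S \<Longrightarrow> small_directed (P x)"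
    and cont: "\<And>x. x \<in> ?S \<Longrightarrow> continuous_map (net_space (P x)) X (limit_extend (P x) (m x) x)"
    and nbhd: "\<And>x W p. x \<in> ?S \<Longrightarrow> p \<in> Field (P x) \<Longrightarrow> m x ` above (P x) p \<subseteq> W \<Longrightarrow>
        \<exists>V. openin X V \<and> x \<in> V \<and> V \<subseteq> W"
    by metis
  define n where "n x = limit_extend (P x) (m x) x" for x
  have im: "n x ` insert (infpt (P x)) (Field (P x)) \<subseteq> ?S" if "x \<in> ?S" for x
    using cont[OF that] continuous_map_image_subset_topspace unfolding n_def[symmetric]
    by (metis P that topspace_net_space)
  note sm = small_net_space[OF inacc P]
  show ?thesis
  proof (rule that[OF P])
    show "continuous_map (net_space (P x)) X (n x)" if "x \<in> ?S" for x
      using cont[OF that] by (simp add: n_def)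
    show "colimit_cocone ?T (nets_cocone X P n)"
    proof (rule colimit_coarsening[where A = "\<lambda>x. sum_space (P x)" and B = "\<lambda>x. net_space (P x)"])
      fix x assume x: "x \<in> ?S"
      show "sum_to_net (P x) \<in> Hom ?T (sum_space (P x)) (net_space (P x))"
        by (rule sum_to_net_hom[OF inacc P[OF x]])
      show "top_map (sum_space (P x)) (n x) (discrete_topology ?S)
        \<in> Hom ?T (sum_space (P x)) (discrete_topology ?S)"
        using X im[OF x] by (intro top_map_hom[OF sm(2)[OF x]]) auto
      show "top_map (net_space (P x)) (n x) X \<in> Hom ?T (net_space (P x)) X"
        using X cont[OF x] by (intro top_map_hom[OF sm(1)[OF x]]) (auto simp: n_def)
    next
      fix W assume W: "openin (discrete_topology ?S) W"
        and op: "\<And>x. x \<in> ?S \<Longrightarrow> openin (net_space (P x))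
          {p \<in> topspace (net_space (P x)). fn (top_map (net_space (P x)) (n x) X) p \<in> W}"
      have "\<exists>V. openin X V \<and> x \<in> V \<and> V \<subseteq> W" if x: "x \<in> W" for x
      proof -
        have xS: "x \<in> ?S" using W x by auto
        have dir: "directed (P x)" using P[OF xS] by (simp add: small_directed_def)
        let ?O = "{p \<in> topspace (net_space (P x)). fn (top_map (net_space (P x)) (n x) X) p \<in> W}"
        have "infpt (P x) \<in> ?O" using x P[OF xS] by (simp add: n_def)
        then obtain p where p: "p \<in> Field (P x)" "above (P x) p \<subseteq> ?O"
          using op[OF xS] unfolding openin_net_space[OF dir] by blast
        have "m x q \<in> W" if q: "q \<in> above (P x) p" for q
          using subsetD[OF p(2) q] subsetD[OF above_Field q] P[OF xS] by (simp add: n_def)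
        then show ?thesis using nbhd[OF xS p(1), of W] by blast
      qed
      then show "openin X W" by (subst openin_subopen) blast
    next
      show "openin (discrete_topology ?S) W" if "openin X W" for W
        using openin_subset[OF that] by simp
      fix x p assume "x \<in> ?S" "p \<in> topspace (sum_space (P x))"
      then show "fn (top_map (net_space (P x)) (n x) X) (fn (sum_to_net (P x)) p) =
        fn (top_map (sum_space (P x)) (n x) (discrete_topology ?S)) p"
        using P by simp
    qed (use X P in simp_all)
  qed
qed

lemma continuous_map_by_nets:
  fixes X Y :: "'u topology"
  assumes inacc: "inaccessible TYPE('u)" and X: "small TYPE('u) (topspace X)"
    and Y: "small TYPE('u) (topspace Y)" and f: "f \<in> topspace X \<rightarrow> topspace Y"
    and nets: "\<And>P u. small_directed (P :: 'u rel) \<Longrightarrow> continuous_map (net_space P) X u \<Longrightarrow>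
      continuous_map (net_space P) Y (\<lambda>p. f (u p))"
  shows "continuous_map X Y f"
proof -
  let ?T = "Top TYPE('u)" and ?S = "topspace X"
  obtain P :: "'u \<Rightarrow> 'u rel" and n where P: "\<And>x. x \<in> ?S \<Longrightarrow> small_directed (P x)"
    and n: "\<And>x. x \<in> ?S \<Longrightarrow> continuous_map (net_space (P x)) X (n x)"
    and col: "colimit_cocone ?T (nets_cocone X P n)"
      (is "colimit_cocone _ ?K")
    using space_colimit_of_nets[OF inacc X] by blast
  have cK: "is_cocone ?T ?K" using col by (simp add: colimit_cocone_iff)
  have "continuous_map (vertex ?K) Y f"
  proof (rule colimit_Top_final[OF col Y])
    fix i assume i: "i \<in> Obj (shape ?K)"
    then consider "i = Base" | x where "x \<in> ?S" "i = Apex x" | x where "x \<in> ?S" "i = Leg x" by auto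
    then show "continuous_map (ob_map (diagram ?K) i) Y (\<lambda>x. f (fn (leg ?K i) x))"
    proof cases
      case 1 then show ?thesis using f by (auto simp: continuous_map_def)
    next
      case 2
      have "f (fn (leg ?K i) p) \<in> topspace Y" if "p \<in> insert (infpt (P x)) (Field (P x))" for p
        using Hom_Top_mem[OF cocone_TopD(2)[OF cK i], of p] 2 that f by auto
      then show ?thesis using 2 by auto
    next
      case 3
      have "continuous_map (net_space (P x)) Y (\<lambda>p. f (n x p))" using nets P n 3 by blast
      then show ?thesis using 3 by (auto intro: continuous_map_eq simp: P)
    qed
  qed (use f in simp)
  then show ?thesis by simp
qed

section \<open>Subnets and iterated limits as colimits\<close>

definition final_topology ::
  "'a set \<Rightarrow> 'i set \<Rightarrow> ('i \<Rightarrow> 'b topology) \<Rightarrow> ('i \<Rightarrow> 'b \<Rightarrow> 'a) \<Rightarrow> 'a topology" where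
  "final_topology S I B c =
     topology (\<lambda>W. W \<subseteq> S \<and> (\<forall>i\<in>I. openin (B i) {x \<in> topspace (B i). c i x \<in> W}))"

lemma openin_final_topology:
  "openin (final_topology S I B c) W \<longleftrightarrow>
     W \<subseteq> S \<and> (\<forall>i\<in>I. openin (B i) {x \<in> topspace (B i). c i x \<in> W})"
proof -
  have "istopology (\<lambda>W. W \<subseteq> S \<and> (\<forall>i\<in>I. openin (B i) {x \<in> topspace (B i). c i x \<in> W}))"
    unfolding istopology_def
  proof (intro conjI allI impI ballI)
    fix V W i
    assume V: "V \<subseteq> S \<and> (\<forall>i\<in>I. openin (B i) {x \<in> topspace (B i). c i x \<in> V})"
      and W: "W \<subseteq> S \<and> (\<forall>i\<in>I. openin (B i) {x \<in> topspace (B i). c i x \<in> W})" and i: "i \<in> I"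
    have "{x \<in> topspace (B i). c i x \<in> V \<inter> W} =
      {x \<in> topspace (B i). c i x \<in> V} \<inter> {x \<in> topspace (B i). c i x \<in> W}" by auto
    then show "openin (B i) {x \<in> topspace (B i). c i x \<in> V \<inter> W}" using V W i by auto
  next
    fix \<K> i
    assume K: "\<forall>W\<in>\<K>. W \<subseteq> S \<and> (\<forall>i\<in>I. openin (B i) {x \<in> topspace (B i). c i x \<in> W})" and i: "i \<in> I"
    have "{x \<in> topspace (B i). c i x \<in> \<Union>\<K>} = (\<Union>W\<in>\<K>. {x \<in> topspace (B i). c i x \<in> W})" by auto
    then show "openin (B i) {x \<in> topspace (B i). c i x \<in> \<Union>\<K>}" using K i by auto
  qed blast+
  then show ?thesis by (simp add: final_topology_def topology_inverse')
qed

lemma topspace_final_topology: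
  assumes "\<And>i x. i \<in> I \<Longrightarrow> x \<in> topspace (B i) \<Longrightarrow> c i x \<in> S"
  shows "topspace (final_topology S I B c) = S"
proof -
  have "{x \<in> topspace (B i). c i x \<in> S} = topspace (B i)" if "i \<in> I" for i
    using assms that by auto
  then have "openin (final_topology S I B c) S" by (simp add: openin_final_topology)
  moreover have "topspace (final_topology S I B c) \<subseteq> S"
    using openin_topspace[of "final_topology S I B c"] unfolding openin_final_topology by blast
  ultimately show ?thesis using openin_subset by blast
qed

lemma continuous_final_topology:
  assumes "\<And>i x. i \<in> I \<Longrightarrow> x \<in> topspace (B i) \<Longrightarrow> c i x \<in> S" "i \<in> I"
  shows "continuous_map (B i) (final_topology S I B c) (c i)"
  using assms topspace_final_topology[of I B c S]
  unfolding continuous_map_def by (auto simp: openin_final_topology)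

lemma Field_Restr: "directed r \<Longrightarrow> Q \<subseteq> Field r \<Longrightarrow> Field (Restr r Q) = Q"
  using directedD(4)[of r] unfolding Field_def by blast

lemma sum_to_sum_hom:
  assumes inacc: "inaccessible TYPE('u)" and r: "small_directed (r :: 'u rel)" and s: "small_directed s"
    and h: "h \<in> Field r \<rightarrow> Field s"
  shows "sum_to_sum r h s \<in> Hom (Top TYPE('u)) (sum_space r) (sum_space s)"
  unfolding sum_to_sum_def
  using small_net_space(2)[OF inacc r] small_net_space(2)[OF inacc s] h
  by (intro top_map_hom) auto

text \<open>
  With the right topology on \<open>V\<close> this is the distinguished cocone with vertex \<open>F(P,h)\<close>.
\<close>

abbreviation subnet_cocone where
  "subnet_cocone P R h V \<equiv> span_cocone (Top TYPE('u)) (Subset ` {Q. cofinal_subset P Q}) (sum_space P)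
     (\<lambda>k. case k of Subset Q \<Rightarrow> sum_to_net (R Q))
     (\<lambda>k. case k of Subset Q \<Rightarrow> sum_to_sum (R Q) (h Q) P)
     (V :: 'u topology) (top_map (sum_space P) (\<lambda>x. x) V)
     (\<lambda>k. case k of Subset Q \<Rightarrow> top_map (net_space (R Q)) (limit_extend (R Q) (h Q) (infpt P)) V)"

text \<open>
  The space \<open>F(P,h)\<close> can be taken on the points of \<open>P \<union> {\<infinity>}\<close>. Its topology is contained in
  that of \<open>P \<union> {\<infinity>}\<close>: if a set \<open>W\<close> containing \<open>\<infinity>\<close> contains no tail of \<open>P\<close>, then \<open>P - W\<close> is
  a cofinal subset \<open>Q\<close>, and the preimage of \<open>W\<close> in \<open>R Q \<union> {\<infinity>}\<close> is \<open>{\<infinity>}\<close>, which is not open.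
\<close>

lemma subnet_cocone_exists:
  fixes P :: "'u rel"
  assumes inacc: "inaccessible TYPE('u)" and P: "small_directed P"
    and R: "\<And>Q. cofinal_subset P Q \<Longrightarrow> small_directed (R Q)"
    and h: "\<And>Q. cofinal_subset P Q \<Longrightarrow> cofinal_map (R Q) (Restr P Q) (h Q)"
  obtains V where "subnet_cocone P R h V \<in> subnet_cocones"
    "topspace V = insert (infpt P) (Field P)" "continuous_map (net_space P) V (\<lambda>x. x)"
proof -
  let ?T = "Top TYPE('u)" and ?I = "{Q. cofinal_subset P Q}" and ?S = "insert (infpt P) (Field P)"
  let ?c = "\<lambda>Q. limit_extend (R Q) (h Q) (infpt P)"
  define V where "V = final_topology ?S ?I (\<lambda>Q. net_space (R Q)) ?c"
  have dP: "directed P" using P by (simp add: small_directed_def)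
  have FQ: "Field (Restr P Q) = Q" if "cofinal_subset P Q" for Q
    using that Field_Restr[OF dP] by (simp add: cofinal_subset_def)
  have hQ: "h Q r \<in> Q" "h Q r \<in> Field P" if "cofinal_subset P Q" "r \<in> Field (R Q)" for Q r
    using h[OF that(1)] that FQ[OF that(1)] by (auto simp: cofinal_map_def cofinal_subset_def)
  have c: "?c Q x \<in> ?S" if "Q \<in> ?I" "x \<in> topspace (net_space (R Q))" for Q x
    using that R hQ by auto
  have tV: "topspace V = ?S" unfolding V_def by (rule topspace_final_topology[OF c])
  have contc: "continuous_map (net_space (R Q)) V (?c Q)" if "cofinal_subset P Q" for Q
    unfolding V_def using that by (intro continuous_final_topology[OF c]) auto
  have "continuous_map (net_space P) V (\<lambda>x. x)"
    unfolding continuous_map_net_space[OF P]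
  proof (intro conjI allI impI)
    show "(\<lambda>x. x) ` ?S \<subseteq> topspace V" using tV by simp
    fix W assume W: "openin V W" "infpt P \<in> W"
    show "\<exists>p\<in>Field P. (\<lambda>x. x) ` above P p \<subseteq> W"
    proof (rule ccontr)
      assume "\<not> (\<exists>p\<in>Field P. (\<lambda>x. x) ` above P p \<subseteq> W)"
      then have cof: "cofinal_subset P (Field P - W)"
        using above_Field[of P] unfolding cofinal_subset_def by (fastforce simp: above_def)
      let ?Q = "Field P - W"
      have dR: "directed (R ?Q)" using R[OF cof] by (simp add: small_directed_def)
      have "openin (net_space (R ?Q)) {x \<in> topspace (net_space (R ?Q)). ?c ?Q x \<in> W}"
        using W(1) cof by (simp add: V_def openin_final_topology)
      then obtain r where r: "r \<in> Field (R ?Q)" "above (R ?Q) r \<subseteq> {x. ?c ?Q x \<in> W}"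
        using W(2) R[OF cof] unfolding openin_net_space[OF dR] by auto
      have "r \<in> above (R ?Q) r" using directedD(4)[OF dR r(1)] by (simp add: above_def)
      then have "h ?Q r \<in> W" using r R[OF cof] by auto
      then show False using hQ(1)[OF cof r(1)] by blast
    qed
  qed
  moreover
  have "colimit_cocone ?T (subnet_cocone P R h V)"
  proof (rule colimit_coarsening[where A = "\<lambda>k. case k of Subset Q \<Rightarrow> sum_space (R Q)"
        and B = "\<lambda>k. case k of Subset Q \<Rightarrow> net_space (R Q)"])
    show "small TYPE('u) (topspace (sum_space P))" by (rule small_net_space(2)[OF inacc P])
    show "topspace V = topspace (sum_space P)" using tV by simp
    show "openin (sum_space P) W" if "openin V W" for W
      using openin_subset[OF that] tV by (simp add: sum_space_def)
    fix W assume W: "openin (sum_space P) W" "\<And>k. k \<in> Subset ` ?I \<Longrightarrow>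
      openin (case k of Subset Q \<Rightarrow> net_space (R Q)) {x \<in> topspace (case k of Subset Q \<Rightarrow> net_space (R Q)).
          fn (case k of Subset Q \<Rightarrow> top_map (net_space (R Q)) (?c Q) V) x \<in> W}"
    have "openin (net_space (R Q)) {x \<in> topspace (net_space (R Q)). ?c Q x \<in> W}"
      if "cofinal_subset P Q" for Q
    proof -
      have "{x \<in> topspace (net_space (R Q)). fn (top_map (net_space (R Q)) (?c Q) V) x \<in> W} =
        {x \<in> topspace (net_space (R Q)). ?c Q x \<in> W}" by auto
      then show ?thesis using W(2)[of "Subset Q"] that by simp
    qed
    then show "openin V W" using openin_subset[OF W(1)] by (simp add: V_def openin_final_topology)
  next
    fix k assume "k \<in> Subset ` ?I"
    then obtain Q where k: "k = Subset Q" and Q: "cofinal_subset P Q" by blast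
    note sm = small_net_space[OF inacc R[OF Q]]
    show "(case k of Subset Q \<Rightarrow> sum_to_net (R Q)) \<in> Hom ?T (case k of Subset Q \<Rightarrow> sum_space (R Q))
      (case k of Subset Q \<Rightarrow> net_space (R Q))"
      using sum_to_net_hom[OF inacc R[OF Q]] k by simp
    show "topspace (case k of Subset Q \<Rightarrow> net_space (R Q)) \<subseteq>
      fn (case k of Subset Q \<Rightarrow> sum_to_net (R Q)) ` topspace (case k of Subset Q \<Rightarrow> sum_space (R Q))"
      using R[OF Q] k by auto
    show "(case k of Subset Q \<Rightarrow> sum_to_sum (R Q) (h Q) P)
      \<in> Hom ?T (case k of Subset Q \<Rightarrow> sum_space (R Q)) (sum_space P)"
      using sum_to_sum_hom[OF inacc R[OF Q] P] hQ[OF Q] k by auto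
    show "(case k of Subset Q \<Rightarrow> top_map (net_space (R Q)) (?c Q) V)
      \<in> Hom ?T (case k of Subset Q \<Rightarrow> net_space (R Q)) V"
      using k top_map_hom[OF sm(1) _ contc[OF Q]] small_net_space(2)[OF inacc P] tV by simp
    fix x assume "x \<in> topspace (case k of Subset Q \<Rightarrow> sum_space (R Q))"
    then show "fn (case k of Subset Q \<Rightarrow> top_map (net_space (R Q)) (?c Q) V)
        (fn (case k of Subset Q \<Rightarrow> sum_to_net (R Q)) x) =
      fn (case k of Subset Q \<Rightarrow> sum_to_sum (R Q) (h Q) P) x"
      using k R[OF Q] by (auto simp: sum_to_sum_def limit_extend_def)
  qed
  then have "subnet_cocone P R h V \<in> subnet_cocones"
    using P R h unfolding subnet_cocones_def
    by (intro CollectI exI[of _ P] exI[of _ R] exI[of _ h]) simp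
  ultimately show ?thesis using that[OF _ tV] by simp
qed

lemma point_hom:
  assumes "inaccessible TYPE('u)" "small TYPE('u) (topspace X)" "x \<in> topspace (X :: 'u topology)"
  shows "point x X \<in> Hom (Top TYPE('u)) one_space X"
  unfolding point_def using assms by (intro top_map_hom) (auto intro: small_finite)

lemma point_fn [simp]: "fn (point x X) undefined = x" "src (point x X) = one_space" "tgt (point x X) = X"
  by (simp_all add: point_def)

text \<open>
  With the right choice of \<open>V\<close>, \<open>i\<close> and \<open>j\<close> this is the distinguished cocone with vertex \<open>G(P,Q)\<close>.
\<close>

abbreviation iterated_cocone where
  "iterated_cocone P Q V i j \<equiv> span_cocone (Top TYPE('u)) (Point ` Field P) (net_space P)
     (\<lambda>k. case k of Point p \<Rightarrow> point (infpt (Q p)) (net_space (Q p)))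
     (\<lambda>k. case k of Point p \<Rightarrow> point p (net_space P))
     (V :: 'u topology) (top_map (net_space P) i V)
     (\<lambda>k. case k of Point p \<Rightarrow> top_map (net_space (Q p)) (j p) V)"

text \<open>
  For \<open>G(P,Q)\<close>, the points \<open>x\<close> of \<open>P \<union> {\<infinity>}\<close> are coded by \<open>(u0, (x, x))\<close> and the points
  \<open>z\<close> of \<open>Q p\<close> by \<open>(u1, (p, z))\<close>, while the point at infinity of \<open>Q p\<close> is the point \<open>p\<close>.
\<close>

lemma iterated_cocone_exists:
  fixes P :: "'u rel" and Q :: "'u \<Rightarrow> 'u rel"
  assumes inacc: "inaccessible TYPE('u)" and P: "small_directed P"
    and Q: "\<And>p. p \<in> Field P \<Longrightarrow> small_directed (Q p)"
  obtains V i j where "iterated_cocone P Q V i j \<in> iterated_cocones"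
    "continuous_map (net_space P) V i"
    "\<And>p. p \<in> Field P \<Longrightarrow> continuous_map (net_space (Q p)) V (j p)"
    "\<And>p. p \<in> Field P \<Longrightarrow> j p (infpt (Q p)) = i p"
    "\<And>(g0 :: 'u \<Rightarrow> 'u) (g :: 'u \<Rightarrow> 'u \<Rightarrow> 'u). (\<And>p. p \<in> Field P \<Longrightarrow> g p (infpt (Q p)) = g0 p) \<Longrightarrow>
      \<exists>t. (\<forall>x\<in>topspace (net_space P). t (i x) = g0 x) \<and>
          (\<forall>p\<in>Field P. \<forall>z\<in>topspace (net_space (Q p)). t (j p z) = g p z)"
    "topspace V = i ` topspace (net_space P) \<union> (\<Union>p\<in>Field P. j p ` topspace (net_space (Q p)))"
proof -
  let ?T = "Top TYPE('u)"
  obtain e :: "'u \<times> 'u \<Rightarrow> 'u" where e: "inj e" using universe_pairing[OF inacc] .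
  \<comment> \<open>two tags that keep the codes of the points of \<open>P\<close> and of the \<open>Q p\<close> apart\<close>
  obtain u0 u1 :: 'u where u: "u0 \<noteq> u1"
    using infinite_universe[OF inacc] by (metis UNIV_eq_I finite.emptyI finite.insertI singletonI)
  define i where "i x = e (u0, e (x, x))" for x
  define j where "j p z = (if z = infpt (Q p) then i p else e (u1, e (p, z)))" for p z
  let ?S = "i ` topspace (net_space P) \<union> (\<Union>p\<in>Field P. j p ` topspace (net_space (Q p)))"
  let ?B = "case_option (net_space P) (\<lambda>p. net_space (Q p))" and ?c = "case_option i j"
  define V where "V = final_topology ?S (insert None (Some ` Field P)) ?B ?c"
  have c: "?c k x \<in> ?S" if "k \<in> insert None (Some ` Field P)" "x \<in> topspace (?B k)" for k x
    using that by (cases k) auto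
  have tV: "topspace V = ?S" unfolding V_def by (rule topspace_final_topology[OF c])
  have ci: "continuous_map (net_space P) V i"
    using continuous_final_topology[where I = "insert None (Some ` Field P)" and B = ?B and c = ?c and i = None, OF c]
    by (simp add: V_def)
  have cj: "continuous_map (net_space (Q p)) V (j p)" if "p \<in> Field P" for p
    using continuous_final_topology[where I = "insert None (Some ` Field P)" and B = ?B and c = ?c and i = "Some p", OF c] that
    by (simp add: V_def)
  have ji: "j p (infpt (Q p)) = i p" for p by (simp add: j_def)
  note smP = small_net_space(1)[OF inacc P] and smQ = small_net_space(1)[OF inacc Q]
  have smV: "small TYPE('u) (topspace V)"
    unfolding tV using smP smQ P by (intro small_Un[OF inacc] small_UN[OF inacc] small_image)
      (auto simp: small_directed_def)
  have glue: "\<exists>t. (\<forall>x\<in>topspace (net_space P). t (i x) = g0 x) \<and>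
          (\<forall>p\<in>Field P. \<forall>z\<in>topspace (net_space (Q p)). t (j p z) = g p z)"
    if g: "\<And>p. p \<in> Field P \<Longrightarrow> g p (infpt (Q p)) = g0 p"
    for g0 :: "'u \<Rightarrow> 'u" and g :: "'u \<Rightarrow> 'u \<Rightarrow> 'u"
  proof -
    define t where "t w = (let (v, y) = inv e w; (p, z) = inv e y in if v = u0 then g0 p else g p z)" for w
    have "t (i x) = g0 x" for x by (simp add: t_def i_def inv_f_f[OF e])
    moreover have "t (e (u1, e (p, z))) = g p z" for p z using u by (simp add: t_def inv_f_f[OF e])
    ultimately show ?thesis using g by (intro exI[of _ t]) (auto simp: j_def)
  qed
  have "colimit_cocone ?T (iterated_cocone P Q V i j)"
  proof (rule colimit_span_cocone_TopI[where A = "\<lambda>_. one_space"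
        and B = "\<lambda>k. case k of Point p \<Rightarrow> net_space (Q p)"])
    show "top_map (net_space P) i V \<in> Hom ?T (net_space P) V" by (rule top_map_hom[OF smP smV ci])
    show "topspace V \<subseteq> fn (top_map (net_space P) i V) ` topspace (net_space P) \<union>
      (\<Union>k\<in>Point ` Field P. fn (case k of Point p \<Rightarrow> top_map (net_space (Q p)) (j p) V) `
         topspace (case k of Point p \<Rightarrow> net_space (Q p)))"
    proof
      fix y assume "y \<in> topspace V"
      then consider x where "x \<in> topspace (net_space P)" "y = i x"
        | p z where "p \<in> Field P" "z \<in> topspace (net_space (Q p))" "y = j p z" unfolding tV by blast
      then show "y \<in> fn (top_map (net_space P) i V) ` topspace (net_space P) \<union>
      (\<Union>k\<in>Point ` Field P. fn (case k of Point p \<Rightarrow> top_map (net_space (Q p)) (j p) V) `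
         topspace (case k of Point p \<Rightarrow> net_space (Q p)))"
      proof cases
        case 1
        then have "y = fn (top_map (net_space P) i V) x" by simp
        with 1 show ?thesis by blast
      next
        case 2
        then have "y = fn (top_map (net_space (Q p)) (j p) V) z" by simp
        with 2 show ?thesis by (intro UnI2 UN_I[of "Point p"]) auto
      qed
    qed
    fix W assume W: "W \<subseteq> topspace V"
      "openin (net_space P) {x \<in> topspace (net_space P). fn (top_map (net_space P) i V) x \<in> W}"
      "\<And>k. k \<in> Point ` Field P \<Longrightarrow> openin (case k of Point p \<Rightarrow> net_space (Q p))
        {x \<in> topspace (case k of Point p \<Rightarrow> net_space (Q p)).
          fn (case k of Point p \<Rightarrow> top_map (net_space (Q p)) (j p) V) x \<in> W}"
    have "openin (net_space (Q p)) {x \<in> topspace (net_space (Q p)). j p x \<in> W}" if "p \<in> Field P" for p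
    proof -
      have "{x \<in> topspace (net_space (Q p)). fn (top_map (net_space (Q p)) (j p) V) x \<in> W} =
        {x \<in> topspace (net_space (Q p)). j p x \<in> W}" by auto
      then show ?thesis using W(3)[of "Point p"] that by simp
    qed
    moreover have "{x \<in> topspace (net_space P). fn (top_map (net_space P) i V) x \<in> W} =
      {x \<in> topspace (net_space P). i x \<in> W}" by auto
    ultimately show "openin V W"
      using W(1,2) unfolding tV by (simp add: V_def openin_final_topology)
  next
    fix g0 and g :: "'u key \<Rightarrow> 'u \<Rightarrow> 'u"
    assume g: "\<And>k x. k \<in> Point ` Field P \<Longrightarrow> x \<in> topspace (one_space :: 'u topology) \<Longrightarrow>
      g k (fn (case k of Point p \<Rightarrow> point (infpt (Q p)) (net_space (Q p))) x) =
      g0 (fn (case k of Point p \<Rightarrow> point p (net_space P)) x)"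
    have "g (Point p) (infpt (Q p)) = g0 p" if "p \<in> Field P" for p using g[of "Point p"] that by simp
    from glue[of "\<lambda>p. g (Point p)", OF this] obtain t where
      "\<forall>x\<in>topspace (net_space P). t (i x) = g0 x"
      "\<forall>p\<in>Field P. \<forall>z\<in>topspace (net_space (Q p)). t (j p z) = g (Point p) z" by blast
    then show "\<exists>t. (\<forall>x\<in>topspace (net_space P). t (fn (top_map (net_space P) i V) x) = g0 x) \<and>
      (\<forall>k\<in>Point ` Field P. \<forall>x\<in>topspace (case k of Point p \<Rightarrow> net_space (Q p)).
        t (fn (case k of Point p \<Rightarrow> top_map (net_space (Q p)) (j p) V) x) = g k x)"
      by (intro exI[of _ t]) simp
  next
    fix k assume "k \<in> Point ` Field P"
    then obtain p where k: "k = Point p" and p: "p \<in> Field P" by blast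
    show "(case k of Point p \<Rightarrow> point (infpt (Q p)) (net_space (Q p)))
      \<in> Hom ?T one_space (case k of Point p \<Rightarrow> net_space (Q p))"
      using k Q[OF p] point_hom[OF inacc smQ[OF p]] by simp
    show "(case k of Point p \<Rightarrow> point p (net_space P)) \<in> Hom ?T one_space (net_space P)"
      using k p P point_hom[OF inacc smP] by simp
    show "(case k of Point p \<Rightarrow> top_map (net_space (Q p)) (j p) V)
      \<in> Hom ?T (case k of Point p \<Rightarrow> net_space (Q p)) V"
      using k top_map_hom[OF smQ[OF p] smV cj[OF p]] by simp
    fix x assume "x \<in> topspace (one_space :: 'u topology)"
    then show "fn (case k of Point p \<Rightarrow> top_map (net_space (Q p)) (j p) V)
        (fn (case k of Point p \<Rightarrow> point (infpt (Q p)) (net_space (Q p))) x) =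
      fn (top_map (net_space P) i V) (fn (case k of Point p \<Rightarrow> point p (net_space P)) x)"
      using k p Q[OF p] P ji by simp
  qed
  then have "iterated_cocone P Q V i j \<in> iterated_cocones"
    using P Q unfolding iterated_cocones_def by (intro CollectI exI[of _ P] exI[of _ Q]) simp
  then show ?thesis by (rule that[OF _ ci cj ji glue tV])
qed

text \<open>
  The index set of an iterated limit is \<open>P \<times> (\<Prod>p\<in>P. Q p)\<close> with the product order, and the
  diagonal net takes \<open>(p, f)\<close> to \<open>f p \<in> Q p\<close>. A neighbourhood of the limit contains
  \<open>i p\<close> for all \<open>p\<close> in a tail, and for each such \<open>p\<close> a tail of \<open>Q p\<close>; the starting
  points of these tails form a function \<open>f\<close>.
\<close>

lemma diagonal_net:
  fixes P :: "'u rel" and Q :: "'u \<Rightarrow> 'u rel"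
  assumes inacc: "inaccessible TYPE('u)" and P: "small_directed P"
    and Q: "\<And>p. p \<in> Field P \<Longrightarrow> small_directed (Q p)"
  obtains R :: "'u rel" and k h where "small_directed R" "cofinal_map R P k"
    "\<And>r. r \<in> Field R \<Longrightarrow> h r \<in> Field (Q (k r))"
    "\<And>(V :: 'u topology) i j. continuous_map (net_space P) V i \<Longrightarrow>
      (\<And>p. p \<in> Field P \<Longrightarrow> continuous_map (net_space (Q p)) V (j p)) \<Longrightarrow>
      (\<And>p. p \<in> Field P \<Longrightarrow> j p (infpt (Q p)) = i p) \<Longrightarrow>
      continuous_map (net_space R) V (limit_extend R (\<lambda>r. j (k r) (h r)) (i (infpt P)))"
proof -
  have dP: "directed P" using P by (simp add: small_directed_def)
  have dQ: "directed (Q p)" if "p \<in> Field P" for p using Q[OF that] by (simp add: small_directed_def)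
  let ?F = "\<Pi>\<^sub>E p\<in>Field P. Field (Q p)"
  let ?N = "Field P \<times> ?F"
  define le where "le v w \<longleftrightarrow> (fst v, fst w) \<in> P \<and> (\<forall>q\<in>Field P. (snd v q, snd w q) \<in> Q q)" for v w
  have "\<forall>p\<in>Field P. \<exists>z. z \<in> Field (Q p)" using directedD(2)[OF dQ] by blast
  then obtain f where "\<forall>p\<in>Field P. f p \<in> Field (Q p)" by metis
  then have f0: "restrict f (Field P) \<in> ?F" by simp
  let ?f0 = "restrict f (Field P)"
  let ?r = "{(v, w). v \<in> ?N \<and> w \<in> ?N \<and> le v w}"
  have r: "directed ?r \<and> Field ?r = ?N"
  proof (rule directed_Collect)
    show "?N \<noteq> {}" using directedD(2)[OF dP] f0 by blast
    show "le v v" if v: "v \<in> ?N" for v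
    proof -
      have "(snd v q, snd v q) \<in> Q q" if "q \<in> Field P" for q
        using directedD(4)[OF dQ[OF that]] v that by (auto dest: PiE_mem)
      then show ?thesis using v directedD(4)[OF dP] by (auto simp: le_def)
    qed
    show "le u w" if "le u v" "le v w" for u v w
      using that transD[OF directedD(3)[OF dP]] transD[OF directedD(3)[OF dQ]]
      unfolding le_def by metis
    fix v w assume v: "v \<in> ?N" and w: "w \<in> ?N"
    have v': "fst v \<in> Field P" "snd v \<in> ?F" and w': "fst w \<in> Field P" "snd w \<in> ?F" using v w by auto
    obtain p where p: "p \<in> Field P" "(fst v, p) \<in> P" "(fst w, p) \<in> P"
      using directedD(5)[OF dP v'(1) w'(1)] by blast
    have "\<exists>z\<in>Field (Q q). (snd v q, z) \<in> Q q \<and> (snd w q, z) \<in> Q q" if "q \<in> Field P" for q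
      using directedD(5)[OF dQ[OF that] PiE_mem[OF v'(2) that] PiE_mem[OF w'(2) that]] .
    then obtain f where f: "\<And>q. q \<in> Field P \<Longrightarrow> f q \<in> Field (Q q)"
      "\<And>q. q \<in> Field P \<Longrightarrow> (snd v q, f q) \<in> Q q \<and> (snd w q, f q) \<in> Q q" by metis
    then show "\<exists>z\<in>?N. le v z \<and> le w z"
      using p by (intro bexI[of _ "(p, restrict f (Field P))"]) (auto simp: le_def)
  qed
  then have F: "Field ?r = ?N" ..
  have "small TYPE('u) (Field ?r)"
    unfolding F using P Q
    by (intro small_Sigma[OF inacc] small_PiE[OF inacc]) (auto simp: small_directed_def)
  then obtain R :: "'u rel" and d where R: "small_directed R"
    and "bij_betw d (Field R) (Field ?r)"
    and Rd': "\<forall>u v. (u, v) \<in> R \<longleftrightarrow> u \<in> Field R \<and> v \<in> Field R \<and> (d u, d v) \<in> ?r"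
    by (rule small_directed_copy[OF conjunct1[OF r]]) (rule that; assumption)
  then have bij: "bij_betw d (Field R) ?N" using F by simp
  have Rd: "le (d u) (d v)" if "(u, v) \<in> R" for u v
    using that Rd' by (simp only: mem_Collect_eq case_prod_conv)
  have dN: "fst (d r) \<in> Field P" "snd (d r) \<in> ?F" if "r \<in> Field R" for r
    using bij_betw_apply[OF bij that] by auto
  have dex: "\<exists>r\<in>Field R. d r = v" if "v \<in> ?N" for v
    using that unfolding bij_betw_imp_surj_on[OF bij, symmetric] by blast
  define k where "k r = fst (d r)" for r
  define h where "h r = snd (d r) (k r)" for r
  have kP: "k r \<in> Field P" and hQ: "h r \<in> Field (Q (k r))" if "r \<in> Field R" for r
    using dN[OF that] PiE_mem[OF dN(2)[OF that] dN(1)[OF that]] by (simp_all add: k_def h_def)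
  have Rk: "(k r, k s) \<in> P" "\<And>q. q \<in> Field P \<Longrightarrow> (snd (d r) q, snd (d s) q) \<in> Q q"
    if "s \<in> above R r" for r s
    using that Rd[of r s] by (auto simp: above_def le_def k_def)
  show ?thesis
  proof (rule that[OF R _ hQ])
    show "cofinal_map R P k"
      unfolding cofinal_map_def
    proof (intro conjI ballI)
      fix p assume "p \<in> Field P"
      then obtain r where r: "r \<in> Field R" "d r = (p, ?f0)" using dex[of "(p, ?f0)"] f0 by auto
      then have "k ` above R r \<subseteq> above P p" using Rk(1) by (fastforce simp: above_def k_def)
      with r show "\<exists>r\<in>Field R. k ` above R r \<subseteq> above P p" by blast
    qed (use kP in blast)
    fix V :: "'u topology" and i j
    assume i: "continuous_map (net_space P) V i"
      and j: "\<And>p. p \<in> Field P \<Longrightarrow> continuous_map (net_space (Q p)) V (j p)"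
      and ji: "\<And>p. p \<in> Field P \<Longrightarrow> j p (infpt (Q p)) = i p"
    show "continuous_map (net_space R) V (limit_extend R (\<lambda>r. j (k r) (h r)) (i (infpt P)))"
      unfolding continuous_limit_extend[OF R]
    proof (intro conjI allI impI)
      have "j (k r) (h r) \<in> topspace V" if "r \<in> Field R" for r
        using j[OF kP[OF that]] hQ[OF that] Q[OF kP[OF that]] by (auto simp: continuous_map_net_space)
      then show "(\<lambda>r. j (k r) (h r)) ` Field R \<subseteq> topspace V" by blast
      show "i (infpt P) \<in> topspace V" using i by (simp add: continuous_map_net_space[OF P])
      fix W assume W: "openin V W" "i (infpt P) \<in> W"
      then obtain p where p: "p \<in> Field P" "i ` above P p \<subseteq> W"
        using i unfolding continuous_map_net_space[OF P] by blast
      \<comment> \<open>if \<open>i q \<notin> W\<close>, any element of \<open>Q q\<close> will do as a value of the choice function\<close>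
      have "\<exists>z\<in>Field (Q q). i q \<in> W \<longrightarrow> j q ` above (Q q) z \<subseteq> W" if q: "q \<in> Field P" for q
      proof (cases "i q \<in> W")
        case True
        then show ?thesis
          using j[OF q] W(1) ji[OF q] unfolding continuous_map_net_space[OF Q[OF q]] by metis
      next
        case False
        then show ?thesis using directedD(2)[OF dQ[OF q]] by blast
      qed
      then obtain f where f: "\<And>q. q \<in> Field P \<Longrightarrow> f q \<in> Field (Q q)"
        "\<And>q. q \<in> Field P \<Longrightarrow> i q \<in> W \<Longrightarrow> j q ` above (Q q) (f q) \<subseteq> W" by metis
      obtain r where r: "r \<in> Field R" "d r = (p, restrict f (Field P))"
        using dex[of "(p, restrict f (Field P))"] p f by auto
      have "j (k s) (h s) \<in> W" if s: "s \<in> above R r" for s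
      proof -
        have sR: "s \<in> Field R" using s above_Field by fast
        have "(p, k s) \<in> P" using Rk(1)[OF s] r by (simp add: k_def)
        then have "i (k s) \<in> W" using p by (auto simp: above_def)
        moreover have "h s \<in> above (Q (k s)) (f (k s))"
          using Rk(2)[OF s kP[OF sR]] r kP[OF sR] by (simp add: h_def above_def)
        ultimately show ?thesis using f(2)[OF kP[OF sR]] by blast
      qed
      with r show "\<exists>r\<in>Field R. (\<lambda>r. j (k r) (h r)) ` above R r \<subseteq> W" by blast
    qed
  qed
qed

section \<open>Convergence classes\<close>

lemma cofinal_map_id: "directed r \<Longrightarrow> cofinal_map r r (\<lambda>x. x)"
  by (auto simp: cofinal_map_def)

lemma small_directed_Restr:
  assumes P: "small_directed P" and Q: "cofinal_subset P Q"
  shows "small_directed (Restr P Q)" "cofinal_map (Restr P Q) P (\<lambda>x. x)"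
proof -
  have dP: "directed P" using P by (simp add: small_directed_def)
  note d = directedD[OF dP]
  have Q': "Q \<subseteq> Field P" and cof: "\<And>p. p \<in> Field P \<Longrightarrow> \<exists>q\<in>Q. (p, q) \<in> P"
    using Q by (auto simp: cofinal_subset_def)
  have F: "Field (Restr P Q) = Q" by (rule Field_Restr[OF dP Q'])
  have "directed (Restr P Q)"
    unfolding directed_def preorder_on_def F
  proof (intro conjI ballI)
    show "refl_on Q (Restr P Q)" using d(4) Q' by (auto simp: refl_on_def)
    show "trans (Restr P Q)" using d(3) unfolding trans_def by blast
    show "Q \<noteq> {}" using d(2) cof by blast
    fix x y assume xy: "x \<in> Q" "y \<in> Q"
    obtain z where z: "z \<in> Field P" "(x, z) \<in> P" "(y, z) \<in> P" using d(5) xy Q' by blast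
    then obtain w where "w \<in> Q" "(z, w) \<in> P" using cof by blast
    then show "\<exists>z\<in>Q. (x, z) \<in> Restr P Q \<and> (y, z) \<in> Restr P Q"
      using z xy transD[OF d(3)] by blast
  qed blast
  moreover have "small TYPE('a) (Field (Restr P Q))"
    unfolding F using P by (intro small_subset[OF _ Q']) (simp add: small_directed_def)
  ultimately show "small_directed (Restr P Q)" by (simp add: small_directed_def)
  show "cofinal_map (Restr P Q) P (\<lambda>x. x)"
    unfolding cofinal_map_def F
  proof (intro conjI ballI)
    fix p assume "p \<in> Field P"
    then obtain q where q: "q \<in> Q" "(p, q) \<in> P" using cof by blast
    then have "above (Restr P Q) q \<subseteq> above P p" using transD[OF d(3)] by (auto simp: above_def)
    with q show "\<exists>q\<in>Q. (\<lambda>x. x) ` above (Restr P Q) q \<subseteq> above P p" by auto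
  qed (use Q' in auto)
qed

text \<open>
  Kelley's axioms for convergence of nets in a set. The axiom \<open>conv_local\<close> is the contrapositive
  of the usual one, that a net not converging to \<open>a\<close> has a subnet no subnet of which converges
  to \<open>a\<close>; the directed sets in question may be taken as cofinal subsets. The axiom
  \<open>conv_iterated\<close> asks for some diagonal net only, without fixing its index set.
\<close>

locale convergence_class =
  fixes S :: "'u set" and conv :: "'u rel \<Rightarrow> ('u \<Rightarrow> 'u) \<Rightarrow> 'u \<Rightarrow> bool"
  assumes conv_in: "small_directed P \<Longrightarrow> conv P x a \<Longrightarrow> x \<in> Field P \<rightarrow> S \<and> a \<in> S"
    and conv_const: "small_directed P \<Longrightarrow> a \<in> S \<Longrightarrow> conv P (\<lambda>_. a) a"
    and conv_subnet: "\<lbrakk>small_directed P; small_directed R; cofinal_map R P h; conv P x a;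
      \<And>r. r \<in> Field R \<Longrightarrow> z r = x (h r)\<rbrakk> \<Longrightarrow> conv R z a"
    and conv_local: "\<lbrakk>small_directed P; x \<in> Field P \<rightarrow> S; a \<in> S;
      \<And>Q. cofinal_subset P Q \<Longrightarrow> \<exists>R h. small_directed R \<and> cofinal_map R (Restr P Q) h \<and>
        conv R (\<lambda>r. x (h r)) a\<rbrakk> \<Longrightarrow> conv P x a"
    and conv_iterated: "\<lbrakk>small_directed P; conv P x a;
      \<And>p. p \<in> Field P \<Longrightarrow> small_directed (Q p) \<and> conv (Q p) (y p) (x p)\<rbrakk> \<Longrightarrow>
      \<exists>R k h. small_directed R \<and> cofinal_map R P k \<and> (\<forall>r\<in>Field R. h r \<in> Field (Q (k r))) \<and>
        conv R (\<lambda>r. y (k r) (h r)) a"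
begin

definition conv_topology :: "'u topology" where
  "conv_topology = topology (\<lambda>W. W \<subseteq> S \<and>
     (\<forall>P x a. small_directed P \<longrightarrow> conv P x a \<longrightarrow> a \<in> W \<longrightarrow> (\<exists>p\<in>Field P. x ` above P p \<subseteq> W)))"

lemma openin_conv_topology: "openin conv_topology W \<longleftrightarrow> W \<subseteq> S \<and>
     (\<forall>P x a. small_directed P \<longrightarrow> conv P x a \<longrightarrow> a \<in> W \<longrightarrow> (\<exists>p\<in>Field P. x ` above P p \<subseteq> W))"
proof -
  have "istopology (\<lambda>W. W \<subseteq> S \<and>
     (\<forall>P x a. small_directed P \<longrightarrow> conv P x a \<longrightarrow> a \<in> W \<longrightarrow> (\<exists>p\<in>Field P. x ` above P p \<subseteq> W)))"
    (is "istopology ?O")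
    unfolding istopology_def
  proof (rule conjI; intro allI impI)
    fix V W assume V: "?O V" and W: "?O W"
    show "?O (V \<inter> W)"
    proof (intro conjI allI impI)
      fix P x a assume P: "small_directed P" and x: "conv P x a" and a: "a \<in> V \<inter> W"
      have dP: "directed P" using P by (simp add: small_directed_def)
      obtain p where p: "p \<in> Field P" "x ` above P p \<subseteq> V" using V P x a by blast
      obtain q where q: "q \<in> Field P" "x ` above P q \<subseteq> W" using W P x a by blast
      obtain r where r: "r \<in> Field P" "(p, r) \<in> P" "(q, r) \<in> P" using directedD(5)[OF dP p(1) q(1)] by blast
      then have "above P r \<subseteq> above P p \<inter> above P q"
        using transD[OF directedD(3)[OF dP]] by (auto simp: above_def)
      with r p q show "\<exists>p\<in>Field P. x ` above P p \<subseteq> V \<inter> W" by blast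
    qed (use V in blast)
  next
    fix \<K> assume K: "\<forall>W\<in>\<K>. ?O W"
    show "?O (\<Union>\<K>)"
    proof (intro conjI allI impI)
      fix P x a assume P: "small_directed P" and x: "conv P x a" and a: "a \<in> \<Union>\<K>"
      then obtain W where W: "W \<in> \<K>" "a \<in> W" by blast
      then obtain p where "p \<in> Field P" "x ` above P p \<subseteq> W" using K P x by blast
      with W show "\<exists>p\<in>Field P. x ` above P p \<subseteq> \<Union>\<K>" by blast
    qed (use K in blast)
  qed
  then show ?thesis by (simp add: conv_topology_def topology_inverse')
qed

lemma topspace_conv_topology [simp]: "topspace conv_topology = S"
proof
  show "topspace conv_topology \<subseteq> S"
    using openin_topspace[of conv_topology] unfolding openin_conv_topology by blast
  have "\<exists>p\<in>Field P. x ` above P p \<subseteq> S" if P: "small_directed P" and x: "conv P x a" for P x a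
  proof -
    have "Field P \<noteq> {}" using P directedD(2) by (auto simp: small_directed_def)
    then show ?thesis using conv_in[OF P x] above_Field[of P] by blast
  qed
  then have "openin conv_topology S" unfolding openin_conv_topology by blast
  then show "S \<subseteq> topspace conv_topology" by (rule openin_subset)
qed

definition limits :: "'u set \<Rightarrow> 'u set" where
  "limits A = {a. \<exists>P x. small_directed P \<and> x \<in> Field P \<rightarrow> A \<and> conv P x a}"

text \<open>
  A net in \<open>limits A\<close> is a net of limits of nets in \<open>A\<close>, and a diagonal net lies in \<open>A\<close>.
\<close>

lemma limits_idem: "limits (limits A) \<subseteq> limits A"
proof
  fix a assume "a \<in> limits (limits A)"
  then obtain P x where P: "small_directed P" and x: "x \<in> Field P \<rightarrow> limits A" and conv: "conv P x a"
    by (auto simp: limits_def)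
  from x have "\<forall>p\<in>Field P. \<exists>Q y. small_directed Q \<and> y \<in> Field Q \<rightarrow> A \<and> conv Q y (x p)"
    by (auto simp: limits_def)
  then obtain Q y where Q: "\<And>p. p \<in> Field P \<Longrightarrow> small_directed (Q p) \<and> conv (Q p) (y p) (x p)"
    and y: "\<And>p. p \<in> Field P \<Longrightarrow> y p \<in> Field (Q p) \<rightarrow> A" by metis
  from conv_iterated[OF P conv Q] obtain R k h where R: "small_directed R" "cofinal_map R P k"
    "\<forall>r\<in>Field R. h r \<in> Field (Q (k r))" "conv R (\<lambda>r. y (k r) (h r)) a" by blast
  have "(\<lambda>r. y (k r) (h r)) \<in> Field R \<rightarrow> A" using y R(2,3) by (fastforce simp: cofinal_map_def)
  with R show "a \<in> limits A" by (auto simp: limits_def)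
qed

text \<open>
  Otherwise a net converging to a point outside \<open>limits A\<close> would lie in \<open>limits A\<close> on a cofinal
  subset.
\<close>

lemma open_complement_limits: "openin conv_topology (S - limits A)"
  unfolding openin_conv_topology
proof (intro conjI allI impI)
  fix P x a assume P: "small_directed P" and x: "conv P x a" and a: "a \<in> S - limits A"
  show "\<exists>p\<in>Field P. x ` above P p \<subseteq> S - limits A"
  proof (rule ccontr)
    assume *: "\<not> (\<exists>p\<in>Field P. x ` above P p \<subseteq> S - limits A)"
    let ?Q = "{q \<in> Field P. x q \<in> limits A}"
    have "\<exists>q\<in>?Q. (p, q) \<in> P" if p: "p \<in> Field P" for p
    proof -
      obtain q where q: "q \<in> above P p" "x q \<notin> S - limits A" using * p by blast
      then have "q \<in> Field P" using above_Field by fast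
      with q conv_in[OF P x] show ?thesis by (auto simp: above_def)
    qed
    then have cof: "cofinal_subset P ?Q" by (auto simp: cofinal_subset_def)
    note R = small_directed_Restr[OF P cof]
    have "conv (Restr P ?Q) x a" by (rule conv_subnet[OF P R x]) simp
    moreover have "x \<in> Field (Restr P ?Q) \<rightarrow> limits A" by (auto simp: Field_def)
    ultimately have "a \<in> limits (limits A)" using R(1) by (auto simp: limits_def)
    then show False using limits_idem a by blast
  qed
qed blast

text \<open>
  Kelley's theorem. Let \<open>x\<close> converge to \<open>a\<close> topologically and let \<open>Q\<close> be cofinal in \<open>P\<close>.
  For every \<open>q \<in> Q\<close> the point \<open>a\<close> is adherent to the tail of \<open>x\<close> at \<open>q\<close>, and hence a limit
  of some net in that tail. A diagonal net of these nets, regarded as an iterated limit of the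
  constant net \<open>a\<close>, is a subnet of \<open>x\<close> on \<open>Q\<close> that converges to \<open>a\<close>, so that
  \<open>conv_local\<close> applies.
\<close>

theorem conv_iff_topological:
  assumes P: "small_directed P"
  shows "conv P x a \<longleftrightarrow> x \<in> Field P \<rightarrow> S \<and> a \<in> S \<and>
    (\<forall>W. openin conv_topology W \<longrightarrow> a \<in> W \<longrightarrow> (\<exists>p\<in>Field P. x ` above P p \<subseteq> W))"
proof
  assume "conv P x a"
  then show "x \<in> Field P \<rightarrow> S \<and> a \<in> S \<and>
    (\<forall>W. openin conv_topology W \<longrightarrow> a \<in> W \<longrightarrow> (\<exists>p\<in>Field P. x ` above P p \<subseteq> W))"
    using conv_in[OF P] P by (auto simp: openin_conv_topology)
next
  assume "x \<in> Field P \<rightarrow> S \<and> a \<in> S \<and>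
    (\<forall>W. openin conv_topology W \<longrightarrow> a \<in> W \<longrightarrow> (\<exists>p\<in>Field P. x ` above P p \<subseteq> W))"
  then have x: "x \<in> Field P \<rightarrow> S" and a: "a \<in> S"
    and top: "\<And>W. openin conv_topology W \<Longrightarrow> a \<in> W \<Longrightarrow> \<exists>p\<in>Field P. x ` above P p \<subseteq> W"
    by auto
  have dP: "directed P" using P by (simp add: small_directed_def)
  show "conv P x a"
  proof (rule conv_local[OF P x a])
    fix Q assume cof: "cofinal_subset P Q"
    have QF: "Q \<subseteq> Field P" using cof by (simp add: cofinal_subset_def)
    have FQ: "Field (Restr P Q) = Q" by (rule Field_Restr[OF dP QF])
    note RQ = small_directed_Restr[OF P cof]
    let ?A = "\<lambda>q. x ` (above P q \<inter> Q)"
    have "a \<in> limits (?A q)" if q: "q \<in> Q" for q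
    proof (rule ccontr)
      assume "a \<notin> limits (?A q)"
      then obtain p where p: "p \<in> Field P" "x ` above P p \<subseteq> S - limits (?A q)"
        using top[OF open_complement_limits[of "?A q"]] a by blast
      obtain r where r: "r \<in> Field P" "(p, r) \<in> P" "(q, r) \<in> P"
        using directedD(5)[OF dP p(1), of q] q QF by blast
      then obtain s where s: "s \<in> Q" "(r, s) \<in> P" using cof by (auto simp: cofinal_subset_def)
      then have "s \<in> above P p" "s \<in> above P q \<inter> Q"
        using r transD[OF directedD(3)[OF dP]] by (auto simp: above_def)
      then have "x s \<in> ?A q" "x s \<notin> limits (?A q)" using p(2) by auto
      moreover have "conv P (\<lambda>_. x s) (x s)" using conv_const[OF P] x s QF by blast
      ultimately show False using P by (auto simp: limits_def)
    qed
    then have "\<forall>q\<in>Q. \<exists>E z. small_directed E \<and> z \<in> Field E \<rightarrow> ?A q \<and> conv E z a"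
      by (auto simp: limits_def)
    then obtain E z where E: "\<And>q. q \<in> Q \<Longrightarrow> small_directed (E q) \<and> conv (E q) (z q) a"
      and z: "\<And>q. q \<in> Q \<Longrightarrow> z q \<in> Field (E q) \<rightarrow> ?A q" by metis
    have "\<exists>R k h. small_directed R \<and> cofinal_map R (Restr P Q) k \<and>
        (\<forall>r\<in>Field R. h r \<in> Field (E (k r))) \<and> conv R (\<lambda>r. z (k r) (h r)) a"
      by (rule conv_iterated[OF RQ(1) conv_const[OF RQ(1) a]]) (simp add: FQ E)
    then obtain R k h where R: "small_directed R" and k: "cofinal_map R (Restr P Q) k"
      and h: "\<And>r. r \<in> Field R \<Longrightarrow> h r \<in> Field (E (k r))" and conv: "conv R (\<lambda>r. z (k r) (h r)) a"
      by blast
    have dR: "directed R" using R by (simp add: small_directed_def)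
    have kQ: "k r \<in> Q" if "r \<in> Field R" for r using k that FQ by (auto simp: cofinal_map_def)
    have "\<forall>r\<in>Field R. \<exists>g. g \<in> above P (k r) \<inter> Q \<and> z (k r) (h r) = x g"
      using z[OF kQ] h by blast
    then obtain g where g: "\<And>r. r \<in> Field R \<Longrightarrow> g r \<in> above P (k r) \<inter> Q"
      and zg: "\<And>r. r \<in> Field R \<Longrightarrow> z (k r) (h r) = x (g r)" by metis
    have "cofinal_map R (Restr P Q) g"
      unfolding cofinal_map_def FQ
    proof (intro conjI ballI)
      show "g \<in> Field R \<rightarrow> Q" using g by blast
      fix p assume p: "p \<in> Q"
      then obtain r where r: "r \<in> Field R" "k ` above R r \<subseteq> above (Restr P Q) p"
        using k FQ by (auto simp: cofinal_map_def)
      have "g s \<in> above (Restr P Q) p" if s: "s \<in> above R r" for s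
      proof -
        have sF: "s \<in> Field R" using s above_Field by fast
        then have "(p, k s) \<in> P" "(k s, g s) \<in> P" "g s \<in> Q" using r s g by (auto simp: above_def)
        then show ?thesis using p transD[OF directedD(3)[OF dP]] by (auto simp: above_def)
      qed
      with r show "\<exists>q\<in>Field R. g ` above R q \<subseteq> above (Restr P Q) p" by blast
    qed
    moreover have "conv R (\<lambda>r. x (g r)) a"
      by (rule conv_subnet[OF R R cofinal_map_id[OF dR] conv]) (simp add: zg)
    ultimately show "\<exists>R h. small_directed R \<and> cofinal_map R (Restr P Q) h \<and> conv R (\<lambda>r. x (h r)) a"
      using R by blast
  qed
qed

end

section \<open>The sketch and its representable models\<close>

lemma is_cocone_full_subcat:
  assumes K: "is_cocone C K" and V: "vertex K \<in> A"
    and D: "\<And>i. i \<in> Obj (shape K) \<Longrightarrow> ob_map (diagram K) i \<in> A" and A: "A \<subseteq> Obj C"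
  shows "is_cocone (full_subcat C A) K"
proof -
  have dia: "is_functor (shape K) C (diagram K)" using K by (simp add: is_cocone_iff)
  interpret J: category "shape K" using functor_cat[OF dia] by simp
  have "is_functor (shape K) (full_subcat C A) (diagram K)"
  proof (rule is_functorI)
    show "category (full_subcat C A)" by (rule category_full_subcat[OF functor_cat(2)[OF dia] A])
    show "ob_map (diagram K) \<in> extensional (Obj (shape K))"
      "arr_map (diagram K) \<in> extensional (Arr (shape K))"
      using dia by (auto simp: is_functor_def PiE_def)
    fix f a b assume f: "f \<in> Hom (shape K) a b"
    show "arr_map (diagram K) f
      \<in> Hom (full_subcat C A) (ob_map (diagram K) a) (ob_map (diagram K) b)"
      using functor_hom[OF dia f] D[OF Hom_Obj(1)[OF J.category_axioms f]]
        D[OF Hom_Obj(2)[OF J.category_axioms f]] by (simp add: Hom_full_subcat)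
    fix g c assume "g \<in> Hom (shape K) b c"
    then show "arr_map (diagram K) (Comp (shape K) g f) =
      Comp (full_subcat C A) (arr_map (diagram K) g) (arr_map (diagram K) f)"
      using functor_comp[OF dia f] by simp
  qed (use D functor_id[OF dia] J.category_axioms in auto)
  then show ?thesis using K V D unfolding is_cocone_iff by (simp add: Hom_full_subcat)
qed

type_synonym 'u space_arrow = "('u topology, 'u \<Rightarrow> 'u) arrow"

type_synonym 'u presheaf =
  "('u topology, 'u space_arrow, 'u set, ('u set, 'u \<Rightarrow> 'u) arrow) fctr"

text \<open>
  The spaces in the sketch serve to test other spaces by the continuous maps from them. Arrows of
  the underlying category of the sketch are continuous maps in the opposite direction.
\<close>

definition test_cat :: "('u topology, 'u space_arrow) cat" where
  "test_cat = op_cat (full_subcat (Top TYPE('u)) sketch_spaces)"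

definition sketch_cocones :: "'u top_cocone set" where
  "sketch_cocones = discrete_cocones \<union> net_cocones \<union> subnet_cocones \<union> iterated_cocones"

lemma top_sketch_sel [simp]:
  "under (top_sketch TYPE('u)) = (test_cat :: ('u topology, 'u space_arrow) cat)"
  "cones (top_sketch TYPE('u)) = op_cone ` (sketch_cocones :: 'u top_cocone set)"
  by (simp_all add: top_sketch_def test_cat_def sketch_cocones_def)

lemma test_cat_sel [simp]:
  "Obj (test_cat :: ('u topology, _) cat) = sketch_spaces" "Dom test_cat = tgt" "Cod test_cat = src"
  "Comp (test_cat :: ('u topology, 'u space_arrow) cat) g f = Comp (Top TYPE('u)) f g"
  "Id (test_cat :: ('u topology, 'u space_arrow) cat) X = Id (Top TYPE('u)) X"
  by (simp_all add: test_cat_def)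

lemma Hom_test_cat:
  "f \<in> Hom (test_cat :: ('u topology, 'u space_arrow) cat) X Y \<longleftrightarrow>
     X \<in> sketch_spaces \<and> Y \<in> sketch_spaces \<and> f \<in> Hom (Top TYPE('u)) Y X"
  by (auto simp: test_cat_def Hom_def)

text \<open>
  All objects of the diagrams of distinguished cocones are of these two kinds, so that a statement
  passes from them to all spaces of the sketch by one passage to a colimit.
\<close>

definition basic_spaces :: "'u topology set" where
  "basic_spaces = {discrete_topology I | I. small TYPE('u) I} \<union> {net_space P | P. small_directed P}"

lemma basic_in_sketch: "X \<in> basic_spaces \<Longrightarrow> X \<in> sketch_spaces"
  by (auto simp: basic_spaces_def sketch_spaces_def)

text \<open>
  The presheaf \<open>M\<close> is a copy of \<open>Hom(-,X)\<close> on the test spaces. In contrast to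
  \<open>represents\<close>, the space \<open>X\<close> need not belong to the sketch.
\<close>

definition presents :: "'u topology \<Rightarrow> 'u presheaf \<Rightarrow> ('u topology \<Rightarrow> 'u space_arrow \<Rightarrow> 'u) \<Rightarrow> bool" where
  "presents X M \<theta> \<longleftrightarrow> is_functor test_cat Set M \<and> small TYPE('u) (topspace X) \<and>
     (\<forall>B\<in>sketch_spaces. bij_betw (\<theta> B) (Hom (Top TYPE('u)) B X) (ob_map M B)) \<and>
     (\<forall>A\<in>sketch_spaces. \<forall>B\<in>sketch_spaces. \<forall>f\<in>Hom (Top TYPE('u)) A B. \<forall>u\<in>Hom (Top TYPE('u)) B X.
        \<theta> A (Comp (Top TYPE('u)) u f) = fn (arr_map M f) (\<theta> B u))"

lemma discrete_basic: "small TYPE('u) I \<Longrightarrow> discrete_topology (I :: 'u set) \<in> basic_spaces"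
  by (auto simp: basic_spaces_def)

lemma net_basic: "small_directed (P :: 'u rel) \<Longrightarrow> net_space P \<in> basic_spaces"
  by (auto simp: basic_spaces_def)

context
  assumes inacc: "inaccessible TYPE('u)"
begin

lemma one_basic: "(one_space :: 'u topology) \<in> basic_spaces"
  unfolding one_space_def by (intro discrete_basic small_finite[OF inacc]) simp

lemma sum_basic: "small_directed (P :: 'u rel) \<Longrightarrow> sum_space P \<in> basic_spaces"
  unfolding sum_space_def
  by (intro discrete_basic small_insert[OF inacc]) (simp add: small_directed_def)

lemma small_basic: "(X :: 'u topology) \<in> basic_spaces \<Longrightarrow> small TYPE('u) (topspace X)"
  by (auto simp: basic_spaces_def small_net_space(1)[OF inacc] simp del: topspace_net_space)

lemma colimit_coproduct_cocone:
  assumes I: "small TYPE('u) (I :: 'u set)"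
  shows "colimit_cocone (Top TYPE('u)) (coproduct_cocone I)"
proof (rule colimit_cocone_TopI)
  let ?T = "Top TYPE('u)" and ?K = "coproduct_cocone I" and ?J = "discrete_on (Point ` I)"
  have one: "small TYPE('u) (topspace (one_space :: 'u topology))" by (rule small_basic[OF one_basic])
  have J: "shape ?K = ?J" and V: "vertex ?K = discrete_topology I"
    by (simp_all add: coproduct_cocone_def)
  have D: "ob_map (diagram ?K) x = one_space" if "x \<in> Leg ` Point ` I" for x
    using that by (simp add: coproduct_cocone_def)
  have A: "arr_map (diagram ?K) u = Id ?T one_space" if "u \<in> Arr ?J" for u
    using that by (simp add: coproduct_cocone_def)
  have L: "leg ?K (Leg (Point i)) = point i (discrete_topology I)" if "i \<in> I" for i
    using that by (simp add: coproduct_cocone_def)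
  have idone: "Id ?T one_space \<in> Hom ?T one_space one_space"
    by (rule category.id_hom[OF category_Top]) (use one in simp)
  have HomJ: "f = Ident x \<and> y = x \<and> x \<in> Leg ` Point ` I" if "f \<in> Hom ?J x y" for f x y
    using that by (auto simp: Hom_def Arr_discrete_on)
  show "is_cocone ?T ?K"
  proof (rule cocone_TopI)
    show "is_functor (shape ?K) ?T (diagram ?K)"
      unfolding J
    proof (rule is_functorI)
      show "arr_map (diagram ?K) f \<in> Hom ?T (ob_map (diagram ?K) x) (ob_map (diagram ?K) y)"
        if f: "f \<in> Hom ?J x y" for f x y
        using HomJ[OF f] D A[OF Hom_Arr[OF f]] idone by (simp del: Top_sel)
      show "arr_map (diagram ?K) (Comp ?J g f) = Comp ?T (arr_map (diagram ?K) g) (arr_map (diagram ?K) f)"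
        if f: "f \<in> Hom ?J x y" and g: "g \<in> Hom ?J y z" for f g x y z
      proof -
        have "Comp ?J g f = g" using HomJ[OF f] by simp
        then show ?thesis
          using A[OF Hom_Arr[OF f]] A[OF Hom_Arr[OF g]] category.id_left[OF category_Top idone]
          by (simp del: Top_sel)
      qed
      show "ob_map (diagram ?K) x \<in> Obj ?T" if "x \<in> Obj ?J" for x
        using that D one by simp
      show "arr_map (diagram ?K) (Id ?J x) = Id ?T (ob_map (diagram ?K) x)" if "x \<in> Obj ?J" for x
        using that D A[of "Ident x"] by (simp add: Arr_discrete_on del: Top_sel)
      show "ob_map (diagram ?K) \<in> extensional (Obj ?J)" "arr_map (diagram ?K) \<in> extensional (Arr ?J)"
        by (simp_all add: coproduct_cocone_def)
    qed (rule category_discrete_on category_Top)+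
    show "leg ?K x \<in> Hom ?T (ob_map (diagram ?K) x) (vertex ?K)" if "x \<in> Obj (shape ?K)" for x
      using that D L V J point_hom[OF inacc, of "discrete_topology I"] I by auto
    show "leg ?K \<in> extensional (Obj (shape ?K))" by (simp add: coproduct_cocone_def)
    show "small TYPE('u) (topspace (vertex ?K))" using I V by simp
    fix u x assume u: "u \<in> Arr (shape ?K)" and x: "x \<in> topspace (ob_map (diagram ?K) (Dom (shape ?K) u))"
    then show "fn (leg ?K (Cod (shape ?K) u)) (fn (arr_map (diagram ?K) u) x) = fn (leg ?K (Dom (shape ?K) u)) x"
      unfolding J using A[of u] D by (auto simp: Arr_discrete_on)
  qed
  show "\<exists>i\<in>Obj (shape ?K). \<exists>x\<in>topspace (ob_map (diagram ?K) i). y = fn (leg ?K i) x"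
    if "y \<in> topspace (vertex ?K)" for y
    using that J V D L by (intro bexI[of _ "Leg (Point y)"] bexI[of _ undefined]) auto
  show "openin (vertex ?K) W" if "W \<subseteq> topspace (vertex ?K)" for W
    using that V by simp
  fix g :: "'u key span_ob \<Rightarrow> 'u \<Rightarrow> 'u"
  show "\<exists>t. \<forall>i\<in>Obj (shape ?K). \<forall>x\<in>topspace (ob_map (diagram ?K) i). t (fn (leg ?K i) x) = g i x"
    using J D L by (intro exI[of _ "\<lambda>y. g (Leg (Point y)) undefined"]) auto
qed

lemma sketch_cocone_cases:
  assumes K: "(K :: 'u top_cocone) \<in> sketch_cocones"
  shows "colimit_cocone (Top TYPE('u)) K" "small_category TYPE('u) (shape K)"
    "vertex K \<in> sketch_spaces" "\<And>i. i \<in> Obj (shape K) \<Longrightarrow> ob_map (diagram K) i \<in> basic_spaces"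
proof -
  have "colimit_cocone (Top TYPE('u)) K \<and> small_category TYPE('u) (shape K) \<and> vertex K \<in> sketch_spaces
    \<and> (\<forall>i\<in>Obj (shape K). ob_map (diagram K) i \<in> basic_spaces)"
    using K unfolding sketch_cocones_def
  proof (elim UnE)
    assume "K \<in> discrete_cocones"
    then obtain I where I: "small TYPE('u) I" "K = coproduct_cocone I" by (auto simp: discrete_cocones_def)
    have "colimit_cocone (Top TYPE('u)) K" using I colimit_coproduct_cocone by simp
    moreover have "small_category TYPE('u) (shape K)"
      using I by (simp add: coproduct_cocone_def small_category_discrete_on small_image)
    moreover have "vertex K \<in> sketch_spaces"
      using I basic_in_sketch[OF discrete_basic] by (simp add: coproduct_cocone_def)
    ultimately show ?thesis using I one_basic by (simp add: coproduct_cocone_def)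
  next
    assume "K \<in> net_cocones"
    then obtain P where P: "small_directed P" "K = epi_cocone (sum_to_net P)" by (auto simp: net_cocones_def)
    have "colimit_cocone (Top TYPE('u)) K"
      using P colimit_epi_cocone[OF sum_to_net_hom[OF inacc P(1)]] by auto
    moreover have "small_category TYPE('u) (shape K)"
      using P by (simp add: epi_cocone_def small_category_spans_on[OF inacc] small_finite[OF inacc])
    moreover have "vertex K \<in> sketch_spaces"
      using P basic_in_sketch[OF net_basic] by (simp add: epi_cocone_def)
    ultimately show ?thesis
      using P net_basic[OF P(1)] sum_basic by (auto simp: epi_cocone_def)
  next
    assume K: "K \<in> subnet_cocones"
    then obtain P R h where P: "small_directed P"
      and R: "\<And>Q. cofinal_subset P Q \<Longrightarrow> small_directed (R Q)"
      and J: "shape K = spans_on (Subset ` {Q. cofinal_subset P Q})"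
      and D: "diagram K = span_diagram (Top TYPE('u)) (Subset ` {Q. cofinal_subset P Q}) (sum_space P)
       (\<lambda>k. case k of Subset Q \<Rightarrow> sum_to_net (R Q))
       (\<lambda>k. case k of Subset Q \<Rightarrow> sum_to_sum (R Q) (h Q) P)"
      and col: "colimit_cocone (Top TYPE('u)) K"
      unfolding subnet_cocones_def by blast
    have "small TYPE('u) (Pow (Field P))" using small_Pow[OF inacc, of "Field P"] P by (simp add: small_directed_def)
    moreover have "{Q. cofinal_subset P Q} \<subseteq> Pow (Field P)" by (auto simp: cofinal_subset_def)
    ultimately have "small TYPE('u) {Q. cofinal_subset P Q}" by (rule small_subset)
    then have "small_category TYPE('u) (shape K)"
      using J by (simp add: small_category_spans_on[OF inacc] small_image)
    moreover have "vertex K \<in> sketch_spaces" using K by (simp add: sketch_spaces_def)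
    ultimately show ?thesis
      using col P R net_basic[OF R] sum_basic unfolding J D by auto
  next
    assume K: "K \<in> iterated_cocones"
    then obtain P Q where P: "small_directed P"
      and Q: "\<And>p. p \<in> Field P \<Longrightarrow> small_directed (Q p)"
      and J: "shape K = spans_on (Point ` Field P)"
      and D: "diagram K = span_diagram (Top TYPE('u)) (Point ` Field P) (net_space P)
       (\<lambda>k. case k of Point p \<Rightarrow> point (infpt (Q p)) (net_space (Q p)))
       (\<lambda>k. case k of Point p \<Rightarrow> point p (net_space P))"
      and col: "colimit_cocone (Top TYPE('u)) K"
      unfolding iterated_cocones_def by blast
    have "small_category TYPE('u) (shape K)"
      using J P by (simp add: small_category_spans_on[OF inacc] small_image small_directed_def)
    moreover have "vertex K \<in> sketch_spaces" using K by (simp add: sketch_spaces_def)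
    ultimately show ?thesis
      using col P net_basic[OF P] net_basic[OF Q] one_basic unfolding J D by auto
  qed
  then show "colimit_cocone (Top TYPE('u)) K" "small_category TYPE('u) (shape K)"
    "vertex K \<in> sketch_spaces" "\<And>i. i \<in> Obj (shape K) \<Longrightarrow> ob_map (diagram K) i \<in> basic_spaces"
    by auto
qed

lemma sketch_space_cases:
  assumes "(B :: 'u topology) \<in> sketch_spaces"
  obtains "B \<in> basic_spaces" | K where "K \<in> sketch_cocones" "vertex K = B"
  using assms unfolding sketch_spaces_def basic_spaces_def sketch_cocones_def by blast

lemma small_sketch_space: "(B :: 'u topology) \<in> sketch_spaces \<Longrightarrow> small TYPE('u) (topspace B)"
  by (erule sketch_space_cases)
    (use small_basic sketch_cocone_cases(1) in \<open>auto simp: colimit_cocone_iff is_cocone_iff\<close>)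

lemma category_test_cat: "category (test_cat :: ('u topology, 'u space_arrow) cat)"
  unfolding test_cat_def
  by (intro category_op_cat category_full_subcat category_Top) (auto simp: small_sketch_space)

lemma is_cone_test_cat:
  assumes "(K :: 'u top_cocone) \<in> sketch_cocones"
  shows "is_cone test_cat (op_cone K)"
proof -
  have "is_cocone (full_subcat (Top TYPE('u)) sketch_spaces) K"
    by (rule is_cocone_full_subcat)
      (use sketch_cocone_cases[OF assms] basic_in_sketch small_sketch_space in
        \<open>auto simp: colimit_cocone_iff\<close>)
  then show ?thesis unfolding is_cocone_def test_cat_def .
qed

lemma small_Hom_Top: "small TYPE('u) (Hom (Top TYPE('u)) X Y)"
proof (cases "small TYPE('u) (topspace X) \<and> small TYPE('u) (topspace Y)")
  case True
  have "Hom (Top TYPE('u)) X Y \<subseteq> (\<lambda>g. Arrow X g Y) ` (topspace X \<rightarrow>\<^sub>E topspace Y)"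
  proof
    fix f assume f: "f \<in> Hom (Top TYPE('u)) X Y"
    then have "f = Arrow X (fn f) Y" by (cases f) (simp add: Hom_Top)
    with Hom_Top_PiE[OF f] show "f \<in> (\<lambda>g. Arrow X g Y) ` (topspace X \<rightarrow>\<^sub>E topspace Y)" by blast
  qed
  then show ?thesis
    by (rule small_subset[OF small_image[OF small_PiE[OF inacc]], rotated 2]) (use True in auto)
next
  case False
  then have "Hom (Top TYPE('u)) X Y = {}" by (auto simp: Hom_Top)
  then show ?thesis by (simp add: small_finite[OF inacc])
qed

theorem limit_sketch_top_sketch: "limit_sketch TYPE('u) (top_sketch TYPE('u))"
proof -
  have "small TYPE('u) (Hom (test_cat :: ('u topology, 'u space_arrow) cat) X Y)" for X Y
    by (rule small_subset[OF small_Hom_Top[of Y X]]) (auto simp: Hom_test_cat)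
  moreover have "small_category TYPE('u) (op_cat (shape K))" if "(K :: 'u top_cocone) \<in> sketch_cocones" for K
    using sketch_cocone_cases(2)[OF that] by (simp add: small_category_def category_op_cat)
  ultimately show ?thesis
    unfolding limit_sketch_def
    using category_test_cat is_cone_test_cat by (auto simp: locally_small_def)
qed

text \<open>
  There are as many one-point discrete spaces as elements of the universe.
\<close>

theorem large_top_sketch: "large_sketch TYPE('u) (top_sketch TYPE('u))"
proof
  assume "small_sketch TYPE('u) (top_sketch TYPE('u))"
  then have "small TYPE('u) (sketch_spaces :: 'u topology set)"
    by (simp add: small_sketch_def small_category_def)
  moreover have "(\<lambda>x :: 'u. discrete_topology {x}) ` UNIV \<subseteq> sketch_spaces"
  proof clarify
    fix x :: 'u
    have "small TYPE('u) {x}" by (rule small_finite[OF inacc]) simp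
    then show "discrete_topology {x} \<in> sketch_spaces" by (rule basic_in_sketch[OF discrete_basic])
  qed
  ultimately have "small TYPE('u) ((\<lambda>x :: 'u. discrete_topology {x}) ` UNIV)" by (rule small_subset)
  moreover have "inj (\<lambda>x :: 'u. discrete_topology {x})"
    by (rule injI) (metis singletonD singletonI topspace_discrete_topology)
  ultimately have "small TYPE('u) (UNIV :: 'u set)" by (metis small_inj)
  then show False using small_fresh by auto
qed

lemma presents_iff_represents:
  fixes X :: "'u topology"
  assumes X: "X \<in> sketch_spaces"
  shows "represents test_cat X M \<longleftrightarrow> (\<exists>\<theta>. presents X M \<theta>)"
proof -
  have H: "Hom test_cat X B = Hom (Top TYPE('u)) B X" if "B \<in> sketch_spaces" for B
    using X that by (auto simp: Hom_test_cat)
  have Arr: "f \<in> Arr test_cat \<longleftrightarrow> src f \<in> sketch_spaces \<and> tgt f \<in> sketch_spaces \<and>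
     f \<in> Hom (Top TYPE('u)) (src f) (tgt f)" for f :: "'u space_arrow"
    using Hom_test_cat[of f "tgt f" "src f"] by (auto simp: Hom_def)
  have nat_iff: "(\<forall>f\<in>Arr test_cat. \<forall>g\<in>Hom test_cat X (tgt f).
          \<theta> (src f) (Comp (Top TYPE('u)) g f) = fn (arr_map M f) (\<theta> (tgt f) g)) \<longleftrightarrow>
        (\<forall>A\<in>sketch_spaces. \<forall>B\<in>sketch_spaces. \<forall>f\<in>Hom (Top TYPE('u)) A B. \<forall>u\<in>Hom (Top TYPE('u)) B X.
          \<theta> A (Comp (Top TYPE('u)) u f) = fn (arr_map M f) (\<theta> B u))"
    (is "?L \<longleftrightarrow> ?R") for \<theta>
  proof
    assume l: ?L
    show ?R
    proof (intro ballI)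
      fix A B f u assume *: "A \<in> sketch_spaces" "B \<in> sketch_spaces"
        "f \<in> Hom (Top TYPE('u)) A B" "u \<in> Hom (Top TYPE('u)) B X"
      then have f: "src f = A" "tgt f = B" by (auto simp: Hom_Top)
      have "f \<in> Arr test_cat" unfolding Arr f using * by blast
      moreover have "u \<in> Hom test_cat X (tgt f)" unfolding f H[OF *(2)] by (rule *)
      ultimately show "\<theta> A (Comp (Top TYPE('u)) u f) = fn (arr_map M f) (\<theta> B u)"
        using l f by blast
    qed
  next
    assume r: ?R
    show ?L
    proof (intro ballI)
      fix f :: "'u space_arrow" and g assume f: "f \<in> Arr test_cat" and g: "g \<in> Hom test_cat X (tgt f)"
      have "src f \<in> sketch_spaces" "tgt f \<in> sketch_spaces" "f \<in> Hom (Top TYPE('u)) (src f) (tgt f)"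
        using f unfolding Arr by blast+
      moreover have "g \<in> Hom (Top TYPE('u)) (tgt f) X" using g H[OF calculation(2)] by simp
      ultimately show "\<theta> (src f) (Comp (Top TYPE('u)) g f) = fn (arr_map M f) (\<theta> (tgt f) g)"
        using r by blast
    qed
  qed
  have bij_iff: "(\<forall>B\<in>sketch_spaces. bij_betw (\<theta> B) (Hom test_cat X B) (ob_map M B)) \<longleftrightarrow>
      (\<forall>B\<in>sketch_spaces. bij_betw (\<theta> B) (Hom (Top TYPE('u)) B X) (ob_map M B))" for \<theta>
    using H by (intro ball_cong refl) simp
  show ?thesis
    unfolding represents_def presents_def test_cat_sel bij_iff nat_iff
    using X small_sketch_space[OF X] by blast
qed

context
  fixes M :: "'u presheaf"
  assumes M: "is_functor test_cat Set M"
begin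

lemma presheaf_small: "B \<in> sketch_spaces \<Longrightarrow> small TYPE('u) (ob_map M B)"
  using functor_ob[OF M, of B] by simp

lemma presheaf_hom:
  "A \<in> sketch_spaces \<Longrightarrow> B \<in> sketch_spaces \<Longrightarrow> f \<in> Hom (Top TYPE('u)) A B \<Longrightarrow>
     arr_map M f \<in> Hom Set (ob_map M B) (ob_map M A)"
  using functor_hom[OF M, of f B A] by (simp add: Hom_test_cat)

lemma presheaf_mem:
  "A \<in> sketch_spaces \<Longrightarrow> B \<in> sketch_spaces \<Longrightarrow> f \<in> Hom (Top TYPE('u)) A B \<Longrightarrow> m \<in> ob_map M B \<Longrightarrow>
     fn (arr_map M f) m \<in> ob_map M A"
  using presheaf_hom[of A B f] by (auto simp: Hom_Set)

lemma presheaf_comp: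
  assumes "A \<in> sketch_spaces" "B \<in> sketch_spaces" "C \<in> sketch_spaces"
    and f: "f \<in> Hom (Top TYPE('u)) A B" and g: "g \<in> Hom (Top TYPE('u)) B C" and m: "m \<in> ob_map M C"
  shows "fn (arr_map M (Comp (Top TYPE('u)) g f)) m = fn (arr_map M f) (fn (arr_map M g) m)"
proof -
  have "arr_map M (Comp (Top TYPE('u)) g f) = Comp Set (arr_map M f) (arr_map M g)"
    using functor_comp[OF M, of g C B f A] assms by (simp add: Hom_test_cat)
  then show ?thesis using presheaf_hom[OF assms(2,3) g] m by (simp add: Hom_Set compose_def)
qed

lemma presheaf_id:
  "B \<in> sketch_spaces \<Longrightarrow> m \<in> ob_map M B \<Longrightarrow> fn (arr_map M (Id (Top TYPE('u)) B)) m = m"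
  using functor_id[OF M, of B] by (simp del: Top_sel)

lemma limit_cone_presheaf_iff:
  assumes K: "K \<in> sketch_cocones"
  shows "limit_cone Set (map_cone M (op_cone K)) \<longleftrightarrow>
    (\<forall>x. (\<forall>i\<in>Obj (shape K). x i \<in> ob_map M (ob_map (diagram K) i)) \<longrightarrow>
       (\<forall>u\<in>Arr (shape K). fn (arr_map M (arr_map (diagram K) u)) (x (Cod (shape K) u)) = x (Dom (shape K) u)) \<longrightarrow>
       (\<exists>!v. v \<in> ob_map M (vertex K) \<and> (\<forall>i\<in>Obj (shape K). fn (arr_map M (leg K i)) v = x i)))"
proof -
  have "is_cone Set (map_cone M (op_cone K))"
    by (rule is_cone_map[OF M is_cone_test_cat[OF K]])
  from limit_cone_Set_iff[OF inacc this] show ?thesis by simp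
qed

end

lemma model_presheaf: "model (top_sketch TYPE('u)) (M :: 'u presheaf) \<Longrightarrow> is_functor test_cat Set M"
  by (simp add: model_def)

text \<open>
  Distinguished cocones are colimits in Top, and \<open>Hom(-,X)\<close> takes colimits to limits.
\<close>

lemma presents_model:
  assumes pr: "presents X M \<theta>"
  shows "model (top_sketch TYPE('u)) M"
proof -
  let ?T = "Top TYPE('u)"
  have M: "is_functor test_cat Set M" and X: "small TYPE('u) (topspace X)"
    and bij: "\<And>B. B \<in> sketch_spaces \<Longrightarrow> bij_betw (\<theta> B) (Hom ?T B X) (ob_map M B)"
    and nat: "\<And>A B f u. A \<in> sketch_spaces \<Longrightarrow> B \<in> sketch_spaces \<Longrightarrow> f \<in> Hom ?T A B \<Longrightarrow>
      u \<in> Hom ?T B X \<Longrightarrow> \<theta> A (Comp ?T u f) = fn (arr_map M f) (\<theta> B u)"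
    using pr by (auto simp: presents_def)
  have inj: "u = v" if "B \<in> sketch_spaces" "u \<in> Hom ?T B X" "v \<in> Hom ?T B X" "\<theta> B u = \<theta> B v" for B u v
    using bij[OF that(1)] that by (auto simp: bij_betw_def dest: inj_onD)
  have "limit_cone Set (map_cone M (op_cone K))" if K: "K \<in> sketch_cocones" for K :: "'u top_cocone"
    unfolding limit_cone_presheaf_iff[OF M K]
  proof (intro allI impI)
    let ?J = "shape K" and ?D = "ob_map (diagram K)" and ?V = "vertex K"
    fix x assume x: "\<forall>i\<in>Obj ?J. x i \<in> ob_map M (?D i)"
      and compat: "\<forall>u\<in>Arr ?J. fn (arr_map M (arr_map (diagram K) u)) (x (Cod ?J u)) = x (Dom ?J u)"
    note kc = sketch_cocone_cases[OF K]
    have cK: "is_cocone ?T K"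
      and univ: "\<And>L. \<lbrakk>is_cocone ?T L; shape L = ?J; diagram L = diagram K\<rbrakk> \<Longrightarrow>
        \<exists>!t. t \<in> Hom ?T ?V (vertex L) \<and> (\<forall>i\<in>Obj ?J. Comp ?T t (leg K i) = leg L i)"
      using kc(1) unfolding colimit_cocone_iff by auto
    interpret J: category ?J by (rule cocone_TopD(4)[OF cK])
    have Dsk: "?D i \<in> sketch_spaces" if "i \<in> Obj ?J" for i by (rule basic_in_sketch[OF kc(4)[OF that]])
    note leg = cocone_TopD(2)[OF cK] and Du = cocone_TopD(5)[OF cK]
    have "\<exists>s. s \<in> Hom ?T (?D i) X \<and> \<theta> (?D i) s = x i" if i: "i \<in> Obj ?J" for i
    proof -
      have "x i \<in> \<theta> (?D i) ` Hom ?T (?D i) X"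
        using bij_betw_imp_surj_on[OF bij[OF Dsk[OF i]]] x i by simp
      then obtain s where "x i = \<theta> (?D i) s" "s \<in> Hom ?T (?D i) X" by (rule imageE)
      then show ?thesis by (intro exI[of _ s]) simp
    qed
    then obtain s where s: "\<And>i. i \<in> Obj ?J \<Longrightarrow> s i \<in> Hom ?T (?D i) X"
      and \<theta>s: "\<And>i. i \<in> Obj ?J \<Longrightarrow> \<theta> (?D i) (s i) = x i" by metis
    let ?L = "\<lparr>shape = ?J, diagram = diagram K, vertex = X, leg = (\<lambda>i\<in>Obj ?J. s i)\<rparr>"
    have "Comp ?T (s (Cod ?J u)) (arr_map (diagram K) u) = s (Dom ?J u)" if u: "u \<in> Arr ?J" for u
    proof (rule inj[OF Dsk])
      note d = J.dom_cod[OF u]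
      show "Comp ?T (s (Cod ?J u)) (arr_map (diagram K) u) \<in> Hom ?T (?D (Dom ?J u)) X"
        by (rule category.comp_hom[OF category_Top Du[OF u] s]) (use d in blast)
      show "\<theta> (?D (Dom ?J u)) (Comp ?T (s (Cod ?J u)) (arr_map (diagram K) u)) = \<theta> (?D (Dom ?J u)) (s (Dom ?J u))"
        using nat[OF Dsk Dsk Du[OF u] s] d \<theta>s compat u by simp
    qed (use J.dom_cod[OF u] s in auto)
    then have "is_cocone ?T ?L"
      using cocone_TopD(1)[OF cK] X s J.dom_cod unfolding is_cocone_iff by simp
    then have "\<exists>!t. t \<in> Hom ?T ?V X \<and> (\<forall>i\<in>Obj ?J. Comp ?T t (leg K i) = s i)"
      using univ[of ?L] by simp
    then obtain t where t: "t \<in> Hom ?T ?V X" and tl: "\<And>i. i \<in> Obj ?J \<Longrightarrow> Comp ?T t (leg K i) = s i"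
      and uniq: "\<And>t'. t' \<in> Hom ?T ?V X \<Longrightarrow> (\<And>i. i \<in> Obj ?J \<Longrightarrow> Comp ?T t' (leg K i) = s i) \<Longrightarrow> t' = t"
      by blast
    show "\<exists>!v. v \<in> ob_map M ?V \<and> (\<forall>i\<in>Obj ?J. fn (arr_map M (leg K i)) v = x i)"
    proof (rule ex1I[of _ "\<theta> ?V t"])
      show "\<theta> ?V t \<in> ob_map M ?V \<and> (\<forall>i\<in>Obj ?J. fn (arr_map M (leg K i)) (\<theta> ?V t) = x i)"
      proof (intro conjI ballI)
        show "\<theta> ?V t \<in> ob_map M ?V" by (rule bij_betw_apply[OF bij[OF kc(3)] t])
        show "fn (arr_map M (leg K i)) (\<theta> ?V t) = x i" if "i \<in> Obj ?J" for i
          using nat[OF Dsk[OF that] kc(3) leg[OF that] t] tl[OF that] \<theta>s[OF that] by simp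
      qed
      fix v assume v: "v \<in> ob_map M ?V \<and> (\<forall>i\<in>Obj ?J. fn (arr_map M (leg K i)) v = x i)"
      then have "v \<in> \<theta> ?V ` Hom ?T ?V X" using bij_betw_imp_surj_on[OF bij[OF kc(3)]] by simp
      then obtain t' where t': "v = \<theta> ?V t'" "t' \<in> Hom ?T ?V X" by (rule imageE)
      have "t' = t"
      proof (rule uniq[OF t'(2)])
        fix i assume i: "i \<in> Obj ?J"
        show "Comp ?T t' (leg K i) = s i"
          using inj[OF Dsk[OF i] category.comp_hom[OF category_Top leg[OF i] t'(2)] s[OF i]]
            nat[OF Dsk[OF i] kc(3) leg[OF i] t'(2)] v t'(1) \<theta>s i by simp
      qed
      with t' show "v = \<theta> ?V t" by simp
    qed
  qed
  with M show ?thesis by (simp add: model_def)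
qed

theorem realized_top_sketch: "realized TYPE('u) (top_sketch TYPE('u))"
  unfolding realized_def using presents_iff_represents presents_model by auto

end

section \<open>Models are spaces\<close>

lemma continuous_cofinal_map:
  assumes R: "small_directed (R :: 'u rel)" and P: "small_directed P" and h: "cofinal_map R P h"
  shows "continuous_map (net_space R) (net_space P) (limit_extend R h (infpt P))"
  unfolding continuous_limit_extend[OF R]
proof (intro conjI allI impI)
  show "h ` Field R \<subseteq> topspace (net_space P)" using h P by (auto simp: cofinal_map_def)
  show "infpt P \<in> topspace (net_space P)" using P by simp
  fix W assume W: "openin (net_space P) W" "infpt P \<in> W"
  have "directed P" using P by (simp add: small_directed_def)
  then obtain p where p: "p \<in> Field P" "above P p \<subseteq> W" using W openin_net_space by blast
  then obtain r where "r \<in> Field R" "h ` above R r \<subseteq> above P p" using h by (auto simp: cofinal_map_def)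
  with p show "\<exists>r\<in>Field R. h ` above R r \<subseteq> W" by blast
qed

text \<open>
  An element of \<open>M B\<close> should be a continuous map from \<open>B\<close>; this is its underlying function,
  which takes a point \<open>b : 1 \<rightarrow> B\<close> to the restriction of the element along \<open>b\<close>.
\<close>

definition evaluation :: "'u presheaf \<Rightarrow> 'u topology \<Rightarrow> 'u \<Rightarrow> 'u \<Rightarrow> 'u" where
  "evaluation M B m = (\<lambda>b\<in>topspace B. fn (arr_map M (point b B)) m)"

text \<open>
  For a copy of \<open>Hom(-,X)\<close> with \<open>X\<close> on the set \<open>M 1\<close> these are the continuous maps \<open>B \<rightarrow> X\<close>.
\<close>

definition traces :: "'u presheaf \<Rightarrow> 'u topology \<Rightarrow> ('u \<Rightarrow> 'u) set" where
  "traces M B = evaluation M B ` ob_map M B"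

text \<open>
  The convergence of nets in the set \<open>M 1\<close> that is read off from the values of \<open>M\<close> on the spaces
  \<open>P \<union> {\<infinity>}\<close>.
\<close>

definition model_conv :: "'u presheaf \<Rightarrow> 'u rel \<Rightarrow> ('u \<Rightarrow> 'u) \<Rightarrow> 'u \<Rightarrow> bool" where
  "model_conv M P x a \<longleftrightarrow> restrict (limit_extend P x a) (insert (infpt P) (Field P)) \<in> traces M (net_space P)"

context
  assumes inacc: "inaccessible TYPE('u)"
begin

lemma point_hom_sketch:
  "B \<in> sketch_spaces \<Longrightarrow> b \<in> topspace B \<Longrightarrow> point b B \<in> Hom (Top TYPE('u)) one_space B"
  by (rule point_hom[OF inacc small_sketch_space[OF inacc]])

lemma one_sketch: "(one_space :: 'u topology) \<in> sketch_spaces"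
  by (rule basic_in_sketch[OF one_basic[OF inacc]])

lemma Comp_point:
  assumes f: "f \<in> Hom (Top TYPE('u)) A B" and A: "A \<in> sketch_spaces" and B: "B \<in> sketch_spaces"
    and a: "a \<in> topspace A"
  shows "Comp (Top TYPE('u)) f (point a A) = point (fn f a) B"
  by (rule Hom_Top_eqI[OF category.comp_hom[OF category_Top point_hom_sketch[OF A a] f]
        point_hom_sketch[OF B Hom_Top_mem[OF f a]]])
    (use fn_Comp_Top[OF point_hom_sketch[OF A a]] in simp)

context
  fixes M :: "'u presheaf"
  assumes M: "is_functor test_cat Set M"
begin

lemma evaluation_mem:
  assumes "B \<in> sketch_spaces" "m \<in> ob_map M B"
  shows "evaluation M B m \<in> topspace B \<rightarrow>\<^sub>E ob_map M one_space"
  using presheaf_mem[OF inacc M one_sketch assms(1) point_hom_sketch[OF assms(1)] assms(2)]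
  by (simp add: evaluation_def)

lemma evaluation_natural:
  assumes A: "A \<in> sketch_spaces" and B: "B \<in> sketch_spaces" and f: "f \<in> Hom (Top TYPE('u)) A B"
    and m: "m \<in> ob_map M B" and a: "a \<in> topspace A"
  shows "evaluation M A (fn (arr_map M f) m) a = evaluation M B m (fn f a)"
  using presheaf_comp[OF inacc M one_sketch A B point_hom_sketch[OF A a] f m] Comp_point[OF f A B a] a
    Hom_Top_mem[OF f a]
  by (simp add: evaluation_def)

lemma evaluation_one:
  assumes "m \<in> ob_map M one_space"
  shows "evaluation M one_space m undefined = m"
proof -
  have "point undefined one_space = Id (Top TYPE('u)) (one_space :: 'u topology)"
    by (auto simp: point_def top_map_def)
  then show ?thesis
    using presheaf_id[OF inacc M one_sketch assms] by (simp add: evaluation_def del: Top_sel)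
qed

lemma traces_subset: "B \<in> sketch_spaces \<Longrightarrow> traces M B \<subseteq> topspace B \<rightarrow>\<^sub>E ob_map M one_space"
  using evaluation_mem by (auto simp: traces_def simp del: PiE_iff)

lemma traces_pullback:
  assumes A: "A \<in> sketch_spaces" and B: "B \<in> sketch_spaces"
    and f: "continuous_map A B f" and y: "y \<in> traces M B"
  shows "(\<lambda>a\<in>topspace A. y (f a)) \<in> traces M A"
proof -
  obtain m where m: "m \<in> ob_map M B" "y = evaluation M B m" using y by (auto simp: traces_def)
  let ?f = "top_map A f B"
  have F: "?f \<in> Hom (Top TYPE('u)) A B"
    by (rule top_map_hom[OF small_sketch_space[OF inacc A] small_sketch_space[OF inacc B] f])
  have "(\<lambda>a\<in>topspace A. y (f a)) = evaluation M A (fn (arr_map M ?f) m)"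
  proof (rule ext)
    fix a show "(\<lambda>a\<in>topspace A. y (f a)) a = evaluation M A (fn (arr_map M ?f) m) a"
    proof (cases "a \<in> topspace A")
      case True then show ?thesis using evaluation_natural[OF A B F m(1) True] m(2) by simp
    next
      case False then show ?thesis by (simp add: evaluation_def)
    qed
  qed
  then show ?thesis using presheaf_mem[OF inacc M A B F m(1)] by (simp add: traces_def)
qed

lemma traces_one: "traces M one_space = topspace one_space \<rightarrow>\<^sub>E ob_map M one_space"
proof
  show "traces M one_space \<subseteq> topspace one_space \<rightarrow>\<^sub>E ob_map M one_space"
    by (rule traces_subset[OF one_sketch])
  show "topspace one_space \<rightarrow>\<^sub>E ob_map M one_space \<subseteq> traces M one_space"
  proof
    fix y assume y: "y \<in> topspace (one_space :: 'u topology) \<rightarrow>\<^sub>E ob_map M one_space"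
    then have m: "y undefined \<in> ob_map M one_space" by auto
    have "y = evaluation M one_space (y undefined)"
      by (rule PiE_ext[OF y evaluation_mem[OF one_sketch m]]) (use evaluation_one[OF m] in simp)
    then show "y \<in> traces M one_space" using m unfolding traces_def by blast
  qed
qed

end

context
  fixes M :: "'u presheaf"
  assumes model: "model (top_sketch TYPE('u)) M"
begin

lemma model_functor: "is_functor test_cat Set M"
  by (rule model_presheaf[OF inacc model])

lemma model_limit:
  assumes K: "K \<in> sketch_cocones"
    and "\<And>i. i \<in> Obj (shape K) \<Longrightarrow> x i \<in> ob_map M (ob_map (diagram K) i)"
    and "\<And>u. u \<in> Arr (shape K) \<Longrightarrow>
      fn (arr_map M (arr_map (diagram K) u)) (x (Cod (shape K) u)) = x (Dom (shape K) u)"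
  shows "\<exists>!v. v \<in> ob_map M (vertex K) \<and> (\<forall>i\<in>Obj (shape K). fn (arr_map M (leg K i)) v = x i)"
proof -
  have "limit_cone Set (map_cone M (op_cone K))" using model K by (simp add: model_def)
  then show ?thesis
    unfolding limit_cone_presheaf_iff[OF inacc model_functor K] using assms(2,3) by blast
qed

lemma sketch_cocone_legs:
  assumes K: "K \<in> sketch_cocones"
  shows "is_cocone (Top TYPE('u)) K" "category (shape K)"
    "\<And>i. i \<in> Obj (shape K) \<Longrightarrow> ob_map (diagram K) i \<in> sketch_spaces"
    "\<And>i. i \<in> Obj (shape K) \<Longrightarrow> leg K i \<in> Hom (Top TYPE('u)) (ob_map (diagram K) i) (vertex K)"
    "\<And>u. u \<in> Arr (shape K) \<Longrightarrow> arr_map (diagram K) u \<in> Hom (Top TYPE('u))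
      (ob_map (diagram K) (Dom (shape K) u)) (ob_map (diagram K) (Cod (shape K) u))"
    "\<And>u m. u \<in> Arr (shape K) \<Longrightarrow> m \<in> ob_map M (vertex K) \<Longrightarrow>
      fn (arr_map M (arr_map (diagram K) u)) (fn (arr_map M (leg K (Cod (shape K) u))) m) =
      fn (arr_map M (leg K (Dom (shape K) u))) m"
proof -
  note kc = sketch_cocone_cases[OF inacc K]
  show cK: "is_cocone (Top TYPE('u)) K" using kc(1) by (simp add: colimit_cocone_iff)
  show J: "category (shape K)" by (rule cocone_TopD(4)[OF cK])
  show D: "ob_map (diagram K) i \<in> sketch_spaces" if "i \<in> Obj (shape K)" for i
    by (rule basic_in_sketch[OF kc(4)[OF that]])
  show leg: "leg K i \<in> Hom (Top TYPE('u)) (ob_map (diagram K) i) (vertex K)" if "i \<in> Obj (shape K)" for i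
    by (rule cocone_TopD(2)[OF cK that])
  show Du: "arr_map (diagram K) u \<in> Hom (Top TYPE('u))
      (ob_map (diagram K) (Dom (shape K) u)) (ob_map (diagram K) (Cod (shape K) u))"
    if "u \<in> Arr (shape K)" for u by (rule cocone_TopD(5)[OF cK that])
  fix u m assume u: "u \<in> Arr (shape K)" and m: "m \<in> ob_map M (vertex K)"
  note d = category.dom_cod[OF J u]
  have "Comp (Top TYPE('u)) (leg K (Cod (shape K) u)) (arr_map (diagram K) u) = leg K (Dom (shape K) u)"
    using cK u by (simp add: is_cocone_iff)
  then show "fn (arr_map M (arr_map (diagram K) u)) (fn (arr_map M (leg K (Cod (shape K) u))) m) =
      fn (arr_map M (leg K (Dom (shape K) u))) m"
    using presheaf_comp[OF inacc model_functor D D kc(3) Du[OF u] leg m] d by simp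
qed

lemma legs_jointly_injective:
  assumes K: "K \<in> sketch_cocones" and m: "m \<in> ob_map M (vertex K)" "m' \<in> ob_map M (vertex K)"
    and eq: "\<And>i. i \<in> Obj (shape K) \<Longrightarrow> fn (arr_map M (leg K i)) m = fn (arr_map M (leg K i)) m'"
  shows "m = m'"
proof -
  note k = sketch_cocone_legs[OF K] and V = sketch_cocone_cases(3)[OF inacc K]
  have "\<exists>!v. v \<in> ob_map M (vertex K) \<and>
      (\<forall>i\<in>Obj (shape K). fn (arr_map M (leg K i)) v = fn (arr_map M (leg K i)) m)"
    by (rule model_limit[OF K]) (use k(6) presheaf_mem[OF inacc model_functor k(3) V k(4)] m in auto)
  then show ?thesis using m eq by metis
qed

text \<open>
  An element of the limit \<open>M (vertex K)\<close> is determined by its components, and their evaluations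
  are composites of its evaluation with the legs.
\<close>

lemma evaluation_inj_vertex:
  assumes K: "K \<in> sketch_cocones"
    and inj: "\<And>i. i \<in> Obj (shape K) \<Longrightarrow>
      inj_on (evaluation M (ob_map (diagram K) i)) (ob_map M (ob_map (diagram K) i))"
  shows "inj_on (evaluation M (vertex K)) (ob_map M (vertex K))"
proof (rule inj_onI)
  fix m m' assume m: "m \<in> ob_map M (vertex K)" "m' \<in> ob_map M (vertex K)"
    and eq: "evaluation M (vertex K) m = evaluation M (vertex K) m'"
  note k = sketch_cocone_legs[OF K] and V = sketch_cocone_cases(3)[OF inacc K]
  show "m = m'"
  proof (rule legs_jointly_injective[OF K m])
    fix i assume i: "i \<in> Obj (shape K)"
    let ?D = "ob_map (diagram K) i"
    note mem = presheaf_mem[OF inacc model_functor k(3)[OF i] V k(4)[OF i]]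
    have "evaluation M ?D (fn (arr_map M (leg K i)) m) = evaluation M ?D (fn (arr_map M (leg K i)) m')"
      by (rule PiE_ext[OF evaluation_mem[OF model_functor k(3)[OF i] mem[OF m(1)]]
            evaluation_mem[OF model_functor k(3)[OF i] mem[OF m(2)]]])
        (use evaluation_natural[OF model_functor k(3)[OF i] V k(4)[OF i]] m eq in simp)
    then show "fn (arr_map M (leg K i)) m = fn (arr_map M (leg K i)) m'"
      using inj_onD[OF inj[OF i]] mem m by blast
  qed
qed

lemma evaluation_inj_one: "inj_on (evaluation M one_space) (ob_map M one_space)"
  by (rule inj_onI) (metis evaluation_one[OF model_functor])

lemma evaluation_inj_discrete:
  assumes I: "small TYPE('u) (I :: 'u set)"
  shows "inj_on (evaluation M (discrete_topology I)) (ob_map M (discrete_topology I))"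
proof -
  have "coproduct_cocone I \<in> sketch_cocones" using I by (auto simp: sketch_cocones_def discrete_cocones_def)
  from evaluation_inj_vertex[OF this] show ?thesis
    using evaluation_inj_one by (simp add: coproduct_cocone_def)
qed

text \<open>
  The epimorphism cocone forces restriction along \<open>P \<squnion> 1 \<rightarrow> P \<union> {\<infinity>}\<close> to be injective, and on the
  discrete space \<open>P \<squnion> 1\<close> evaluation is injective.
\<close>

lemma evaluation_inj_net:
  assumes P: "small_directed P"
  shows "inj_on (evaluation M (net_space P)) (ob_map M (net_space P))"
proof (rule inj_onI)
  let ?T = "Top TYPE('u)" and ?f = "sum_to_net P" and ?N = "net_space P" and ?K = "epi_cocone (sum_to_net P)"
  fix m m' assume m: "m \<in> ob_map M ?N" "m' \<in> ob_map M ?N"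
    and eq: "evaluation M ?N m = evaluation M ?N m'"
  have K: "?K \<in> sketch_cocones" using P by (auto simp: sketch_cocones_def net_cocones_def)
  have N: "?N \<in> sketch_spaces" by (rule basic_in_sketch[OF net_basic[OF P]])
  have S: "sum_space P \<in> sketch_spaces" by (rule basic_in_sketch[OF sum_basic[OF inacc P]])
  note f = sum_to_net_hom[OF inacc P]
  note mem = presheaf_mem[OF inacc model_functor S N f]
  have "small TYPE('u) (insert (infpt P) (Field P))"
    using P by (intro small_insert[OF inacc]) (simp add: small_directed_def)
  then have injS: "inj_on (evaluation M (sum_space P)) (ob_map M (sum_space P))"
    unfolding sum_space_def by (rule evaluation_inj_discrete)
  have "evaluation M (sum_space P) (fn (arr_map M ?f) m) = evaluation M (sum_space P) (fn (arr_map M ?f) m')"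
    by (rule PiE_ext[OF evaluation_mem[OF model_functor S mem[OF m(1)]] evaluation_mem[OF model_functor S mem[OF m(2)]]])
      (use evaluation_natural[OF model_functor S N f] m eq in simp)
  then have fm: "fn (arr_map M ?f) m = fn (arr_map M ?f) m'" using inj_onD[OF injS] mem m by blast
  \<comment> \<open>the two copies of the net space in the epimorphism cocone carry the two elements\<close>
  let ?x = "\<lambda>i. case i of Base \<Rightarrow> m | Apex _ \<Rightarrow> fn (arr_map M ?f) m | Leg _ \<Rightarrow> m'"
  have "\<exists>!v. v \<in> ob_map M (vertex ?K) \<and> (\<forall>i\<in>Obj (shape ?K). fn (arr_map M (leg ?K i)) v = ?x i)"
  proof (rule model_limit[OF K])
    show "?x i \<in> ob_map M (ob_map (diagram ?K) i)" if "i \<in> Obj (shape ?K)" for i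
      using that m mem[OF m(1)] by (auto simp: epi_cocone_def)
    show "fn (arr_map M (arr_map (diagram ?K) u)) (?x (Cod (shape ?K) u)) = ?x (Dom (shape ?K) u)"
      if "u \<in> Arr (shape ?K)" for u
      using that fm m mem[OF m(1)] presheaf_id[OF inacc model_functor N] presheaf_id[OF inacc model_functor S]
      by (auto simp: epi_cocone_def Arr_spans_on simp del: Top_sel(4))
  qed
  then obtain v where "v \<in> ob_map M (vertex ?K)"
    "\<forall>i\<in>Obj (shape ?K). fn (arr_map M (leg ?K i)) v = ?x i" by (elim ex1E conjE)
  then have v: "v \<in> ob_map M ?N"
    "\<And>i. i \<in> Obj (spans_on {Single}) \<Longrightarrow> fn (arr_map M (leg ?K i)) v = ?x i"
    by (simp_all add: epi_cocone_def del: spans_on_sel(1))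
  have "leg ?K Base = Id ?T ?N" "leg ?K (Leg Single) = Id ?T ?N" by (simp_all add: epi_cocone_def)
  then show "m = m'"
    using v(2)[of Base] v(2)[of "Leg Single"] presheaf_id[OF inacc model_functor N v(1)]
    by (simp del: Top_sel)
qed

lemma evaluation_inj_basic: "B \<in> basic_spaces \<Longrightarrow> inj_on (evaluation M B) (ob_map M B)"
  using evaluation_inj_discrete evaluation_inj_net by (auto simp: basic_spaces_def)

lemma evaluation_inj: "B \<in> sketch_spaces \<Longrightarrow> inj_on (evaluation M B) (ob_map M B)"
  by (erule sketch_space_cases[OF inacc])
    (use evaluation_inj_basic evaluation_inj_vertex sketch_cocone_cases(4)[OF inacc] in blast)+

text \<open>
  The preimages of the composites \<open>y \<circ> leg K i\<close> under evaluation form a compatible family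
  because evaluation is injective, so they come from an element of \<open>M (vertex K)\<close>; it evaluates to
  \<open>y\<close> because the legs are jointly surjective.
\<close>

lemma traces_vertex:
  assumes K: "K \<in> sketch_cocones" and y: "y \<in> topspace (vertex K) \<rightarrow>\<^sub>E ob_map M one_space"
    and tr: "\<And>i. i \<in> Obj (shape K) \<Longrightarrow>
      (\<lambda>x\<in>topspace (ob_map (diagram K) i). y (fn (leg K i) x)) \<in> traces M (ob_map (diagram K) i)"
  shows "y \<in> traces M (vertex K)"
proof -
  let ?J = "shape K" and ?D = "ob_map (diagram K)" and ?V = "vertex K"
  note k = sketch_cocone_legs[OF K] and kc = sketch_cocone_cases[OF inacc K]
  have "\<exists>m. m \<in> ob_map M (?D i) \<and> (\<forall>x\<in>topspace (?D i). evaluation M (?D i) m x = y (fn (leg K i) x))"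
    if i: "i \<in> Obj ?J" for i
  proof -
    obtain m where m: "(\<lambda>x\<in>topspace (?D i). y (fn (leg K i) x)) = evaluation M (?D i) m"
      "m \<in> ob_map M (?D i)"
      using tr[OF i] unfolding traces_def by (rule imageE)
    have "evaluation M (?D i) m x = y (fn (leg K i) x)" if "x \<in> topspace (?D i)" for x
      unfolding m(1)[symmetric] using that by simp
    with m(2) show ?thesis by blast
  qed
  then obtain m where m: "\<And>i. i \<in> Obj ?J \<Longrightarrow> m i \<in> ob_map M (?D i)"
    and em: "\<And>i x. i \<in> Obj ?J \<Longrightarrow> x \<in> topspace (?D i) \<Longrightarrow> evaluation M (?D i) (m i) x = y (fn (leg K i) x)"
    by metis
  have "\<exists>!v. v \<in> ob_map M ?V \<and> (\<forall>i\<in>Obj ?J. fn (arr_map M (leg K i)) v = m i)"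
  proof (rule model_limit[OF K m])
    fix u assume u: "u \<in> Arr ?J"
    note d = category.dom_cod[OF k(2) u]
    let ?a = "Dom ?J u" and ?b = "Cod ?J u" and ?u = "arr_map (diagram K) u"
    note Da = k(3)[OF conjunct1[OF d]] and Db = k(3)[OF conjunct2[OF d]]
    note ma = m[OF conjunct1[OF d]] and mb = m[OF conjunct2[OF d]]
    note um = presheaf_mem[OF inacc model_functor Da Db k(5)[OF u] mb]
    have "evaluation M (?D ?a) (fn (arr_map M ?u) (m ?b)) = evaluation M (?D ?a) (m ?a)"
    proof (rule PiE_ext[OF evaluation_mem[OF model_functor Da um] evaluation_mem[OF model_functor Da ma]])
      fix x assume x: "x \<in> topspace (?D ?a)"
      show "evaluation M (?D ?a) (fn (arr_map M ?u) (m ?b)) x = evaluation M (?D ?a) (m ?a) x"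
        using evaluation_natural[OF model_functor Da Db k(5)[OF u] mb x]
          em[OF conjunct2[OF d] Hom_Top_mem[OF k(5)[OF u] x]] em[OF conjunct1[OF d] x]
          cocone_TopD(3)[OF k(1) u x] by simp
    qed
    then show "fn (arr_map M ?u) (m ?b) = m ?a"
      using inj_onD[OF evaluation_inj[OF Da]] um ma by blast
  qed
  then obtain v where v: "v \<in> ob_map M ?V" "\<And>i. i \<in> Obj ?J \<Longrightarrow> fn (arr_map M (leg K i)) v = m i" by blast
  have "y = evaluation M ?V v"
  proof (rule PiE_ext[OF y evaluation_mem[OF model_functor kc(3) v(1)]])
    fix w assume w: "w \<in> topspace ?V"
    obtain i x where ix: "i \<in> Obj ?J" "x \<in> topspace (?D i)" "w = fn (leg K i) x"
      using colimit_Top_surj[OF kc(1) w] by blast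
    show "y w = evaluation M ?V v w"
      using evaluation_natural[OF model_functor k(3)[OF ix(1)] kc(3) k(4)[OF ix(1)] v(1) ix(2)]
        v(2)[OF ix(1)] em[OF ix(1,2)] ix(3) by simp
  qed
  with v(1) show ?thesis unfolding traces_def by blast
qed

lemma traces_discrete:
  assumes I: "small TYPE('u) (I :: 'u set)"
  shows "traces M (discrete_topology I) = I \<rightarrow>\<^sub>E ob_map M one_space"
proof
  have K: "coproduct_cocone I \<in> sketch_cocones" using I by (auto simp: sketch_cocones_def discrete_cocones_def)
  have V: "vertex (coproduct_cocone I) = discrete_topology I" by (simp add: coproduct_cocone_def)
  show "traces M (discrete_topology I) \<subseteq> I \<rightarrow>\<^sub>E ob_map M one_space"
    using traces_subset[OF model_functor sketch_cocone_cases(3)[OF inacc K]] V by simp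
  show "I \<rightarrow>\<^sub>E ob_map M one_space \<subseteq> traces M (discrete_topology I)"
  proof
    fix y assume y: "y \<in> I \<rightarrow>\<^sub>E ob_map M one_space"
    have "y \<in> traces M (vertex (coproduct_cocone I))"
    proof (rule traces_vertex[OF K])
      fix i assume "i \<in> Obj (shape (coproduct_cocone I))"
      then obtain p where "p \<in> I" "i = Leg (Point p)" by (auto simp: coproduct_cocone_def)
      then show "(\<lambda>x\<in>topspace (ob_map (diagram (coproduct_cocone I)) i).
          y (fn (leg (coproduct_cocone I) i) x)) \<in> traces M (ob_map (diagram (coproduct_cocone I)) i)"
        using y by (auto simp: coproduct_cocone_def traces_one[OF model_functor])
    qed (use y V in simp)
    then show "y \<in> traces M (discrete_topology I)" using V by simp
  qed
qed

lemma traces_sum: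
  assumes "small_directed P"
  shows "traces M (sum_space P) = insert (infpt P) (Field P) \<rightarrow>\<^sub>E ob_map M one_space"
  unfolding sum_space_def
  by (rule traces_discrete, rule small_insert[OF inacc]) (use assms in \<open>simp add: small_directed_def\<close>)

lemma model_convD:
  assumes "small_directed P" "model_conv M P x a"
  shows "x \<in> Field P \<rightarrow> ob_map M one_space" "a \<in> ob_map M one_space"
proof -
  have "restrict (limit_extend P x a) (insert (infpt P) (Field P))
    \<in> topspace (net_space P) \<rightarrow>\<^sub>E ob_map M one_space"
    using traces_subset[OF model_functor basic_in_sketch[OF net_basic[OF assms(1)]]] assms(2)
    unfolding model_conv_def by blast
  then have *: "limit_extend P x a p \<in> ob_map M one_space" if "p \<in> insert (infpt P) (Field P)" for p
    using that assms(1) by (metis PiE_mem restrict_apply' topspace_net_space)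
  show "a \<in> ob_map M one_space" using *[of "infpt P"] by simp
  show "x \<in> Field P \<rightarrow> ob_map M one_space" using * assms(1) by (metis Pi_I insertCI limit_extend_simps(2))
qed

lemma model_conv_pullback:
  assumes R: "small_directed R" and B: "B \<in> sketch_spaces"
    and g: "continuous_map (net_space R) B g" and y: "y \<in> traces M B"
    and eq: "\<And>r. r \<in> Field R \<Longrightarrow> y (g r) = z r" and lim: "y (g (infpt R)) = a"
  shows "model_conv M R z a"
proof -
  have "restrict (limit_extend R z a) (insert (infpt R) (Field R)) = (\<lambda>r\<in>topspace (net_space R). y (g r))"
    using eq lim R by (intro ext) auto
  then show ?thesis
    unfolding model_conv_def
    using traces_pullback[OF model_functor basic_in_sketch[OF net_basic[OF R]] B g y] by simp
qed

lemma model_conv_const: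
  assumes P: "small_directed P" and a: "a \<in> ob_map M one_space"
  shows "model_conv M P (\<lambda>_. a) a"
proof (rule model_conv_pullback[OF P one_sketch])
  show "continuous_map (net_space P) one_space (\<lambda>_. undefined)" by simp
  show "(\<lambda>p\<in>{undefined}. a) \<in> traces M one_space" using a by (simp add: traces_one[OF model_functor])
qed auto

lemma model_conv_subnet:
  assumes P: "small_directed P" and R: "small_directed R" and h: "cofinal_map R P h"
    and x: "model_conv M P x a" and z: "\<And>r. r \<in> Field R \<Longrightarrow> z r = x (h r)"
  shows "model_conv M R z a"
proof (rule model_conv_pullback[OF R basic_in_sketch[OF net_basic[OF P]]
      continuous_cofinal_map[OF R P h] x[unfolded model_conv_def]])
  fix r assume r: "r \<in> Field R"
  then have "h r \<in> Field P" using h by (auto simp: cofinal_map_def)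
  then show "restrict (limit_extend P x a) (insert (infpt P) (Field P)) (limit_extend R h (infpt P) r) = z r"
    using r R P z by simp
qed simp

text \<open>
  This is what the cocones with vertex \<open>F(P,h)\<close> are for: given convergent subnets \<open>h Q\<close>, the net
  is a trace on \<open>F(P,h)\<close>, which restricts along the continuous bijection \<open>P \<union> {\<infinity>} \<rightarrow> F(P,h)\<close>.
\<close>

lemma model_conv_local:
  assumes P: "small_directed P" and x: "x \<in> Field P \<rightarrow> ob_map M one_space" and a: "a \<in> ob_map M one_space"
    and loc: "\<And>Q. cofinal_subset P Q \<Longrightarrow> \<exists>R h. small_directed R \<and> cofinal_map R (Restr P Q) h \<and>
        model_conv M R (\<lambda>r. x (h r)) a"
  shows "model_conv M P x a"
proof -
  obtain R h where R: "\<And>Q. cofinal_subset P Q \<Longrightarrow> small_directed (R Q)"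
    and h: "\<And>Q. cofinal_subset P Q \<Longrightarrow> cofinal_map (R Q) (Restr P Q) (h Q)"
    and conv: "\<And>Q. cofinal_subset P Q \<Longrightarrow> model_conv M (R Q) (\<lambda>r. x (h Q r)) a"
    using loc by metis
  let ?S = "insert (infpt P) (Field P)"
  obtain V where K: "subnet_cocone P R h V \<in> subnet_cocones" (is "?K \<in> _")
    and tV: "topspace V = ?S" and idV: "continuous_map (net_space P) V (\<lambda>x. x)"
    by (rule subnet_cocone_exists[OF inacc P R h])
  have K': "?K \<in> sketch_cocones" using K by (simp add: sketch_cocones_def)
  have V: "V \<in> sketch_spaces" using sketch_cocone_cases(3)[OF inacc K'] by simp
  note k = sketch_cocone_legs[OF K']
  let ?y = "restrict (limit_extend P x a) ?S"
  have y: "?y \<in> topspace V \<rightarrow>\<^sub>E ob_map M one_space"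
    unfolding tV using x a P by (auto simp: limit_extend_def)
  have "?y \<in> traces M (vertex ?K)"
  proof (rule traces_vertex[OF K'])
    fix i assume i: "i \<in> Obj (shape ?K)"
    have mem: "?y (fn (leg ?K i) p) \<in> ob_map M one_space" if "p \<in> topspace (ob_map (diagram ?K) i)" for p
      using Hom_Top_mem[OF k(4)[OF i] that] y by (simp only: span_cocone_sel) (rule PiE_mem)
    from i consider "i = Base" | Q where "cofinal_subset P Q" "i = Apex (Subset Q)"
      | Q where "cofinal_subset P Q" "i = Leg (Subset Q)" by auto
    then show "(\<lambda>p\<in>topspace (ob_map (diagram ?K) i). ?y (fn (leg ?K i) p)) \<in> traces M (ob_map (diagram ?K) i)"
    proof cases
      case 1
      then have "ob_map (diagram ?K) i = sum_space P" by simp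
      then show ?thesis using mem traces_sum[OF P] by (simp only: topspace_sum_space) (auto intro!: restrict_PiE_iff[THEN iffD2])
    next
      case 2
      then have "ob_map (diagram ?K) i = sum_space (R Q)" by simp
      then show ?thesis using mem traces_sum[OF R[OF 2(1)]] by (simp only: topspace_sum_space) (auto intro!: restrict_PiE_iff[THEN iffD2])
    next
      case 3
      have D: "ob_map (diagram ?K) i = net_space (R Q)"
        and L: "leg ?K i = top_map (net_space (R Q)) (limit_extend (R Q) (h Q) (infpt P)) V"
        using 3 by simp_all
      have hP: "h Q r \<in> Field P" if "r \<in> Field (R Q)" for r
        using h[OF 3(1)] that by (auto simp: cofinal_map_def Field_def)
      have "(\<lambda>p\<in>topspace (net_space (R Q)). ?y (fn (leg ?K i) p)) =
        restrict (limit_extend (R Q) (\<lambda>r. x (h Q r)) a) (insert (infpt (R Q)) (Field (R Q)))"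
        unfolding L using R[OF 3(1)] P hP by (intro ext) auto
      then show ?thesis using conv[OF 3(1)] unfolding D model_conv_def by simp
    qed
  qed (use y in simp)
  then have "?y \<in> traces M V" by simp
  then show ?thesis
    by (rule model_conv_pullback[OF P V idV]) (use P in simp_all)
qed

text \<open>
  This is what the cocones with vertex \<open>G(P,Q)\<close> are for: a convergent net whose terms are limits
  of nets is a trace on \<open>G(P,Q)\<close>, which restricts along the diagonal net.
\<close>

lemma model_conv_iterated:
  assumes P: "small_directed P" and x: "model_conv M P x a"
    and Qy: "\<And>p. p \<in> Field P \<Longrightarrow> small_directed (Q p) \<and> model_conv M (Q p) (y p) (x p)"
  shows "\<exists>R k h. small_directed R \<and> cofinal_map R P k \<and> (\<forall>r\<in>Field R. h r \<in> Field (Q (k r))) \<and>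
        model_conv M R (\<lambda>r. y (k r) (h r)) a"
proof -
  have Q: "\<And>p. p \<in> Field P \<Longrightarrow> small_directed (Q p)"
    and yc: "\<And>p. p \<in> Field P \<Longrightarrow> model_conv M (Q p) (y p) (x p)" using Qy by auto
  show ?thesis
  proof (rule iterated_cocone_exists[OF inacc P Q])
    fix V i j assume K: "iterated_cocone P Q V i j \<in> iterated_cocones" (is "?K \<in> _")
      and ci: "continuous_map (net_space P) V i"
      and cj: "\<And>p. p \<in> Field P \<Longrightarrow> continuous_map (net_space (Q p)) V (j p)"
      and ji: "\<And>p. p \<in> Field P \<Longrightarrow> j p (infpt (Q p)) = i p"
      and glue: "\<And>(g0 :: 'u \<Rightarrow> 'u) (g :: 'u \<Rightarrow> 'u \<Rightarrow> 'u). (\<And>p. p \<in> Field P \<Longrightarrow> g p (infpt (Q p)) = g0 p) \<Longrightarrow>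
        \<exists>t. (\<forall>x\<in>topspace (net_space P). t (i x) = g0 x) \<and>
            (\<forall>p\<in>Field P. \<forall>z\<in>topspace (net_space (Q p)). t (j p z) = g p z)"
      and tV: "topspace V = i ` topspace (net_space P) \<union> (\<Union>p\<in>Field P. j p ` topspace (net_space (Q p)))"
    have K': "?K \<in> sketch_cocones" using K by (simp add: sketch_cocones_def)
    have V: "V \<in> sketch_spaces" using sketch_cocone_cases(3)[OF inacc K'] by simp
    note k = sketch_cocone_legs[OF K']
    have "\<exists>t. (\<forall>p\<in>topspace (net_space P). t (i p) = limit_extend P x a p) \<and>
        (\<forall>p\<in>Field P. \<forall>z\<in>topspace (net_space (Q p)).
           t (j p z) = limit_extend (Q p) (y p) (x p) z)"
      by (rule glue) (use P in simp)
    then obtain t where t0: "\<And>p. p \<in> topspace (net_space P) \<Longrightarrow> t (i p) = limit_extend P x a p"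
      and t1: "\<And>p z. p \<in> Field P \<Longrightarrow> z \<in> topspace (net_space (Q p)) \<Longrightarrow>
        t (j p z) = limit_extend (Q p) (y p) (x p) z"
      by blast
    have tS: "t w \<in> ob_map M one_space" if "w \<in> topspace V" for w
    proof -
      from that consider p where "p \<in> topspace (net_space P)" "w = i p"
        | p z where "p \<in> Field P" "z \<in> topspace (net_space (Q p))" "w = j p z" unfolding tV by blast
      then show ?thesis
      proof cases
        case 1
        then show ?thesis using t0[OF 1(1)] model_convD[OF P x] P by (auto simp: limit_extend_def)
      next
        case 2
        then show ?thesis
          using t1[OF 2(1,2)] model_convD[OF Q[OF 2(1)] yc[OF 2(1)]] Q[OF 2(1)] by (auto simp: limit_extend_def)
      qed
    qed
    let ?t = "restrict t (topspace V)"
    have im_i: "i p \<in> topspace V" if "p \<in> topspace (net_space P)" for p using that unfolding tV by blast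
    have im_j: "j p z \<in> topspace V" if "p \<in> Field P" "z \<in> topspace (net_space (Q p))" for p z
      using that unfolding tV by blast
    have "?t \<in> traces M (vertex ?K)"
    proof (rule traces_vertex[OF K'])
      fix l assume l: "l \<in> Obj (shape ?K)"
      then consider "l = Base" | p where "p \<in> Field P" "l = Apex (Point p)"
        | p where "p \<in> Field P" "l = Leg (Point p)" by auto
      then show "(\<lambda>p\<in>topspace (ob_map (diagram ?K) l). ?t (fn (leg ?K l) p)) \<in> traces M (ob_map (diagram ?K) l)"
      proof cases
        case 1
        have "(\<lambda>p\<in>topspace (net_space P). ?t (fn (leg ?K l) p)) =
          restrict (limit_extend P x a) (insert (infpt P) (Field P))"
          using 1 P t0 im_i by (intro ext) auto
        then show ?thesis using 1 x unfolding model_conv_def by simp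
      next
        case 2
        have D: "ob_map (diagram ?K) l = one_space" using 2 by simp
        have "?t (fn (leg ?K l) p) \<in> ob_map M one_space" if "p \<in> topspace (ob_map (diagram ?K) l)" for p
          using Hom_Top_mem[OF k(4)[OF l] that] tS by simp
        then show ?thesis unfolding D traces_one[OF model_functor] by (intro restrict_PiE_iff[THEN iffD2]) blast
      next
        case 3
        have "(\<lambda>z\<in>topspace (net_space (Q p)). ?t (fn (leg ?K l) z)) =
          restrict (limit_extend (Q p) (y p) (x p)) (insert (infpt (Q p)) (Field (Q p)))"
          using 3 Q[OF 3(1)] t1[OF 3(1)] im_j[OF 3(1)] by (intro ext) auto
        then show ?thesis using 3 yc[OF 3(1)] unfolding model_conv_def by simp
      qed
    qed (use tS in simp)
    then have tV': "?t \<in> traces M V" by simp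
    show ?thesis
    proof (rule diagonal_net[OF inacc P Q])
      fix R k' h assume R: "small_directed R" "cofinal_map R P k'"
        and h: "\<And>r. r \<in> Field R \<Longrightarrow> h r \<in> Field (Q (k' r))"
        and diag: "\<And>(V :: 'u topology) i j. continuous_map (net_space P) V i \<Longrightarrow>
          (\<And>p. p \<in> Field P \<Longrightarrow> continuous_map (net_space (Q p)) V (j p)) \<Longrightarrow>
          (\<And>p. p \<in> Field P \<Longrightarrow> j p (infpt (Q p)) = i p) \<Longrightarrow>
          continuous_map (net_space R) V (limit_extend R (\<lambda>r. j (k' r) (h r)) (i (infpt P)))"
      have kP: "k' r \<in> Field P" if "r \<in> Field R" for r using R(2) that by (auto simp: cofinal_map_def)
      have "model_conv M R (\<lambda>r. y (k' r) (h r)) a"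
      proof (rule model_conv_pullback[OF R(1) V diag[OF ci cj ji] tV'])
        fix r assume r: "r \<in> Field R"
        note kr = kP[OF r] and hr = h[OF r]
        have "h r \<in> topspace (net_space (Q (k' r)))" using Q[OF kr] hr by simp
        then show "?t (limit_extend R (\<lambda>r. j (k' r) (h r)) (i (infpt P)) r) = y (k' r) (h r)"
          using r R(1) t1[OF kr] im_j[OF kr] hr Q[OF kr] by simp
      next
        show "?t (limit_extend R (\<lambda>r. j (k' r) (h r)) (i (infpt P)) (infpt R)) = a"
          using t0[of "infpt P"] im_i[of "infpt P"] P by simp
      qed
      with R h show ?thesis by blast
    qed
  qed
qed

lemma model_convergence_class: "convergence_class (ob_map M one_space) (model_conv M)"
proof
  show "x \<in> Field P \<rightarrow> ob_map M one_space \<and> a \<in> ob_map M one_space"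
    if "small_directed P" "model_conv M P x a" for P x a using model_convD[OF that] by blast
qed (fact model_conv_const model_conv_subnet model_conv_local model_conv_iterated)+

interpretation conv: convergence_class "ob_map M one_space" "model_conv M"
  by (rule model_convergence_class)

lemma traces_net:
  assumes P: "small_directed P"
  shows "y \<in> traces M (net_space P) \<longleftrightarrow>
    y \<in> extensional (topspace (net_space P)) \<and> continuous_map (net_space P) conv.conv_topology y"
proof -
  have *: "y \<in> traces M (net_space P) \<longleftrightarrow> continuous_map (net_space P) conv.conv_topology y"
    if ext: "y \<in> extensional (topspace (net_space P))"
  proof -
    have y: "limit_extend P y (y (infpt P)) = y" by (auto simp: limit_extend_def)
    have "restrict y (insert (infpt P) (Field P)) = y"
      using ext P by (simp add: extensional_restrict)
    then have "y \<in> traces M (net_space P) \<longleftrightarrow> model_conv M P y (y (infpt P))"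
      unfolding model_conv_def y by simp
    also have "\<dots> \<longleftrightarrow> continuous_map (net_space P) conv.conv_topology (limit_extend P y (y (infpt P)))"
      unfolding conv.conv_iff_topological[OF P] continuous_limit_extend[OF P]
      by (simp only: conv.topspace_conv_topology image_subset_iff_funcset)
    finally show ?thesis unfolding y .
  qed
  have "traces M (net_space P) \<subseteq> extensional (topspace (net_space P))"
    using traces_subset[OF model_functor basic_in_sketch[OF net_basic[OF P]]] by (auto simp: PiE_def)
  with * show ?thesis by blast
qed

lemma traces_basic:
  assumes "B \<in> basic_spaces"
  shows "y \<in> traces M B \<longleftrightarrow> y \<in> extensional (topspace B) \<and> continuous_map B conv.conv_topology y"
  using assms traces_net unfolding basic_spaces_def
  by (auto simp: traces_discrete PiE_def image_subset_iff_funcset continuous_map_def simp del: topspace_net_space)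

text \<open>
  Kelley's theorem gives the claim for the spaces \<open>P \<union> {\<infinity>}\<close>. At the vertex of a distinguished
  cocone, both being a trace and being continuous can be tested on the legs.
\<close>

lemma traces_sketch:
  assumes B: "B \<in> sketch_spaces"
  shows "y \<in> traces M B \<longleftrightarrow> y \<in> extensional (topspace B) \<and> continuous_map B conv.conv_topology y"
proof (rule sketch_space_cases[OF inacc B])
  assume "B \<in> basic_spaces" then show ?thesis by (rule traces_basic)
next
  fix K assume K: "K \<in> sketch_cocones" and BK: "vertex K = B"
  note k = sketch_cocone_legs[OF K] and kc = sketch_cocone_cases[OF inacc K]
  let ?X = "conv.conv_topology"
  have X: "small TYPE('u) (topspace ?X)" using presheaf_small[OF inacc model_functor one_sketch] by simp
  show ?thesis
  proof
    assume y: "y \<in> traces M B"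
    have y': "y \<in> topspace B \<rightarrow>\<^sub>E ob_map M one_space" using traces_subset[OF model_functor B] y by blast
    have "continuous_map (vertex K) ?X y"
    proof (rule colimit_Top_final[OF kc(1) X])
      show "y \<in> topspace (vertex K) \<rightarrow> topspace ?X" using y' BK by (auto simp: PiE_def)
      fix i assume i: "i \<in> Obj (shape K)"
      have cl: "continuous_map (ob_map (diagram K) i) B (fn (leg K i))" using k(4)[OF i] BK by (simp add: Hom_Top)
      have "(\<lambda>x\<in>topspace (ob_map (diagram K) i). y (fn (leg K i) x)) \<in> traces M (ob_map (diagram K) i)"
        by (rule traces_pullback[OF model_functor k(3)[OF i] B cl y])
      then show "continuous_map (ob_map (diagram K) i) ?X (\<lambda>x. y (fn (leg K i) x))"
        unfolding traces_basic[OF kc(4)[OF i]] by (auto intro: continuous_map_eq)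
    qed
    with y' BK show "y \<in> extensional (topspace B) \<and> continuous_map B ?X y" by (auto simp: PiE_def)
  next
    assume y: "y \<in> extensional (topspace B) \<and> continuous_map B ?X y"
    have "y \<in> traces M (vertex K)"
    proof (rule traces_vertex[OF K])
      show "y \<in> topspace (vertex K) \<rightarrow>\<^sub>E ob_map M one_space"
        using y BK by (auto simp: continuous_map_def PiE_def)
      fix i assume i: "i \<in> Obj (shape K)"
      have "continuous_map (ob_map (diagram K) i) ?X (y \<circ> fn (leg K i))"
        using k(4)[OF i] y BK by (auto simp: Hom_Top intro: continuous_map_compose)
      then have "continuous_map (ob_map (diagram K) i) ?X (\<lambda>x\<in>topspace (ob_map (diagram K) i). y (fn (leg K i) x))"
        by (rule continuous_map_eq) simp
      then show "(\<lambda>x\<in>topspace (ob_map (diagram K) i). y (fn (leg K i) x)) \<in> traces M (ob_map (diagram K) i)"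
        unfolding traces_basic[OF kc(4)[OF i]] by simp
    qed
    then show "y \<in> traces M B" using BK by simp
  qed
qed

theorem model_presented: "\<exists>X \<theta>. presents X M \<theta>"
proof -
  let ?T = "Top TYPE('u)" and ?X = "conv.conv_topology"
  define \<theta> where "\<theta> B u = inv_into (ob_map M B) (evaluation M B) (fn u)" for B and u :: "'u space_arrow"
  have X: "small TYPE('u) (topspace ?X)" using presheaf_small[OF inacc model_functor one_sketch] by simp
  have tr: "fn u \<in> evaluation M B ` ob_map M B" if "B \<in> sketch_spaces" "u \<in> Hom ?T B ?X" for B u
    using traces_sketch[OF that(1), of "fn u"] that(2) unfolding traces_def by (simp add: Hom_Top)
  have \<theta>: "\<theta> B u \<in> ob_map M B" "evaluation M B (\<theta> B u) = fn u" if "B \<in> sketch_spaces" "u \<in> Hom ?T B ?X" for B u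
    using inv_into_into[OF tr[OF that]] f_inv_into_f[OF tr[OF that]] by (simp_all add: \<theta>_def)
  have bij: "bij_betw (\<theta> B) (Hom ?T B ?X) (ob_map M B)" if B: "B \<in> sketch_spaces" for B
    unfolding bij_betw_def
  proof
    show "inj_on (\<theta> B) (Hom ?T B ?X)"
      by (rule inj_onI) (metis \<theta>(2) B Hom_Top_eqI)
    show "\<theta> B ` Hom ?T B ?X = ob_map M B"
    proof
      show "\<theta> B ` Hom ?T B ?X \<subseteq> ob_map M B" using \<theta>(1)[OF B] by blast
      show "ob_map M B \<subseteq> \<theta> B ` Hom ?T B ?X"
      proof
        fix m assume m: "m \<in> ob_map M B"
        then have "evaluation M B m \<in> traces M B" by (simp add: traces_def)
        then have "Arrow B (evaluation M B m) ?X \<in> Hom ?T B ?X"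
          unfolding traces_sketch[OF B] using X small_sketch_space[OF inacc B] by (simp add: Hom_Top)
        moreover have "\<theta> B (Arrow B (evaluation M B m) ?X) = m"
          unfolding \<theta>_def using inv_into_f_f[OF evaluation_inj[OF B] m] by simp
        ultimately show "m \<in> \<theta> B ` Hom ?T B ?X" by (metis imageI)
      qed
    qed
  qed
  have "\<theta> A (Comp ?T u f) = fn (arr_map M f) (\<theta> B u)"
    if A: "A \<in> sketch_spaces" and B: "B \<in> sketch_spaces" and f: "f \<in> Hom ?T A B" and u: "u \<in> Hom ?T B ?X" for A B f u
  proof (rule inj_onD[OF evaluation_inj[OF A]])
    note uf = category.comp_hom[OF category_Top f u]
    note fm = presheaf_mem[OF inacc model_functor A B f \<theta>(1)[OF B u]]
    show "evaluation M A (\<theta> A (Comp ?T u f)) = evaluation M A (fn (arr_map M f) (\<theta> B u))"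
    proof (rule PiE_ext[OF evaluation_mem[OF model_functor A \<theta>(1)[OF A uf]] evaluation_mem[OF model_functor A fm]])
      fix a assume a: "a \<in> topspace A"
      show "evaluation M A (\<theta> A (Comp ?T u f)) a = evaluation M A (fn (arr_map M f) (\<theta> B u)) a"
        using evaluation_natural[OF model_functor A B f \<theta>(1)[OF B u] a] \<theta>(2)[OF A uf] \<theta>(2)[OF B u]
          fn_Comp_Top[OF f a] by simp
    qed
    show "\<theta> A (Comp ?T u f) \<in> ob_map M A" by (rule \<theta>(1)[OF A uf])
    show "fn (arr_map M f) (\<theta> B u) \<in> ob_map M A" by (rule fm)
  qed
  then have "presents ?X M \<theta>"
    unfolding presents_def using model_functor X bij by blast
  then show ?thesis by blast
qed

end

end

section \<open>The equivalence\<close>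

lemma nat_trans_id:
  assumes F: "is_functor C D F"
  shows "nat_trans C D F F (\<lambda>a\<in>Obj C. Id D (ob_map F a))"
  unfolding nat_trans_def
proof (intro conjI ballI F)
  interpret C: category C using functor_cat[OF F] by simp
  interpret D: category D using functor_cat[OF F] by simp
  show "(\<lambda>a\<in>Obj C. Id D (ob_map F a)) a \<in> Hom D (ob_map F a) (ob_map F a)" if "a \<in> Obj C" for a
    using that D.id_hom[OF functor_ob[OF F that]] by simp
  fix f assume f: "f \<in> Arr C"
  note Ff = functor_hom[OF F Arr_Hom[OF f]]
  show "Comp D (arr_map F f) ((\<lambda>a\<in>Obj C. Id D (ob_map F a)) (Dom C f)) =
    Comp D ((\<lambda>a\<in>Obj C. Id D (ob_map F a)) (Cod C f)) (arr_map F f)"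
    using C.dom_cod[OF f] D.id_left[OF Ff] D.id_right[OF Ff] by simp
qed simp

lemma nat_transD:
  assumes "nat_trans C D F G \<eta>"
  shows "is_functor C D F" "is_functor C D G" "\<eta> \<in> extensional (Obj C)"
    "\<And>a. a \<in> Obj C \<Longrightarrow> \<eta> a \<in> Hom D (ob_map F a) (ob_map G a)"
    "\<And>f a b. f \<in> Hom C a b \<Longrightarrow> Comp D (arr_map G f) (\<eta> a) = Comp D (\<eta> b) (arr_map F f)"
  using assms unfolding nat_trans_def Hom_def by auto

lemma nat_trans_comp:
  assumes \<eta>: "nat_trans C D F G \<eta>" and \<mu>: "nat_trans C D G H \<mu>"
  shows "nat_trans C D F H (\<lambda>a\<in>Obj C. Comp D (\<mu> a) (\<eta> a))"
  unfolding nat_trans_def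
proof (intro conjI ballI nat_transD(1)[OF \<eta>] nat_transD(2)[OF \<mu>])
  note F = nat_transD(1)[OF \<eta>] and G = nat_transD(2)[OF \<eta>] and H = nat_transD(2)[OF \<mu>]
  interpret C: category C using functor_cat[OF F] by simp
  interpret D: category D using functor_cat[OF F] by simp
  note e = nat_transD(4)[OF \<eta>] and m = nat_transD(4)[OF \<mu>]
  show "(\<lambda>a\<in>Obj C. Comp D (\<mu> a) (\<eta> a)) a \<in> Hom D (ob_map F a) (ob_map H a)" if "a \<in> Obj C" for a
    using that D.comp_hom[OF e[OF that] m[OF that]] by simp
  fix f assume f: "f \<in> Arr C"
  note fh = Arr_Hom[OF f]
  let ?a = "Dom C f" and ?b = "Cod C f"
  have ab: "?a \<in> Obj C" "?b \<in> Obj C" using C.dom_cod[OF f] by auto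
  show "Comp D (arr_map H f) ((\<lambda>a\<in>Obj C. Comp D (\<mu> a) (\<eta> a)) ?a) =
    Comp D ((\<lambda>a\<in>Obj C. Comp D (\<mu> a) (\<eta> a)) ?b) (arr_map F f)"
    using ab D.assoc[OF e[OF ab(1)] m[OF ab(1)] functor_hom[OF H fh]] nat_transD(5)[OF \<mu> fh]
      D.assoc[OF e[OF ab(1)] functor_hom[OF G fh] m[OF ab(2)]] nat_transD(5)[OF \<eta> fh]
      D.assoc[OF functor_hom[OF F fh] e[OF ab(2)] m[OF ab(2)]] by simp
qed simp

lemma Mod_sel [simp]:
  "Obj (Mod U S) = {M. model S M}" "Dom (Mod U S) = src" "Cod (Mod U S) = tgt"
  "Id (Mod U S) M = Arrow M (\<lambda>a\<in>Obj (under S). Id Set (ob_map M a)) M"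
  "Comp (Mod U S) g f = Arrow (src f) (\<lambda>a\<in>Obj (under S). Comp Set (fn g a) (fn f a)) (tgt g)"
  by (simp_all add: Mod_def)

lemma Hom_Mod: "f \<in> Hom (Mod U S) M N \<longleftrightarrow> model S M \<and> model S N \<and> src f = M \<and> tgt f = N \<and>
    nat_trans (under S) Set M N (fn f)"
  by (cases f) (auto simp: Hom_def Mod_def)

lemma category_Mod: "category (Mod U S)"
proof
  fix f assume "f \<in> Arr (Mod U S)"
  then show "Dom (Mod U S) f \<in> Obj (Mod U S) \<and> Cod (Mod U S) f \<in> Obj (Mod U S)" by (auto simp: Mod_def)
next
  fix M assume "M \<in> Obj (Mod U S)"
  then show "Id (Mod U S) M \<in> Hom (Mod U S) M M"
    using nat_trans_id[of "under S" Set M] by (simp add: Hom_Mod model_def del: Set_sel)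
next
  fix f M N assume f: "f \<in> Hom (Mod U S) M N"
  then have nt: "nat_trans (under S) Set M N (fn f)" by (simp add: Hom_Mod)
  note h = nat_transD(4)[OF nt] and e = nat_transD(3)[OF nt]
  have "(\<lambda>a\<in>Obj (under S). Comp Set (Id Set (ob_map N a)) (fn f a)) = fn f"
    by (rule extensionalityI[OF _ e])
      (use category.id_left[OF category_Set h] in \<open>simp_all del: Set_sel\<close>)
  moreover have "(\<lambda>a\<in>Obj (under S). Comp Set (fn f a) (Id Set (ob_map M a))) = fn f"
    by (rule extensionalityI[OF _ e])
      (use category.id_right[OF category_Set h] in \<open>simp_all del: Set_sel\<close>)
  ultimately show "Comp (Mod U S) (Id (Mod U S) N) f = f" "Comp (Mod U S) f (Id (Mod U S) M) = f"
    using f by (auto intro!: arrow.expand simp: Hom_Mod cong: restrict_cong simp del: Set_sel)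
  fix g L assume g: "g \<in> Hom (Mod U S) N L"
  then have nt': "nat_trans (under S) Set N L (fn g)" by (simp add: Hom_Mod)
  show "Comp (Mod U S) g f \<in> Hom (Mod U S) M L"
    using f g nat_trans_comp[OF nt nt'] by (simp add: Hom_Mod del: Set_sel)
  fix k R assume k: "k \<in> Hom (Mod U S) L R"
  then have nt'': "nat_trans (under S) Set L R (fn k)" by (simp add: Hom_Mod)
  show "Comp (Mod U S) k (Comp (Mod U S) g f) = Comp (Mod U S) (Comp (Mod U S) k g) f"
    using category.assoc[OF category_Set h nat_transD(4)[OF nt'] nat_transD(4)[OF nt'']]
    by (simp del: Set_sel cong: restrict_cong)
qed

lemma fn_Comp_Set: "f \<in> Hom Set A B \<Longrightarrow> x \<in> A \<Longrightarrow> fn (Comp Set g f) x = fn g (fn f x)"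
  by (simp add: Hom_Set compose_def)

text \<open>
  The transformation \<open>\<eta>\<close> between copies of \<open>Hom(-,X)\<close> and \<open>Hom(-,Y)\<close> is composition with
  \<open>g : X \<rightarrow> Y\<close>. The two lemmas on uniqueness and the two on existence below make this a bijection
  between continuous maps and natural transformations.
\<close>

definition tracks :: "'u topology \<Rightarrow> ('u topology \<Rightarrow> 'u space_arrow \<Rightarrow> 'u) \<Rightarrow>
    ('u topology \<Rightarrow> 'u space_arrow \<Rightarrow> 'u) \<Rightarrow>
    'u space_arrow \<Rightarrow> ('u topology \<Rightarrow> ('u set, 'u \<Rightarrow> 'u) arrow) \<Rightarrow> bool" where
  "tracks X \<theta> \<theta>' g \<eta> \<longleftrightarrow> (\<forall>B\<in>sketch_spaces. \<forall>u\<in>Hom (Top TYPE('u)) B X.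
     fn (\<eta> B) (\<theta> B u) = \<theta>' B (Comp (Top TYPE('u)) g u))"

definition hom_code :: "'u topology \<Rightarrow> 'u topology \<Rightarrow> 'u space_arrow \<Rightarrow> 'u" where
  "hom_code X B = (SOME c. inj_on c (Hom (Top TYPE('u)) B X))"

text \<open>
  Continuous maps \<open>B \<rightarrow> X\<close> are not elements of \<open>'u\<close>, so the values of this copy of
  \<open>Hom(-,X)\<close> are sets of codes.
\<close>

definition hom_presheaf :: "'u topology \<Rightarrow> 'u presheaf" where
  "hom_presheaf X = (let H = (\<lambda>B. Hom (Top TYPE('u)) B X); c = hom_code X in
     \<lparr>ob_map = (\<lambda>B\<in>sketch_spaces. c B ` H B),
      arr_map = (\<lambda>f\<in>Arr test_cat. Arrow (c (tgt f) ` H (tgt f))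
        (\<lambda>v\<in>c (tgt f) ` H (tgt f). c (src f) (Comp (Top TYPE('u)) (inv_into (H (tgt f)) (c (tgt f)) v) f))
        (c (src f) ` H (src f)))\<rparr>)"

definition hom_trans :: "'u space_arrow \<Rightarrow> 'u topology \<Rightarrow> ('u set, 'u \<Rightarrow> 'u) arrow" where
  "hom_trans g = (SOME \<eta>. nat_trans test_cat Set (hom_presheaf (src g)) (hom_presheaf (tgt g)) \<eta> \<and>
     tracks (src g) (hom_code (src g)) (hom_code (tgt g)) g \<eta>)"

definition hom_functor :: "('u topology, 'u space_arrow, 'u presheaf,
    ('u presheaf, 'u topology \<Rightarrow> ('u set, 'u \<Rightarrow> 'u) arrow) arrow) fctr" where
  "hom_functor = \<lparr>ob_map = (\<lambda>X\<in>Obj (Top TYPE('u)). hom_presheaf X),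
     arr_map = (\<lambda>g\<in>Arr (Top TYPE('u)). Arrow (hom_presheaf (src g)) (hom_trans g) (hom_presheaf (tgt g)))\<rparr>"

abbreviation ModT where "ModT \<equiv> Mod TYPE('u) (top_sketch TYPE('u))"

context
  assumes inacc: "inaccessible TYPE('u)"
begin

lemma hom_code_inj: "inj_on (hom_code X B) (Hom (Top TYPE('u)) B (X :: 'u topology))"
proof -
  obtain c :: "'u space_arrow \<Rightarrow> 'u" where "inj_on c (Hom (Top TYPE('u)) B X)"
    by (rule small_embed[OF small_Hom_Top[OF inacc]])
  then show ?thesis unfolding hom_code_def
    by (rule someI[of "\<lambda>c. inj_on c (Hom (Top TYPE('u)) B X)"])
qed

lemma presents_hom_presheaf:
  fixes X :: "'u topology"
  assumes X: "small TYPE('u) (topspace X)"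
  shows "presents X (hom_presheaf X) (hom_code X)"
proof -
  let ?T = "Top TYPE('u)" and ?c = "hom_code X" and ?M = "hom_presheaf X"
  have dec: "inv_into (Hom ?T B X) (?c B) (?c B u) = u" if "u \<in> Hom ?T B X" for B u
    by (rule inv_into_f_f[OF hom_code_inj that])
  have ob: "ob_map ?M B = ?c B ` Hom ?T B X" if "B \<in> sketch_spaces" for B
    using that by (simp add: hom_presheaf_def Let_def)
  have arr: "arr_map ?M f = Arrow (?c B ` Hom ?T B X)
      (\<lambda>v\<in>?c B ` Hom ?T B X. ?c A (Comp ?T (inv_into (Hom ?T B X) (?c B) v) f)) (?c A ` Hom ?T A X)"
    if "f \<in> Hom test_cat B A" for f A B
    using that by (auto simp: hom_presheaf_def Let_def Hom_def)
  have fnarr: "fn (arr_map ?M f) (?c B u) = ?c A (Comp ?T u f)"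
    if "f \<in> Hom test_cat B A" "u \<in> Hom ?T B X" for f A B u
    using arr[OF that(1)] dec[OF that(2)] that(2) by simp
  have smob: "small TYPE('u) (?c B ` Hom ?T B X)" for B
    by (rule small_image[OF small_Hom_Top[OF inacc]])
  have hom: "arr_map ?M f \<in> Hom Set (ob_map ?M B) (ob_map ?M A)" if f: "f \<in> Hom test_cat B A" for f A B
  proof -
    have "A \<in> sketch_spaces" "B \<in> sketch_spaces" "f \<in> Hom ?T A B" using f by (auto simp: Hom_test_cat)
    moreover have "?c A (Comp ?T u f) \<in> ?c A ` Hom ?T A X" if "u \<in> Hom ?T B X" for u
      by (rule imageI, rule category.comp_hom[OF category_Top _ that]) fact
    ultimately show ?thesis
      using arr[OF f] smob dec by (auto simp: Hom_Set ob)
  qed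
  have M: "is_functor test_cat Set ?M"
  proof (rule is_functorI)
    show "ob_map ?M \<in> extensional (Obj test_cat)" "arr_map ?M \<in> extensional (Arr test_cat)"
      by (simp_all add: hom_presheaf_def Let_def)
    show "ob_map ?M B \<in> Obj Set" if "B \<in> Obj test_cat" for B using that smob ob by simp
    show "arr_map ?M f \<in> Hom Set (ob_map ?M B) (ob_map ?M A)" if "f \<in> Hom test_cat B A" for f A B
      by (rule hom[OF that])
    show "arr_map ?M (Id test_cat B) = Id Set (ob_map ?M B)" if B: "B \<in> Obj test_cat" for B
    proof -
      note idB = category.id_hom[OF category_test_cat[OF inacc] B]
      have obB: "ob_map ?M B \<in> Obj Set" using B smob ob by simp
      show ?thesis
      proof (rule fn_eqI[OF hom[OF idB] category.id_hom[OF category_Set obB]])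
        fix v assume v: "v \<in> ob_map ?M B"
        then obtain u where u: "v = ?c B u" "u \<in> Hom ?T B X" using ob B by auto
        have "Comp ?T u (Id ?T B) = u" by (rule category.id_right[OF category_Top u(2)])
        then show "fn (arr_map ?M (Id test_cat B)) v = fn (Id Set (ob_map ?M B)) v"
          using fnarr[OF idB u(2)] u(1) v by (simp del: Top_sel)
      qed
    qed
    show "arr_map ?M (Comp test_cat g f) = Comp Set (arr_map ?M g) (arr_map ?M f)"
      if f: "f \<in> Hom test_cat C B" and g: "g \<in> Hom test_cat B A" for f g A B C
    proof -
      note gf = category.comp_hom[OF category_test_cat[OF inacc] f g]
      have C: "C \<in> sketch_spaces" and f': "f \<in> Hom ?T B C" and g': "g \<in> Hom ?T A B"
        using f g by (auto simp: Hom_test_cat)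
      show ?thesis
      proof (rule fn_eqI[OF hom[OF gf] category.comp_hom[OF category_Set hom[OF f] hom[OF g]]])
        fix v assume v: "v \<in> ob_map ?M C"
        then obtain u where u: "v = ?c C u" "u \<in> Hom ?T C X" using ob C by auto
        have "Comp ?T u (Comp ?T f g) = Comp ?T (Comp ?T u f) g"
          by (rule category.assoc[OF category_Top g' f' u(2)])
        then show "fn (arr_map ?M (Comp test_cat g f)) v = fn (Comp Set (arr_map ?M g) (arr_map ?M f)) v"
          using fnarr[OF gf u(2)] fnarr[OF f u(2)] fnarr[OF g category.comp_hom[OF category_Top f' u(2)]]
            u(1) fn_Comp_Set[OF hom[OF f] v] by simp
      qed
    qed
  qed (rule category_test_cat[OF inacc] category_Set)+
  show ?thesis
    unfolding presents_def
  proof (intro conjI ballI M X)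
    show "bij_betw (?c B) (Hom ?T B X) (ob_map ?M B)" if "B \<in> sketch_spaces" for B
      using that hom_code_inj by (simp add: bij_betw_def ob)
    show "?c A (Comp ?T u f) = fn (arr_map ?M f) (?c B u)"
      if "A \<in> sketch_spaces" "B \<in> sketch_spaces" "f \<in> Hom ?T A B" "u \<in> Hom ?T B X" for A B f u
      using fnarr[of f B A u] that by (simp add: Hom_test_cat)
  qed
qed

lemma presentsD:
  assumes "presents X M \<theta>"
  shows "is_functor test_cat Set M" "small TYPE('u) (topspace X)"
    "\<And>B. B \<in> sketch_spaces \<Longrightarrow> bij_betw (\<theta> B) (Hom (Top TYPE('u)) B X) (ob_map M B)"
    "\<And>A B f u. A \<in> sketch_spaces \<Longrightarrow> B \<in> sketch_spaces \<Longrightarrow> f \<in> Hom (Top TYPE('u)) A B \<Longrightarrow>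
      u \<in> Hom (Top TYPE('u)) B X \<Longrightarrow> \<theta> A (Comp (Top TYPE('u)) u f) = fn (arr_map M f) (\<theta> B u)"
    "\<And>B u. B \<in> sketch_spaces \<Longrightarrow> u \<in> Hom (Top TYPE('u)) B X \<Longrightarrow> \<theta> B u \<in> ob_map M B"
    "\<And>B u v. B \<in> sketch_spaces \<Longrightarrow> u \<in> Hom (Top TYPE('u)) B X \<Longrightarrow> v \<in> Hom (Top TYPE('u)) B X \<Longrightarrow>
      \<theta> B u = \<theta> B v \<Longrightarrow> u = v"
    "\<And>B m. B \<in> sketch_spaces \<Longrightarrow> m \<in> ob_map M B \<Longrightarrow> \<exists>u\<in>Hom (Top TYPE('u)) B X. \<theta> B u = m"
proof -
  show bij: "bij_betw (\<theta> B) (Hom (Top TYPE('u)) B X) (ob_map M B)" if "B \<in> sketch_spaces" for B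
    using assms that by (simp add: presents_def)
  show "\<theta> B u \<in> ob_map M B" if "B \<in> sketch_spaces" "u \<in> Hom (Top TYPE('u)) B X" for B u
    by (rule bij_betw_apply[OF bij[OF that(1)] that(2)])
  show "u = v" if "B \<in> sketch_spaces" "u \<in> Hom (Top TYPE('u)) B X" "v \<in> Hom (Top TYPE('u)) B X"
    "\<theta> B u = \<theta> B v" for B u v
    using inj_onD[OF bij_betw_imp_inj_on[OF bij[OF that(1)]]] that by blast
  show "\<exists>u\<in>Hom (Top TYPE('u)) B X. \<theta> B u = m" if "B \<in> sketch_spaces" "m \<in> ob_map M B" for B m
  proof -
    have "m \<in> \<theta> B ` Hom (Top TYPE('u)) B X" using bij_betw_imp_surj_on[OF bij[OF that(1)]] that(2) by simp
    then obtain u where "m = \<theta> B u" "u \<in> Hom (Top TYPE('u)) B X" by (rule imageE)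
    then show ?thesis by (intro bexI[of _ u]) simp_all
  qed
qed (use assms in \<open>auto simp: presents_def\<close>)

context
  fixes X Y :: "'u topology" and M N and \<theta> \<theta>'
  assumes XM: "presents X M \<theta>" and YN: "presents Y N \<theta>'"
begin

lemma tracked_nat_trans_unique:
  assumes "nat_trans test_cat Set M N \<eta>" "tracks X \<theta> \<theta>' g \<eta>"
    and "nat_trans test_cat Set M N \<mu>" "tracks X \<theta> \<theta>' g \<mu>"
  shows "\<eta> = \<mu>"
proof (rule extensionalityI[OF nat_transD(3)[OF assms(1)] nat_transD(3)[OF assms(3)]])
  fix B :: "'u topology" assume B: "B \<in> Obj test_cat"
  show "\<eta> B = \<mu> B"
  proof (rule fn_eqI[OF nat_transD(4)[OF assms(1) B] nat_transD(4)[OF assms(3) B]])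
    fix m assume "m \<in> ob_map M B"
    then obtain u where "u \<in> Hom (Top TYPE('u)) B X" "\<theta> B u = m" using presentsD(7)[OF XM] B by auto
    then show "fn (\<eta> B) m = fn (\<mu> B) m" using assms(2,4) B by (auto simp: tracks_def)
  qed
qed

lemma tracked_arrow_unique:
  assumes g: "g \<in> Hom (Top TYPE('u)) X Y" "tracks X \<theta> \<theta>' g \<eta>"
    and h: "h \<in> Hom (Top TYPE('u)) X Y" "tracks X \<theta> \<theta>' h \<eta>"
  shows "g = h"
proof (rule Hom_Top_eqI[OF g(1) h(1)])
  fix x assume x: "x \<in> topspace X"
  note px = point_hom[OF inacc presentsD(2)[OF XM] x] and one = one_sketch[OF inacc]
  have "Comp (Top TYPE('u)) g (point x X) = Comp (Top TYPE('u)) h (point x X)"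
    by (rule presentsD(6)[OF YN one category.comp_hom[OF category_Top px g(1)]
          category.comp_hom[OF category_Top px h(1)]])
      (use g(2) h(2) one px in \<open>auto simp: tracks_def\<close>)
  then have "fn (Comp (Top TYPE('u)) g (point x X)) undefined = fn (Comp (Top TYPE('u)) h (point x X)) undefined"
    by simp
  then show "fn g x = fn h x" using fn_Comp_Top[OF px] by simp
qed

lemma tracking_nat_trans_exists:
  assumes g: "g \<in> Hom (Top TYPE('u)) X Y"
  shows "\<exists>\<eta>. nat_trans test_cat Set M N \<eta> \<and> tracks X \<theta> \<theta>' g \<eta>"
proof -
  let ?T = "Top TYPE('u)"
  define \<eta> where "\<eta> = (\<lambda>B\<in>sketch_spaces. Arrow (ob_map M B)
    (\<lambda>m\<in>ob_map M B. \<theta>' B (Comp ?T g (inv_into (Hom ?T B X) (\<theta> B) m))) (ob_map N B))"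
  have \<eta>\<theta>: "fn (\<eta> B) (\<theta> B u) = \<theta>' B (Comp ?T g u)" if B: "B \<in> sketch_spaces" and u: "u \<in> Hom ?T B X" for B u
    using B presentsD(5)[OF XM B u] inv_into_f_f[OF bij_betw_imp_inj_on[OF presentsD(3)[OF XM B]] u]
    by (simp add: \<eta>_def)
  have hom: "\<eta> B \<in> Hom Set (ob_map M B) (ob_map N B)" if B: "B \<in> sketch_spaces" for B
  proof -
    have "\<theta>' B (Comp ?T g (inv_into (Hom ?T B X) (\<theta> B) m)) \<in> ob_map N B" if m: "m \<in> ob_map M B" for m
      using presentsD(5)[OF YN B category.comp_hom[OF category_Top _ g]]
        inv_into_into[of m "\<theta> B" "Hom ?T B X"] bij_betw_imp_surj_on[OF presentsD(3)[OF XM B]] m by blast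
    then show ?thesis
      using B presheaf_small[OF inacc presentsD(1)[OF XM] B] presheaf_small[OF inacc presentsD(1)[OF YN] B]
      by (simp add: \<eta>_def Hom_Set)
  qed
  have "nat_trans test_cat Set M N \<eta>"
    unfolding nat_trans_def
  proof (intro conjI ballI presentsD(1)[OF XM] presentsD(1)[OF YN])
    show "\<eta> \<in> extensional (Obj test_cat)" by (simp add: \<eta>_def)
    show "\<eta> B \<in> Hom Set (ob_map M B) (ob_map N B)" if "B \<in> Obj test_cat" for B
      using that hom by simp
    fix f :: "'u space_arrow" assume "f \<in> Arr test_cat"
    then have "f \<in> Hom test_cat (tgt f) (src f)" using Arr_Hom[of f test_cat] by simp
    then have A: "src f \<in> sketch_spaces" and B: "tgt f \<in> sketch_spaces"
      and f: "f \<in> Hom ?T (src f) (tgt f)" by (simp_all only: Hom_test_cat)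
    note Mf = presheaf_hom[OF inacc presentsD(1)[OF XM] A B f] and Nf = presheaf_hom[OF inacc presentsD(1)[OF YN] A B f]
    have "Comp Set (arr_map N f) (\<eta> (tgt f)) = Comp Set (\<eta> (src f)) (arr_map M f)"
    proof (rule fn_eqI[OF category.comp_hom[OF category_Set hom[OF B] Nf]
          category.comp_hom[OF category_Set Mf hom[OF A]]])
      fix m assume m: "m \<in> ob_map M (tgt f)"
      then obtain u where u: "u \<in> Hom ?T (tgt f) X" "\<theta> (tgt f) u = m" using presentsD(7)[OF XM B] by blast
      note gu = category.comp_hom[OF category_Top u(1) g] and uf = category.comp_hom[OF category_Top f u(1)]
      have "fn (arr_map N f) (fn (\<eta> (tgt f)) m) = \<theta>' (src f) (Comp ?T (Comp ?T g u) f)"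
        using \<eta>\<theta>[OF B u(1)] u(2) presentsD(4)[OF YN A B f gu] by simp
      also have "\<dots> = fn (\<eta> (src f)) (fn (arr_map M f) m)"
        using \<eta>\<theta>[OF A uf] presentsD(4)[OF XM A B f u(1)] u(2) category.assoc[OF category_Top f u(1) g] by simp
      finally show "fn (Comp Set (arr_map N f) (\<eta> (tgt f))) m = fn (Comp Set (\<eta> (src f)) (arr_map M f)) m"
        using fn_Comp_Set[OF hom[OF B] m] fn_Comp_Set[OF Mf m] by simp
    qed
    then show "Comp Set (arr_map N f) (\<eta> (Dom test_cat f)) = Comp Set (\<eta> (Cod test_cat f)) (arr_map M f)"
      by (simp del: Set_sel)
  qed
  moreover have "tracks X \<theta> \<theta>' g \<eta>" using \<eta>\<theta> by (simp add: tracks_def)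
  ultimately show ?thesis by blast
qed

text \<open>
  The component of \<open>\<eta>\<close> at the one-point space is a function \<open>g\<close> from the points of \<open>X\<close> to
  those of \<open>Y\<close>. Naturality with respect to the points of \<open>B\<close> shows that \<open>\<eta>\<close> is composition with
  \<open>g\<close> on all test spaces. So \<open>g\<close> preserves convergent nets and hence is continuous.
\<close>

lemma tracked_arrow_exists:
  assumes \<eta>: "nat_trans test_cat Set M N \<eta>"
  shows "\<exists>g\<in>Hom (Top TYPE('u)) X Y. tracks X \<theta> \<theta>' g \<eta>"
proof -
  let ?T = "Top TYPE('u)" and ?one = "one_space :: 'u topology"
  note one = one_sketch[OF inacc]
  have hom: "\<eta> B \<in> Hom Set (ob_map M B) (ob_map N B)" if "B \<in> sketch_spaces" for B
    using nat_transD(4)[OF \<eta>, of B] that by simp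
  have \<eta>mem: "fn (\<eta> B) (\<theta> B u) \<in> ob_map N B" if "B \<in> sketch_spaces" "u \<in> Hom ?T B X" for B u
    using hom[OF that(1)] presentsD(5)[OF XM that] by (auto simp: Hom_Set)
  have pt: "point x X \<in> Hom ?T ?one X" if "x \<in> topspace X" for x
    by (rule point_hom[OF inacc presentsD(2)[OF XM] that])
  have "\<exists>s. s \<in> Hom ?T ?one Y \<and> \<theta>' ?one s = fn (\<eta> ?one) (\<theta> ?one (point x X))" if x: "x \<in> topspace X" for x
    using presentsD(7)[OF YN one \<eta>mem[OF one pt[OF x]]] by blast
  then obtain s where s: "\<And>x. x \<in> topspace X \<Longrightarrow> s x \<in> Hom ?T ?one Y"
    and \<theta>s: "\<And>x. x \<in> topspace X \<Longrightarrow> \<theta>' ?one (s x) = fn (\<eta> ?one) (\<theta> ?one (point x X))" by metis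
  define g where "g x = fn (s x) undefined" for x
  have gY: "g x \<in> topspace Y" if "x \<in> topspace X" for x
    using Hom_Top_mem[OF s[OF that]] by (simp add: g_def)
  \<comment> \<open>naturality at the points of \<open>B\<close> identifies the image of \<open>u\<close> as \<open>g \<circ> u\<close>\<close>
  have key: "\<exists>w. w \<in> Hom ?T B Y \<and> \<theta>' B w = fn (\<eta> B) (\<theta> B u) \<and> (\<forall>b\<in>topspace B. fn w b = g (fn u b))"
    if B: "B \<in> sketch_spaces" and u: "u \<in> Hom ?T B X" for B u
  proof -
    obtain w where w: "w \<in> Hom ?T B Y" "\<theta>' B w = fn (\<eta> B) (\<theta> B u)"
      using presentsD(7)[OF YN B \<eta>mem[OF B u]] by blast
    have "fn w b = g (fn u b)" if b: "b \<in> topspace B" for b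
    proof -
      note pb = point_hom_sketch[OF inacc B b]
      have "point b B \<in> Hom test_cat B ?one" using pb B one by (simp add: Hom_test_cat)
      note nat = nat_transD(5)[OF \<eta> this]
      note Mp = presheaf_hom[OF inacc presentsD(1)[OF XM] one B pb]
      note \<theta>u = presentsD(5)[OF XM B u]
      have up: "Comp ?T u (point b B) = point (fn u b) X"
        by (rule Hom_Top_eqI[OF category.comp_hom[OF category_Top pb u] pt[OF Hom_Top_mem[OF u b]]])
          (use fn_Comp_Top[OF pb] in simp)
      have "\<theta>' ?one (Comp ?T w (point b B)) = fn (arr_map N (point b B)) (fn (\<eta> B) (\<theta> B u))"
        using presentsD(4)[OF YN one B pb w(1)] w(2) by simp
      also have "\<dots> = fn (\<eta> ?one) (fn (arr_map M (point b B)) (\<theta> B u))"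
        using arg_cong[OF nat, of "\<lambda>f. fn f (\<theta> B u)"] fn_Comp_Set[OF hom[OF B] \<theta>u] fn_Comp_Set[OF Mp \<theta>u]
        by (simp del: Set_sel)
      also have "\<dots> = \<theta>' ?one (s (fn u b))"
        using presentsD(4)[OF XM one B pb u] up \<theta>s[OF Hom_Top_mem[OF u b]] by simp
      finally have "Comp ?T w (point b B) = s (fn u b)"
        by (rule presentsD(6)[OF YN one category.comp_hom[OF category_Top pb w(1)] s[OF Hom_Top_mem[OF u b]]])
      then show ?thesis using fn_Comp_Top[OF pb, of undefined w] by (simp add: g_def)
    qed
    with w show ?thesis by blast
  qed
  have "continuous_map X Y g"
  proof (rule continuous_map_by_nets[OF inacc presentsD(2)[OF XM] presentsD(2)[OF YN]])
    show "g \<in> topspace X \<rightarrow> topspace Y" using gY by blast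
    fix P :: "'u rel" and u assume P: "small_directed P" and u: "continuous_map (net_space P) X u"
    have N: "net_space P \<in> sketch_spaces" by (rule basic_in_sketch[OF net_basic[OF P]])
    have "top_map (net_space P) u X \<in> Hom ?T (net_space P) X"
      by (rule top_map_hom[OF small_net_space(1)[OF inacc P] presentsD(2)[OF XM] u])
    from key[OF N this] obtain w where w: "w \<in> Hom ?T (net_space P) Y"
      "\<forall>b\<in>topspace (net_space P). fn w b = g (fn (top_map (net_space P) u X) b)" by blast
    have "continuous_map (net_space P) Y (fn w)" using w(1) by (simp add: Hom_Top)
    then show "continuous_map (net_space P) Y (\<lambda>p. g (u p))"
      by (rule continuous_map_eq) (use w(2) in simp)
  qed
  then have G: "top_map X g Y \<in> Hom ?T X Y" by (rule top_map_hom[OF presentsD(2)[OF XM] presentsD(2)[OF YN]])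
  moreover have "tracks X \<theta> \<theta>' (top_map X g Y) \<eta>"
    unfolding tracks_def
  proof (intro ballI)
    fix B u assume B: "B \<in> sketch_spaces" and u: "u \<in> Hom ?T B X"
    obtain w where w: "w \<in> Hom ?T B Y" "\<theta>' B w = fn (\<eta> B) (\<theta> B u)"
      "\<forall>b\<in>topspace B. fn w b = g (fn u b)" using key[OF B u] by blast
    have "Comp ?T (top_map X g Y) u = w"
      by (rule Hom_Top_eqI[OF category.comp_hom[OF category_Top u G] w(1)])
        (use w(3) fn_Comp_Top[OF u] Hom_Top_mem[OF u] in simp)
    then show "fn (\<eta> B) (\<theta> B u) = \<theta>' B (Comp ?T (top_map X g Y) u)" using w(2) by simp
  qed
  ultimately show ?thesis by blast
qed

end

lemma tracks_comp:
  assumes XM: "presents X M \<theta>" and YN: "presents Y N \<theta>'"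
    and \<eta>: "nat_trans test_cat Set M N \<eta>" "tracks X \<theta> \<theta>' g \<eta>" and \<mu>: "tracks Y \<theta>' \<theta>'' h \<mu>"
    and g: "g \<in> Hom (Top TYPE('u)) X Y" and h: "h \<in> Hom (Top TYPE('u)) Y Z"
  shows "tracks X \<theta> \<theta>'' (Comp (Top TYPE('u)) h g) (\<lambda>B\<in>Obj test_cat. Comp Set (\<mu> B) (\<eta> B))"
  unfolding tracks_def
proof (intro ballI)
  fix B u assume B: "B \<in> sketch_spaces" and u: "u \<in> Hom (Top TYPE('u)) B X"
  have B': "B \<in> Obj test_cat" using B by simp
  have "fn (Comp Set (\<mu> B) (\<eta> B)) (\<theta> B u) = fn (\<mu> B) (fn (\<eta> B) (\<theta> B u))"
    by (rule fn_Comp_Set[OF nat_transD(4)[OF \<eta>(1) B'] presentsD(5)[OF XM B u]])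
  also have "\<dots> = \<theta>'' B (Comp (Top TYPE('u)) h (Comp (Top TYPE('u)) g u))"
    using \<eta>(2) \<mu> B u category.comp_hom[OF category_Top u g] by (simp add: tracks_def)
  finally show "fn ((\<lambda>B\<in>Obj test_cat. Comp Set (\<mu> B) (\<eta> B)) B) (\<theta> B u) =
      \<theta>'' B (Comp (Top TYPE('u)) (Comp (Top TYPE('u)) h g) u)"
    using B category.assoc[OF category_Top u g h] by (simp del: Set_sel)
qed

lemma tracks_id:
  assumes XM: "presents X M \<theta>"
  shows "tracks X \<theta> \<theta> (Id (Top TYPE('u)) X) (\<lambda>B\<in>Obj test_cat. Id Set (ob_map M B))"
  unfolding tracks_def
proof (intro ballI)
  fix B u assume B: "B \<in> sketch_spaces" and u: "u \<in> Hom (Top TYPE('u)) B X"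
  have "Comp (Top TYPE('u)) (Id (Top TYPE('u)) X) u = u" by (rule category.id_left[OF category_Top u])
  then show "fn ((\<lambda>B\<in>Obj test_cat. Id Set (ob_map M B)) B) (\<theta> B u) =
    \<theta> B (Comp (Top TYPE('u)) (Id (Top TYPE('u)) X) u)"
    using B presentsD(5)[OF XM B u] by (simp del: Top_sel)
qed

lemma hom_trans:
  assumes g: "g \<in> Hom (Top TYPE('u)) X Y"
  shows "nat_trans test_cat Set (hom_presheaf X) (hom_presheaf Y) (hom_trans g)"
    "tracks X (hom_code X) (hom_code Y) g (hom_trans g)"
proof -
  have X: "small TYPE('u) (topspace X)" and Y: "small TYPE('u) (topspace Y)"
    and s: "src g = X" and t: "tgt g = Y" using g by (auto simp: Hom_Top)
  note e = tracking_nat_trans_exists[OF presents_hom_presheaf[OF X] presents_hom_presheaf[OF Y] g]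
  show "nat_trans test_cat Set (hom_presheaf X) (hom_presheaf Y) (hom_trans g)"
    "tracks X (hom_code X) (hom_code Y) g (hom_trans g)"
    using someI_ex[OF e] unfolding hom_trans_def s t by blast+
qed

lemma hom_functor_sel:
  "small TYPE('u) (topspace X) \<Longrightarrow> ob_map hom_functor X = hom_presheaf X"
  "g \<in> Hom (Top TYPE('u)) X Y \<Longrightarrow> arr_map hom_functor g = Arrow (hom_presheaf X) (hom_trans g) (hom_presheaf Y)"
  by (auto simp: hom_functor_def Hom_def)

lemma model_hom_presheaf: "small TYPE('u) (topspace X) \<Longrightarrow> model (top_sketch TYPE('u)) (hom_presheaf X)"
  by (rule presents_model[OF inacc presents_hom_presheaf])

lemma is_functor_hom_functor: "is_functor (Top TYPE('u)) ModT hom_functor"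
proof (rule is_functorI)
  let ?T = "Top TYPE('u)"
  show "ob_map hom_functor \<in> extensional (Obj ?T)" "arr_map hom_functor \<in> extensional (Arr ?T)"
    by (simp_all add: hom_functor_def)
  show "ob_map hom_functor X \<in> Obj ModT" if "X \<in> Obj ?T" for X
    using that model_hom_presheaf by (simp add: hom_functor_sel)
  fix f X Y assume f: "f \<in> Hom ?T X Y"
  then have X: "small TYPE('u) (topspace X)" and Y: "small TYPE('u) (topspace Y)" by (auto simp: Hom_Top)
  show "arr_map hom_functor f \<in> Hom ModT (ob_map hom_functor X) (ob_map hom_functor Y)"
    using hom_trans(1)[OF f] model_hom_presheaf X Y by (simp add: hom_functor_sel f Hom_Mod hom_functor_sel(2)[OF f])
  fix g Z assume g: "g \<in> Hom ?T Y Z"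
  then have Z: "small TYPE('u) (topspace Z)" by (auto simp: Hom_Top)
  note gf = category.comp_hom[OF category_Top f g]
  note pX = presents_hom_presheaf[OF X] and pY = presents_hom_presheaf[OF Y] and pZ = presents_hom_presheaf[OF Z]
  have "hom_trans (Comp ?T g f) = (\<lambda>B\<in>Obj test_cat. Comp Set (hom_trans g B) (hom_trans f B))"
    by (rule tracked_nat_trans_unique[OF pX pZ hom_trans[OF gf] nat_trans_comp[OF hom_trans(1)[OF f] hom_trans(1)[OF g]]
          tracks_comp[OF pX pY hom_trans[OF f] hom_trans(2)[OF g] f g]])
  then show "arr_map hom_functor (Comp ?T g f) = Comp ModT (arr_map hom_functor g) (arr_map hom_functor f)"
    by (simp add: hom_functor_sel(2)[OF f] hom_functor_sel(2)[OF g] hom_functor_sel(2)[OF gf] del: Set_sel)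
next
  let ?T = "Top TYPE('u)"
  fix X assume "X \<in> Obj ?T"
  then have X: "small TYPE('u) (topspace X)" by simp
  have idX: "Id ?T X \<in> Hom ?T X X" by (rule category.id_hom[OF category_Top]) (use X in simp)
  note pX = presents_hom_presheaf[OF X]
  have "hom_trans (Id ?T X) = (\<lambda>B\<in>Obj test_cat. Id Set (ob_map (hom_presheaf X) B))"
    by (rule tracked_nat_trans_unique[OF pX pX hom_trans[OF idX] nat_trans_id[OF presentsD(1)[OF pX]] tracks_id[OF pX]])
  then show "arr_map hom_functor (Id ?T X) = Id ModT (ob_map hom_functor X)"
    by (simp add: hom_functor_sel(1)[OF X] hom_functor_sel(2)[OF idX] del: Set_sel Top_sel)
qed (rule category_Top category_Mod)+

lemma fully_faithful_hom_functor: "fully_faithful (Top TYPE('u)) ModT hom_functor"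
  unfolding fully_faithful_def
proof (intro ballI)
  let ?T = "Top TYPE('u)"
  fix X Y assume "X \<in> Obj ?T" "Y \<in> Obj ?T"
  then have X: "small TYPE('u) (topspace X)" and Y: "small TYPE('u) (topspace Y)" by simp_all
  note pX = presents_hom_presheaf[OF X] and pY = presents_hom_presheaf[OF Y]
  show "bij_betw (arr_map hom_functor) (Hom ?T X Y) (Hom ModT (ob_map hom_functor X) (ob_map hom_functor Y))"
    unfolding bij_betw_def
  proof
    show "inj_on (arr_map hom_functor) (Hom ?T X Y)"
    proof (rule inj_onI)
      fix g h assume g: "g \<in> Hom ?T X Y" and h: "h \<in> Hom ?T X Y"
        and "arr_map hom_functor g = arr_map hom_functor h"
      then have "hom_trans g = hom_trans h" by (simp add: hom_functor_sel(2)[OF g] hom_functor_sel(2)[OF h])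
      then show "g = h" using tracked_arrow_unique[OF pX pY g hom_trans(2)[OF g] h] hom_trans(2)[OF h] by simp
    qed
    show "arr_map hom_functor ` Hom ?T X Y = Hom ModT (ob_map hom_functor X) (ob_map hom_functor Y)"
    proof
      show "arr_map hom_functor ` Hom ?T X Y \<subseteq> Hom ModT (ob_map hom_functor X) (ob_map hom_functor Y)"
        using functor_hom[OF is_functor_hom_functor] by blast
      show "Hom ModT (ob_map hom_functor X) (ob_map hom_functor Y) \<subseteq> arr_map hom_functor ` Hom ?T X Y"
      proof
        fix k assume "k \<in> Hom ModT (ob_map hom_functor X) (ob_map hom_functor Y)"
        then have k: "nat_trans test_cat Set (hom_presheaf X) (hom_presheaf Y) (fn k)"
          and kk: "k = Arrow (hom_presheaf X) (fn k) (hom_presheaf Y)"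
          by (auto simp: Hom_Mod hom_functor_sel(1)[OF X] hom_functor_sel(1)[OF Y] intro: arrow.expand)
        obtain g where g: "g \<in> Hom ?T X Y" "tracks X (hom_code X) (hom_code Y) g (fn k)"
          using tracked_arrow_exists[OF pX pY k] by blast
        have "hom_trans g = fn k"
          by (rule tracked_nat_trans_unique[OF pX pY hom_trans[OF g(1)] k g(2)])
        then have "arr_map hom_functor g = k" using kk by (simp add: hom_functor_sel(2)[OF g(1)])
        then show "k \<in> arr_map hom_functor ` Hom ?T X Y" using g(1) by blast
      qed
    qed
  qed
qed

text \<open>
  Both transformations tracked by the identity of \<open>X\<close> exist, and by uniqueness they are mutually
  inverse.
\<close>

lemma presented_iso:
  fixes X :: "'u topology"
  assumes XM: "presents X M \<theta>" and XN: "presents X N \<theta>'"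
  shows "\<exists>m n. inverse_arrows ModT M N m n"
proof -
  let ?T = "Top TYPE('u)"
  have X: "small TYPE('u) (topspace X)" by (rule presentsD(2)[OF XM])
  have idX: "Id ?T X \<in> Hom ?T X X" by (rule category.id_hom[OF category_Top]) (use X in simp)
  have idid: "Comp ?T (Id ?T X) (Id ?T X) = Id ?T X" by (rule category.id_left[OF category_Top idX])
  obtain \<eta> where \<eta>: "nat_trans test_cat Set M N \<eta>" "tracks X \<theta> \<theta>' (Id ?T X) \<eta>"
    using tracking_nat_trans_exists[OF XM XN idX] by blast
  obtain \<mu> where \<mu>: "nat_trans test_cat Set N M \<mu>" "tracks X \<theta>' \<theta> (Id ?T X) \<mu>"
    using tracking_nat_trans_exists[OF XN XM idX] by blast
  have 1: "(\<lambda>B\<in>Obj test_cat. Comp Set (\<mu> B) (\<eta> B)) = (\<lambda>B\<in>Obj test_cat. Id Set (ob_map M B))"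
    by (rule tracked_nat_trans_unique[OF XM XM nat_trans_comp[OF \<eta>(1) \<mu>(1)]
          tracks_comp[OF XM XN \<eta> \<mu>(2) idX idX, unfolded idid] nat_trans_id[OF presentsD(1)[OF XM]] tracks_id[OF XM]])
  have 2: "(\<lambda>B\<in>Obj test_cat. Comp Set (\<eta> B) (\<mu> B)) = (\<lambda>B\<in>Obj test_cat. Id Set (ob_map N B))"
    by (rule tracked_nat_trans_unique[OF XN XN nat_trans_comp[OF \<mu>(1) \<eta>(1)]
          tracks_comp[OF XN XM \<mu> \<eta>(2) idX idX, unfolded idid] nat_trans_id[OF presentsD(1)[OF XN]] tracks_id[OF XN]])
  have "inverse_arrows ModT M N (Arrow M \<eta> N) (Arrow N \<mu> M)"
    unfolding inverse_arrows_def
    using \<eta>(1) \<mu>(1) 1 2 presents_model[OF inacc XM] presents_model[OF inacc XN]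
    by (simp add: Hom_Mod del: Set_sel)
  then show ?thesis by blast
qed

lemma model_iso_hom_presheaf:
  assumes "model (top_sketch TYPE('u)) M"
  obtains X m n where "small TYPE('u) (topspace X)" "inverse_arrows ModT (ob_map hom_functor X) M m n"
proof -
  obtain X \<theta> where XM: "presents X M \<theta>" using model_presented[OF inacc assms] by blast
  note X = presentsD(2)[OF XM]
  show ?thesis
    using that[OF X] presented_iso[OF presents_hom_presheaf[OF X] XM] by (auto simp: hom_functor_sel(1)[OF X])
qed

lemma essentially_surjective_hom_functor: "essentially_surjective (Top TYPE('u)) ModT hom_functor"
  unfolding essentially_surjective_def
proof
  fix M :: "'u presheaf" assume "M \<in> Obj ModT"
  then have "model (top_sketch TYPE('u)) M" by simp
  then obtain X m n where "small TYPE('u) (topspace X)" "inverse_arrows ModT (ob_map hom_functor X) M m n"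
    by (rule model_iso_hom_presheaf)
  then show "\<exists>X\<in>Obj (Top TYPE('u)). \<exists>m n. inverse_arrows ModT (ob_map hom_functor X) M m n" by auto
qed

text \<open>
  The colimit diagram that presents the space \<open>X\<close> by its nets consists of test spaces, and the
  equivalence takes it to a colimit diagram of representable models.
\<close>

theorem models_small:
  assumes M: "model (top_sketch TYPE('u)) M"
  shows "small_model TYPE('u) (top_sketch TYPE('u)) M"
proof -
  let ?T = "Top TYPE('u)"
  obtain X m n where X: "small TYPE('u) (topspace X)"
    and mn: "inverse_arrows ModT (ob_map hom_functor X) M m n"
    by (rule model_iso_hom_presheaf[OF M])
  let ?S = "topspace X"
  show ?thesis
  proof (rule space_colimit_of_nets[OF inacc X])
    fix P :: "'u \<Rightarrow> 'u rel" and x assume P: "\<And>p. p \<in> ?S \<Longrightarrow> small_directed (P p)"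
      and col: "colimit_cocone ?T (nets_cocone X P x)"
        (is "colimit_cocone _ ?K")
    have D: "ob_map (diagram ?K) i \<in> sketch_spaces" if "i \<in> Obj (shape ?K)" for i
      using that P basic_in_sketch[OF discrete_basic[OF X]] basic_in_sketch[OF net_basic[OF P]]
        basic_in_sketch[OF sum_basic[OF inacc]] by auto
    have mn': "inverse_arrows ModT (ob_map hom_functor (vertex ?K)) M m n" using mn by simp
    let ?K1 = "\<lparr>shape = shape ?K, diagram = comp_functor (shape ?K) hom_functor (diagram ?K),
       vertex = M, leg = (\<lambda>i\<in>Obj (shape ?K). Comp ModT m (arr_map hom_functor (leg ?K i)))\<rparr>"
    have col1: "colimit_cocone ModT ?K1"
      by (rule colimit_under_equivalence[OF is_functor_hom_functor fully_faithful_hom_functor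
            essentially_surjective_hom_functor col mn'])
    have sm: "small_category TYPE('u) (shape ?K)" using small_category_spans_on[OF inacc X] by simp
    then have smO: "small TYPE('u) (Obj (shape ?K))" and smA: "small TYPE('u) (Arr (shape ?K))"
      by (simp_all add: small_category_def)
    obtain a :: "'u span_ob \<Rightarrow> 'u" where a: "inj_on a (Obj (shape ?K))" by (rule small_embed[OF smO])
    obtain b :: "'u span_arr \<Rightarrow> 'u" where b: "inj_on b (Arr (shape ?K))" by (rule small_embed[OF smA])
    have "inj_on a (Obj (shape ?K1))" "inj_on b (Arr (shape ?K1))" using a b by simp_all
    from colimit_reindex[OF col1 this] obtain K' where K': "shape K' = transport_cat a b (shape ?K)"
      "category (shape K')" "colimit_cocone ModT K'" "vertex K' = M"
      and DK': "\<And>i. i \<in> Obj (shape ?K) \<Longrightarrow>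
         ob_map (diagram K') (a i) = ob_map (comp_functor (shape ?K) hom_functor (diagram ?K)) i"
      by auto
    have objs: "Obj (shape K') = a ` Obj (shape ?K)" and arrs: "Arr (shape K') = b ` Arr (shape ?K)"
      unfolding K'(1) transport_cat_def by simp_all
    have "small_category TYPE('u) (shape K')"
      using K'(2) small_image[OF smO, of a] small_image[OF smA, of b]
      unfolding small_category_def objs arrs by blast
    moreover have "\<exists>A\<in>Obj (under (top_sketch TYPE('u))). represents (under (top_sketch TYPE('u))) A (ob_map (diagram K') i')"
      if "i' \<in> Obj (shape K')" for i'
    proof -
      have "i' \<in> a ` Obj (shape ?K)" using that unfolding objs .
      then obtain i where i: "i' = a i" "i \<in> Obj (shape ?K)" by (rule imageE)
      let ?A = "ob_map (diagram ?K) i"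
      have A: "?A \<in> sketch_spaces" by (rule D[OF i(2)])
      have "ob_map (diagram K') i' = hom_presheaf ?A"
        unfolding i(1) DK'[OF i(2)] comp_functor_sel(1)[OF i(2)]
        by (rule hom_functor_sel(1)[OF small_sketch_space[OF inacc A]])
      moreover have "represents test_cat ?A (hom_presheaf ?A)"
        using presents_iff_represents[OF inacc A] presents_hom_presheaf[OF small_sketch_space[OF inacc A]] by blast
      ultimately show ?thesis using A by auto
    qed
    ultimately show ?thesis unfolding small_model_def using K'(3,4) by blast
  qed
qed

end

theorem theorem1p4:
  assumes "inaccessible TYPE('u)"
  shows "limit_sketch TYPE('u) (top_sketch TYPE('u)) \<and>
    large_sketch TYPE('u) (top_sketch TYPE('u)) \<and>
    realized TYPE('u) (top_sketch TYPE('u)) \<and>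
    equivalent_categories (Top TYPE('u)) (Mod TYPE('u) (top_sketch TYPE('u))) \<and>
    (\<forall>M. model (top_sketch TYPE('u)) M \<longrightarrow> small_model TYPE('u) (top_sketch TYPE('u)) M)"
  using limit_sketch_top_sketch[OF assms] large_top_sketch[OF assms] realized_top_sketch[OF assms]
    equivalence_of_fully_faithful[OF is_functor_hom_functor[OF assms]
      fully_faithful_hom_functor[OF assms] essentially_surjective_hom_functor[OF assms]]
    models_small[OF assms] by blast

end
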